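(* Let $(R,\mathfrak m)$ be a noetherian local ring of mixed characteristic, let $p=\mathrm{char}(R/\mathfrak m)$, $i\geq0$ and $x_1,\dots,x_i\in R$. Then $$\{\mathfrak P\in\mathrm{Spec}(R)\mid p,x_1,\dots,x_i\text{ is part of a system of parameters of }R/\mathfrak P\}\subseteq\mathrm{Ass}_R\big(D(H^{i+1}_{(p,x_1,\dots,x_i)R}(R))\big).$$ If $i\geq1$, then moreover $$\{\mathfrak P\in\mathrm{Spec}(R)\mid p,x_1,\dots,x_i\text{ is part of a system of parameters of }R/\mathfrak P\}\subseteq\mathrm{Ass}_R\big(D(H^{i}_{(x_1,\dots,x_i)R}(R))\big).$$
   Context: $D(M)=\mathrm{Hom}_R(M,E_R(R/\mathfrak m))$ is the Matlis dual. For an arbitrary $R$-module $N$, $\mathrm{Ass}_R(N)$ is the set of prime ideals of the form $\mathrm{Ann}_R(n)$, $n\in N$. "Part of a system of parameters of $R/\mathfrak P$" refers to the images of the elements in $R/\mathfrak P$. *)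

theory Defs
  imports Main "HOL-Library.Extended_Nat"
begin

definition cideal :: "'a::comm_ring_1 set \<Rightarrow> bool" where
  "cideal I \<longleftrightarrow> 0 \<in> I \<and> (\<forall>a\<in>I. \<forall>b\<in>I. a + b \<in> I) \<and> (\<forall>a\<in>I. \<forall>r. r * a \<in> I)"

definition gen_ideal :: "'a::comm_ring_1 set \<Rightarrow> 'a set" where
  "gen_ideal A = \<Inter>{I. cideal I \<and> A \<subseteq> I}"

definition prime_ideal :: "'a::comm_ring_1 set \<Rightarrow> bool" where
  "prime_ideal P \<longleftrightarrow> cideal P \<and> (1::'a) \<notin> P \<and> (\<forall>a b. a * b \<in> P \<longrightarrow> a \<in> P \<or> b \<in> P)"

definition maximal_ideal :: "'a::comm_ring_1 set \<Rightarrow> bool" where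
  "maximal_ideal m \<longleftrightarrow> cideal m \<and> (1::'a) \<notin> m \<and>
     (\<forall>I. cideal I \<and> m \<subseteq> I \<longrightarrow> I = m \<or> (1::'a) \<in> I)"

definition noetherian_ring :: "'a::comm_ring_1 itself \<Rightarrow> bool" where
  "noetherian_ring _ \<longleftrightarrow> (\<forall>I::'a set. cideal I \<longrightarrow> (\<exists>F. finite F \<and> I = gen_ideal F))"

definition local_ring :: "'a::comm_ring_1 set \<Rightarrow> bool" where
  "local_ring m \<longleftrightarrow> maximal_ideal m \<and> (\<forall>m'. maximal_ideal m' \<longrightarrow> m' = m)"

definition residue_char :: "'a::comm_ring_1 set \<Rightarrow> nat" where
  "residue_char m = (if \<exists>n>0. (of_nat n::'a) \<in> m then LEAST n. n > 0 \<and> (of_nat n::'a) \<in> m else 0)"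

definition mixed_char :: "'a::comm_ring_1 set \<Rightarrow> bool" where
  "mixed_char m \<longleftrightarrow> CHAR('a) = 0 \<and> residue_char m > 0"

definition prime_chain :: "'a::comm_ring_1 set \<Rightarrow> 'a set list \<Rightarrow> bool" where
  "prime_chain P qs \<longleftrightarrow> qs \<noteq> [] \<and> hd qs = P \<and> (\<forall>q\<in>set qs. prime_ideal q) \<and> sorted_wrt (\<subset>) qs"

definition quot_dim :: "'a::comm_ring_1 set \<Rightarrow> enat" where
  "quot_dim P = Sup {enat (length qs - 1) | qs. prime_chain P qs}"

text \<open>the images of ys in R/P are part of a system of parameters of the local ring R/P:
  they can be completed by zs to dim(R/P) elements of the maximal ideal generating
  an ideal of R/P primary to the maximal ideal (only prime above it is m/P)\<close>
definition part_of_sop :: "'a::comm_ring_1 set \<Rightarrow> 'a set \<Rightarrow> 'a list \<Rightarrow> bool" where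
  "part_of_sop m P ys \<longleftrightarrow> (\<exists>zs. set (ys @ zs) \<subseteq> m \<and> enat (length (ys @ zs)) = quot_dim P \<and>
      (\<forall>Q. prime_ideal Q \<and> gen_ideal (P \<union> set (ys @ zs)) \<subseteq> Q \<longrightarrow> Q = m))"

record ('a, 'm) rmod =
  mcar :: "'m set"
  mzero :: 'm
  madd :: "'m \<Rightarrow> 'm \<Rightarrow> 'm"
  msmul :: "'a \<Rightarrow> 'm \<Rightarrow> 'm"

definition rmodule :: "('a::comm_ring_1, 'm) rmod \<Rightarrow> bool" where
  "rmodule M \<longleftrightarrow> mzero M \<in> mcar M \<and>
     (\<forall>x\<in>mcar M. \<forall>y\<in>mcar M. madd M x y \<in> mcar M) \<and>
     (\<forall>a. \<forall>x\<in>mcar M. msmul M a x \<in> mcar M) \<and>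
     (\<forall>x\<in>mcar M. \<forall>y\<in>mcar M. \<forall>z\<in>mcar M. madd M (madd M x y) z = madd M x (madd M y z)) \<and>
     (\<forall>x\<in>mcar M. \<forall>y\<in>mcar M. madd M x y = madd M y x) \<and>
     (\<forall>x\<in>mcar M. madd M (mzero M) x = x) \<and>
     (\<forall>x\<in>mcar M. \<exists>y\<in>mcar M. madd M x y = mzero M) \<and>
     (\<forall>a. \<forall>x\<in>mcar M. \<forall>y\<in>mcar M. msmul M a (madd M x y) = madd M (msmul M a x) (msmul M a y)) \<and>
     (\<forall>a b. \<forall>x\<in>mcar M. msmul M (a + b) x = madd M (msmul M a x) (msmul M b x)) \<and>
     (\<forall>a b. \<forall>x\<in>mcar M. msmul M (a * b) x = msmul M a (msmul M b x)) \<and>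
     (\<forall>x\<in>mcar M. msmul M 1 x = x)"

definition lin_map :: "('a::comm_ring_1, 'm) rmod \<Rightarrow> ('a, 'n) rmod \<Rightarrow> ('m \<Rightarrow> 'n) \<Rightarrow> bool" where
  "lin_map M N f \<longleftrightarrow> (\<forall>x\<in>mcar M. f x \<in> mcar N) \<and>
     (\<forall>x\<in>mcar M. \<forall>y\<in>mcar M. f (madd M x y) = madd N (f x) (f y)) \<and>
     (\<forall>a. \<forall>x\<in>mcar M. f (msmul M a x) = msmul N a (f x)) \<and>
     (\<forall>x. x \<notin> mcar M \<longrightarrow> f x = mzero N)"

definition hom_mod :: "('a::comm_ring_1, 'm) rmod \<Rightarrow> ('a, 'n) rmod \<Rightarrow> ('a, 'm \<Rightarrow> 'n) rmod" where
  "hom_mod M N = \<lparr> mcar = {f. lin_map M N f},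
     mzero = (\<lambda>x. mzero N),
     madd = (\<lambda>f g x. if x \<in> mcar M then madd N (f x) (g x) else mzero N),
     msmul = (\<lambda>a f x. if x \<in> mcar M then msmul N a (f x) else mzero N) \<rparr>"

definition ann :: "('a::comm_ring_1, 'm) rmod \<Rightarrow> 'm \<Rightarrow> 'a set" where
  "ann M x = {a. msmul M a x = mzero M}"

definition ass :: "('a::comm_ring_1, 'm) rmod \<Rightarrow> 'a set set" where
  "ass M = {P. prime_ideal P \<and> (\<exists>x\<in>mcar M. ann M x = P)}"

text \<open>injective module (via Baer's criterion)\<close>
definition injective_mod :: "('a::comm_ring_1, 'm) rmod \<Rightarrow> bool" where
  "injective_mod E \<longleftrightarrow> rmodule E \<and>
    (\<forall>I g. cideal I \<and> (\<forall>a\<in>I. g a \<in> mcar E) \<and>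
        (\<forall>a\<in>I. \<forall>b\<in>I. g (a + b) = madd E (g a) (g b)) \<and>
        (\<forall>r. \<forall>a\<in>I. g (r * a) = msmul E r (g a))
      \<longrightarrow> (\<exists>e\<in>mcar E. \<forall>a\<in>I. g a = msmul E a e))"

text \<open>E is an injective hull E_R(R/m): injective, and an essential extension of a
  submodule R e isomorphic to R/m (i.e. Ann(e) = m)\<close>
definition inj_hull_residue :: "('a::comm_ring_1, 'm) rmod \<Rightarrow> 'a set \<Rightarrow> bool" where
  "inj_hull_residue E m \<longleftrightarrow> injective_mod E \<and>
    (\<exists>e\<in>mcar E. ann E e = m \<and>
       (\<forall>v\<in>mcar E. v \<noteq> mzero E \<longrightarrow>
          (\<exists>r s. msmul E r v \<noteq> mzero E \<and> msmul E r v = msmul E s e)))"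

definition matlis_dual :: "('a::comm_ring_1, 'm) rmod \<Rightarrow> ('a, 'e) rmod \<Rightarrow> ('a, 'm \<Rightarrow> 'e) rmod" where
  "matlis_dual M E = hom_mod M E"

definition mcoset :: "('a::comm_ring_1, 'm) rmod \<Rightarrow> 'm set \<Rightarrow> 'm \<Rightarrow> 'm set" where
  "mcoset M N x = {y \<in> mcar M. \<exists>n\<in>N. y = madd M x n}"

definition quot_mod :: "('a::comm_ring_1, 'm) rmod \<Rightarrow> 'm set \<Rightarrow> ('a, 'm set) rmod" where
  "quot_mod M N = \<lparr> mcar = {mcoset M N x | x. x \<in> mcar M},
     mzero = mcoset M N (mzero M),
     madd = (\<lambda>A B. \<Union>{mcoset M N (madd M x y) | x y. x \<in> A \<and> y \<in> B}),
     msmul = (\<lambda>a A. \<Union>{mcoset M N (msmul M a x) | x. x \<in> A}) \<rparr>"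

definition loc_rel :: "'a::comm_ring_1 \<Rightarrow> (('a \<times> nat) \<times> ('a \<times> nat)) set" where
  "loc_rel f = {((r, k), (s, l)). \<exists>n. f ^ n * (r * f ^ l - s * f ^ k) = 0}"

text \<open>the class of the fraction r / f^k\<close>
definition lcls :: "'a::comm_ring_1 \<Rightarrow> 'a \<times> nat \<Rightarrow> ('a \<times> nat) set" where
  "lcls f q = loc_rel f `` {q}"

definition loc_mod :: "'a::comm_ring_1 \<Rightarrow> ('a, ('a \<times> nat) set) rmod" where
  "loc_mod f = \<lparr> mcar = range (lcls f),
     mzero = lcls f (0, 0),
     madd = (\<lambda>A B. \<Union>{lcls f (r * f ^ l + s * f ^ k, k + l) | r k s l. (r, k) \<in> A \<and> (s, l) \<in> B}),
     msmul = (\<lambda>a A. \<Union>{lcls f (a * r, k) | r k. (r, k) \<in> A}) \<rparr>"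

definition xprod :: "'a::comm_ring_1 list \<Rightarrow> nat set \<Rightarrow> 'a" where
  "xprod xs S = (\<Prod>j\<in>S. xs ! j)"

definition cidx :: "'a list \<Rightarrow> nat \<Rightarrow> nat set set" where
  "cidx xs k = {S. S \<subseteq> {..<length xs} \<and> card S = k}"

definition cech_mod :: "'a::comm_ring_1 list \<Rightarrow> nat \<Rightarrow> ('a, nat set \<Rightarrow> ('a \<times> nat) set) rmod" where
  "cech_mod xs k = \<lparr>
     mcar = {c. (\<forall>S\<in>cidx xs k. c S \<in> mcar (loc_mod (xprod xs S))) \<and> (\<forall>S. S \<notin> cidx xs k \<longrightarrow> c S = {})},
     mzero = (\<lambda>S. if S \<in> cidx xs k then mzero (loc_mod (xprod xs S)) else {}),
     madd = (\<lambda>c c' S. if S \<in> cidx xs k then madd (loc_mod (xprod xs S)) (c S) (c' S) else {}),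
     msmul = (\<lambda>a c S. if S \<in> cidx xs k then msmul (loc_mod (xprod xs S)) a (c S) else {}) \<rparr>"

text \<open>natural map R_{x_S} \<rightarrow> R_{x_T} for S \<subseteq> T: r/x_S^k \<mapsto> r x_{T-S}^k / x_T^k\<close>
definition lmap :: "'a::comm_ring_1 list \<Rightarrow> nat set \<Rightarrow> nat set \<Rightarrow> ('a \<times> nat) set \<Rightarrow> ('a \<times> nat) set" where
  "lmap xs S T A = \<Union>{lcls (xprod xs T) (r * xprod xs (T - S) ^ k, k) | r k. (r, k) \<in> A}"

definition msum :: "('a, 'm) rmod \<Rightarrow> ('b \<Rightarrow> 'm) \<Rightarrow> 'b list \<Rightarrow> 'm" where
  "msum M g L = foldr (\<lambda>j acc. madd M (g j) acc) L (mzero M)"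

definition cech_d :: "'a::comm_ring_1 list \<Rightarrow> nat \<Rightarrow> (nat set \<Rightarrow> ('a \<times> nat) set) \<Rightarrow> nat set \<Rightarrow> ('a \<times> nat) set" where
  "cech_d xs k c = (\<lambda>T. if T \<in> cidx xs (k + 1) then
      msum (loc_mod (xprod xs T))
        (\<lambda>j. msmul (loc_mod (xprod xs T)) ((-1) ^ card {t\<in>T. t < j}) (lmap xs (T - {j}) T (c (T - {j}))))
        (sorted_list_of_set T)
    else {})"

definition cech_ker :: "'a::comm_ring_1 list \<Rightarrow> nat \<Rightarrow> (nat set \<Rightarrow> ('a \<times> nat) set) set" where
  "cech_ker xs k = {c \<in> mcar (cech_mod xs k). cech_d xs k c = mzero (cech_mod xs (k + 1))}"

definition cech_img :: "'a::comm_ring_1 list \<Rightarrow> nat \<Rightarrow> (nat set \<Rightarrow> ('a \<times> nat) set) set" where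
  "cech_img xs k = (if k = 0 then {mzero (cech_mod xs 0)}
                    else cech_d xs (k - 1) ` mcar (cech_mod xs (k - 1)))"

definition local_coh :: "'a::comm_ring_1 list \<Rightarrow> nat \<Rightarrow> ('a, (nat set \<Rightarrow> ('a \<times> nat) set) set) rmod" where
  "local_coh xs k = quot_mod ((cech_mod xs k)\<lparr>mcar := cech_ker xs k\<rparr>) (cech_img xs k)"

end

theory Submission
  imports Defs "HOL.Modules" "HOL-Library.Function_Algebras"
begin

text \<open>Let \<open>ws = ys @ zs\<close> be a system of parameters of \<open>R/P\<close> with \<open>ys\<close> nonempty. An element of
  the Matlis dual of the top local cohomology of \<open>R\<close> at \<open>ys\<close> is a sequence \<open>g n\<close> in \<open>E\<close>, the
  images of the fractions \<open>1 / Y^n\<close> with \<open>Y = prod_list ys\<close>: it satisfies \<open>Y g (n + 1) = g n\<close>, and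
  \<open>g n\<close> is killed by \<open>y^n\<close> for every \<open>y\<close> in \<open>ys\<close>.

  For the full system \<open>ws\<close>, Grothendieck's nonvanishing theorem for \<open>R/P\<close> and the injectivity of
  \<open>E\<close> give a nonzero such sequence \<open>e\<close> that is killed by \<open>P\<close>. One with maximal annihilator has a prime
  annihilator \<open>Q\<close>, the top local cohomology of \<open>R/Q\<close> does not vanish, and Grothendieck's vanishing
  theorem forces \<open>Q = P\<close>. For \<open>ys\<close> one takes a lacunary series in multiples of \<open>e\<close>.

  Nonvanishing is obtained in the form: if local cohomology of \<open>R/I\<close> vanishes in degrees above \<open>c\<close>,
  then \<open>c\<close> elements generate an \<open>m\<close>-primary ideal modulo \<open>I\<close>. As the top module is Artinian, there is
  a nonzerodivisor \<open>x\<close> of \<open>R/I\<close> modulo which the top module has finite length; such a top module is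
  zero in positive degree, so \<open>x\<close> lowers the cohomological dimension.\<close>

section \<open>Ideals of Noetherian rings\<close>

text \<open>All modules in play are cyclic, R/I for an ideal I, linked by the sequences R/(I : x) ->
  R/I -> R/(I + xR). Noetherian induction on I therefore takes the place of prime filtrations,
  resolutions and derived functors. Cohomology of R/I is computed by Koszul complexes on powers,
  where a class is represented by ring elements and the top group is explicit; the Cech complex of R
  itself enters only at the end and only in top degree.

  That the full system has as many elements as dim R/P is used twice: it makes the top cohomology of
  R/P nonzero, and it excludes a prime annihilator strictly above P. The obstacle lies in a proper
  initial part of the system. Restricted to fractions with a fixed denominator in the remaining
  parameters, a functional is killed by powers of these parameters, so its annihilator is larger
  than P. Infinitely many restrictions must be added in such a way that each can be isolated again.
  Squares as exponents achieve this, because the gap (k + 1)^2 - k^2 = 2 k + 1 is unbounded.\<close>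

definition colon :: "'a::comm_ring_1 set \<Rightarrow> 'a \<Rightarrow> 'a set" where
  "colon I x = {a. x * a \<in> I}"

definition adj :: "'a::comm_ring_1 set \<Rightarrow> 'a \<Rightarrow> 'a set" where
  "adj I x = {i + r * x | i r. i \<in> I}"

lemma cideal_zero: "cideal I \<Longrightarrow> 0 \<in> I"
  and cideal_add: "cideal I \<Longrightarrow> a \<in> I \<Longrightarrow> b \<in> I \<Longrightarrow> a + b \<in> I"
  and cideal_mult: "cideal I \<Longrightarrow> a \<in> I \<Longrightarrow> r * a \<in> I"
  by (auto simp: cideal_def)

lemma cideal_mult2: "cideal I \<Longrightarrow> a \<in> I \<Longrightarrow> a * r \<in> I"
  using cideal_mult[of I a r] by (simp add: mult.commute)

lemma cideal_minus: "cideal I \<Longrightarrow> a \<in> I \<Longrightarrow> - a \<in> I"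
  using cideal_mult[of I a "-1"] by simp

lemma cideal_diff: "cideal I \<Longrightarrow> a \<in> I \<Longrightarrow> b \<in> I \<Longrightarrow> a - b \<in> I"
  using cideal_add[of I a "- b"] cideal_minus[of I b] by simp

lemma cideal_sum: "cideal I \<Longrightarrow> (\<And>x. x \<in> A \<Longrightarrow> f x \<in> I) \<Longrightarrow> sum f A \<in> I"
  by (induction A rule: infinite_finite_induct) (auto intro: cideal_zero cideal_add)

lemma cideal_eqD: "cideal I \<Longrightarrow> b \<in> I \<Longrightarrow> a - b \<in> I \<Longrightarrow> a \<in> I"
  using cideal_add[of I "a - b" b] by simp

lemma cideal_one: "cideal I \<Longrightarrow> 1 \<in> I \<Longrightarrow> a \<in> I"
  using cideal_mult[of I 1 a] by simp

lemma colon_ideal: "cideal I \<Longrightarrow> cideal (colon I x)"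
  by (auto simp: cideal_def colon_def distrib_left mult.left_commute)

lemma subset_colon: "cideal I \<Longrightarrow> I \<subseteq> colon I x"
  by (auto simp: colon_def intro: cideal_mult)

lemma adj_ideal: "cideal I \<Longrightarrow> cideal (adj I x)"
  unfolding cideal_def[of "adj I x"]
proof (intro conjI ballI allI)
  assume I: "cideal I"
  show "0 \<in> adj I x"
    unfolding adj_def using cideal_zero[OF I] by (auto intro!: exI[of _ 0])
  fix a b assume a: "a \<in> adj I x" 
  then obtain i r where ir: "i \<in> I" "a = i + r * x" by (auto simp: adj_def)
  { fix b assume "b \<in> adj I x"
    then obtain j s where js: "j \<in> I" "b = j + s * x" by (auto simp: adj_def)
    have "a + b = (i + j) + (r + s) * x" using ir js by (simp add: algebra_simps)
    then show "a + b \<in> adj I x" using cideal_add[OF I ir(1) js(1)] unfolding adj_def by blast }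
  fix s
  have "s * a = s * i + (s * r) * x" using ir by (simp add: algebra_simps)
  then show "s * a \<in> adj I x" using cideal_mult[OF I ir(1)] unfolding adj_def by blast
qed

lemma subset_adj: "I \<subseteq> adj I x"
proof
  fix a assume "a \<in> I"
  moreover have "a = a + 0 * x" by simp
  ultimately show "a \<in> adj I x" unfolding adj_def by blast
qed

lemma mem_adj: "cideal I \<Longrightarrow> x \<in> adj I x"
proof -
  assume "cideal I"
  then have "0 \<in> I" by (rule cideal_zero)
  moreover have "x = 0 + 1 * x" by simp
  ultimately show "x \<in> adj I x" unfolding adj_def by blast
qed

lemma adj_least: "cideal J \<Longrightarrow> I \<subseteq> J \<Longrightarrow> x \<in> J \<Longrightarrow> adj I x \<subseteq> J"
  by (auto simp: adj_def intro!: cideal_add cideal_mult)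

lemma adj_psubset: "cideal I \<Longrightarrow> x \<notin> I \<Longrightarrow> I \<subset> adj I x"
  using subset_adj[of I x] mem_adj[of I x] by auto

lemma gen_ideal_ideal: "cideal (gen_ideal A)"
  unfolding gen_ideal_def cideal_def by blast

lemma gen_ideal_superset: "A \<subseteq> gen_ideal A"
  unfolding gen_ideal_def by blast

lemma gen_ideal_least: "cideal I \<Longrightarrow> A \<subseteq> I \<Longrightarrow> gen_ideal A \<subseteq> I"
  unfolding gen_ideal_def by blast

lemma gen_ideal_mono: "A \<subseteq> B \<Longrightarrow> gen_ideal A \<subseteq> gen_ideal B"
  by (meson gen_ideal_ideal gen_ideal_least gen_ideal_superset order_trans)

lemma gen_ideal_eq: "cideal I \<Longrightarrow> gen_ideal I = I"
  using gen_ideal_least[of I I] gen_ideal_superset[of I] by blast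

lemma gen_ideal_insert: "gen_ideal (insert a A) = adj (gen_ideal A) a"
proof
  show "gen_ideal (insert a A) \<subseteq> adj (gen_ideal A) a"
    using gen_ideal_superset[of A] subset_adj[of "gen_ideal A" a] mem_adj[OF gen_ideal_ideal, of a A]
    by (intro gen_ideal_least adj_ideal gen_ideal_ideal) auto
  show "adj (gen_ideal A) a \<subseteq> gen_ideal (insert a A)"
    using gen_ideal_superset[of "insert a A"]
    by (intro adj_least gen_ideal_ideal gen_ideal_mono) auto
qed

section \<open>Prime ideals and prime avoidance\<close>

lemma prime_cideal: "prime_ideal P \<Longrightarrow> cideal P"
  and prime_one: "prime_ideal P \<Longrightarrow> 1 \<notin> P"
  and prime_mult: "prime_ideal P \<Longrightarrow> a * b \<in> P \<Longrightarrow> a \<in> P \<or> b \<in> P"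
  by (auto simp: prime_ideal_def)

lemma prime_power: "prime_ideal P \<Longrightarrow> a ^ n \<in> P \<Longrightarrow> a \<in> P"
  by (induction n) (auto dest: prime_mult prime_one)

lemma prime_prod: "finite A \<Longrightarrow> prime_ideal P \<Longrightarrow> prod f A \<in> P \<Longrightarrow> \<exists>a\<in>A. f a \<in> P"
  by (induction A rule: finite_induct) (auto dest: prime_mult prime_one)

lemma prime_avoidance:
  assumes fin: "finite F" and J: "cideal J"
    and F: "\<And>q. q \<in> F \<Longrightarrow> prime_ideal q \<and> \<not> J \<subseteq> q"
  shows "\<exists>x\<in>J. \<forall>q\<in>F. x \<notin> q"
  using fin F
proof (induction F rule: finite_psubset_induct)
  case (psubset F)
  show ?case
  proof (cases "\<exists>q\<in>F. \<exists>q'\<in>F. q' \<noteq> q \<and> q' \<subseteq> q")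
    case True
    then obtain q q' where q: "q \<in> F" "q' \<in> F" "q' \<noteq> q" "q' \<subseteq> q" by blast
    have "\<exists>x\<in>J. \<forall>q\<in>F - {q'}. x \<notin> q"
      by (rule psubset.IH) (use q psubset.prems in auto)
    then show ?thesis using q by blast
  next
    case anti: False
    show ?thesis
    proof (cases "F = {}")
      case True
      then show ?thesis using cideal_zero[OF J] by blast
    next
      case False
      then obtain q where q: "q \<in> F" by blast
      have "\<exists>x\<in>J. \<forall>q\<in>F - {q}. x \<notin> q"
        by (rule psubset.IH) (use q psubset.prems in auto)
      then obtain x where x: "x \<in> J" "\<forall>q\<in>F - {q}. x \<notin> q" by blast
      show ?thesis
      proof (cases "x \<in> q")
        case False
        then show ?thesis using x by blast
      next
        case True
        have pq: "prime_ideal q" using psubset.prems q by blast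
        obtain j where j: "j \<in> J" "j \<notin> q" using psubset.prems q by blast
        have "\<forall>q'\<in>F - {q}. \<exists>y. y \<in> q' \<and> y \<notin> q" using anti q by blast
        then obtain y where y: "\<And>q'. q' \<in> F - {q} \<Longrightarrow> y q' \<in> q' \<and> y q' \<notin> q" by metis
        have fin': "finite (F - {q})" using psubset.hyps by simp
        define z where "z = j * prod y (F - {q})"
        have zq: "z \<notin> q"
          using prime_mult[OF pq, of j "prod y (F - {q})"] prime_prod[OF fin' pq, of y] j y
          unfolding z_def by blast
        have zq': "z \<in> q'" if "q' \<in> F - {q}" for q'
        proof -
          have "prime_ideal q'" using psubset.prems that by blast
          moreover have "prod y (F - {q}) = y q' * prod y (F - {q} - {q'})"
            using prod.remove[OF fin' that] .
          ultimately show ?thesis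
            unfolding z_def using y[OF that] prime_cideal[of q'] cideal_mult cideal_mult2 by metis
        qed
        have zJ: "z \<in> J" unfolding z_def using cideal_mult2[OF J j(1)] .
        have "x + z \<in> J" using cideal_add[OF J x(1) zJ] .
        moreover have "x + z \<notin> q'" if "q' \<in> F" for q'
        proof (cases "q' = q")
          case True
          then show ?thesis
            using zq cideal_diff[OF prime_cideal[OF pq], of "x + z" x] \<open>x \<in> q\<close> by auto
        next
          case False
          have "prime_ideal q'" using psubset.prems that by blast
          then show ?thesis
            using False that zq'[of q'] x(2) cideal_diff[OF prime_cideal, of q' "x + z" z] by auto
        qed
        ultimately show ?thesis by blast
      qed
    qed
  qed
qed

section \<open>Noetherian induction and local rings\<close>

locale noetherian =
  fixes R :: "'a::comm_ring_1 itself"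
  assumes noetherian: "noetherian_ring TYPE('a)"
begin

lemma finitely_generated: "cideal (I :: 'a set) \<Longrightarrow> \<exists>F. finite F \<and> I = gen_ideal F"
  using noetherian unfolding noetherian_ring_def by blast

lemma ideal_wf: "wf {(J, I). cideal I \<and> cideal J \<and> (I :: 'a set) \<subset> J}"
proof (subst wf_iff_no_infinite_down_chain, rule notI)
  assume "\<exists>f. \<forall>i. (f (Suc i), f i) \<in> {(J, I). cideal I \<and> cideal J \<and> (I :: 'a set) \<subset> J}"
  then obtain f :: "nat \<Rightarrow> 'a set"
    where "\<forall>i. (f (Suc i), f i) \<in> {(J, I). cideal I \<and> cideal J \<and> I \<subset> J}" by blast
  then have f: "cideal (f i)" "f i \<subset> f (Suc i)" for i by auto
  have mono: "f i \<subseteq> f j" if "i \<le> j" for i j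
    using lift_Suc_mono_le[of f, OF _ that] f(2) by blast
  have U: "cideal (\<Union>i. f i)"
    unfolding cideal_def
  proof (intro conjI ballI allI)
    show "0 \<in> (\<Union>i. f i)" using cideal_zero f(1) by blast
    fix a assume "a \<in> (\<Union>i. f i)"
    then obtain i where i: "a \<in> f i" by blast
    { fix b assume "b \<in> (\<Union>i. f i)"
      then obtain j where j: "b \<in> f j" by blast
      have "a \<in> f (max i j)" "b \<in> f (max i j)" using i j mono[of i "max i j"] mono[of j "max i j"] by auto
      then show "a + b \<in> (\<Union>i. f i)" using cideal_add[OF f(1)] by blast }
    fix r show "r * a \<in> (\<Union>i. f i)" using cideal_mult[OF f(1) i] by blast
  qed
  obtain F where F: "finite F" "(\<Union>i. f i) = gen_ideal F" using finitely_generated[OF U] by blast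
  have "\<forall>x\<in>F. \<exists>i. x \<in> f i" using gen_ideal_superset[of F] F(2) by blast
  then obtain g where g: "\<And>x. x \<in> F \<Longrightarrow> x \<in> f (g x)" by metis
  obtain N where N: "\<And>x. x \<in> F \<Longrightarrow> g x \<le> N"
    using F(1) finite_nat_set_iff_bounded_le[of "g ` F"] by auto
  have "F \<subseteq> f N" using g mono[OF N] by blast
  then have "gen_ideal F \<subseteq> f N" by (rule gen_ideal_least[OF f(1)])
  then show False using F(2) f(2)[of N] by blast
qed

lemma noetherian_induct [consumes 1, case_names step]:
  assumes "cideal (I :: 'a set)"
    and "\<And>I. cideal I \<Longrightarrow> (\<And>J. cideal J \<Longrightarrow> I \<subset> J \<Longrightarrow> Q J) \<Longrightarrow> Q I"
  shows "Q I"
  using assms(1)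
proof (induction I rule: wf_induct_rule[OF ideal_wf])
  case (1 I)
  then show ?case using assms(2)[of I] by auto
qed

text \<open>If \<open>a * b\<close> lies in a proper ideal \<open>I\<close> that contains neither
  factor, then \<open>colon I a\<close> gains \<open>b\<close> and \<open>adj I a\<close> gains
  \<open>a\<close>, so both are strictly larger. A property of R/I that is stable under extensions
  thus has to be checked only for primes.\<close>

lemma noetherian_prime_induct [consumes 1, case_names prime one step]:
  assumes "cideal (I :: 'a set)"
    and prime: "\<And>I. prime_ideal I \<Longrightarrow> Q I"
    and one: "\<And>I. cideal I \<Longrightarrow> 1 \<in> I \<Longrightarrow> Q I"
    and step: "\<And>I a. cideal I \<Longrightarrow> Q (colon I a) \<Longrightarrow> Q (adj I a) \<Longrightarrow> Q I"
  shows "Q I"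
  using assms(1)
proof (induction I rule: noetherian_induct)
  case (step I)
  show ?case
  proof (cases "prime_ideal I \<or> 1 \<in> I")
    case True
    then show ?thesis using prime one step.hyps by blast
  next
    case False
    then obtain a b where ab: "a * b \<in> I" "a \<notin> I" "b \<notin> I"
      using step.hyps unfolding prime_ideal_def by blast
    have "b \<in> colon I a" using ab by (simp add: colon_def)
    then have "I \<subset> colon I a" using subset_colon[OF step.hyps, of a] ab(3) by blast
    then show ?thesis
      using assms(4)[OF step.hyps, of a] step.IH colon_ideal[OF step.hyps] adj_ideal[OF step.hyps]
        adj_psubset[OF step.hyps ab(2)] by blast
  qed
qed

lemma proper_subset_maximal:
  assumes "cideal (I :: 'a set)" "1 \<notin> I"
  shows "\<exists>M. maximal_ideal M \<and> I \<subseteq> M"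
  using assms
proof (induction I rule: noetherian_induct)
  case (step I)
  show ?case
  proof (cases "maximal_ideal I")
    case False
    then obtain J where "cideal J" "I \<subset> J" "1 \<notin> J"
      using step.hyps step.prems unfolding maximal_ideal_def by blast
    then show ?thesis using step.IH by blast
  qed auto
qed

end

lemma maximal_prime:
  assumes M: "maximal_ideal M"
  shows "prime_ideal M"
proof -
  have I: "cideal M" "1 \<notin> M" using M by (auto simp: maximal_ideal_def)
  have "b \<in> M" if "a * b \<in> M" "a \<notin> M" for a b
  proof -
    have "1 \<in> adj M a"
      using M adj_ideal[OF I(1), of a] adj_psubset[OF I(1) that(2)]
      unfolding maximal_ideal_def by blast
    then obtain i r where ir: "i \<in> M" "1 = i + r * a" unfolding adj_def by blast
    have "b = (i + r * a) * b" using ir(2) by simp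
    also have "\<dots> = b * i + r * (a * b)" by (simp add: algebra_simps)
    finally show ?thesis
      using cideal_add[OF I(1) cideal_mult[OF I(1) ir(1)] cideal_mult[OF I(1) that(1)]] by metis
  qed
  then show ?thesis using I unfolding prime_ideal_def by blast
qed

locale noetherian_local = noetherian "TYPE('a::comm_ring_1)" +
  fixes m :: "'a::comm_ring_1 set"
  assumes local: "local_ring m"
begin

lemma m_prime: "prime_ideal m"
  using local maximal_prime unfolding local_ring_def by blast

lemma m_ideal: "cideal m"
  using m_prime by (rule prime_cideal)

lemma proper_subset_m: "cideal I \<Longrightarrow> 1 \<notin> I \<Longrightarrow> I \<subseteq> m"
  using proper_subset_maximal[of I] local unfolding local_ring_def by blast

lemma prime_subset_m: "prime_ideal P \<Longrightarrow> P \<subseteq> m"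
  using proper_subset_m prime_cideal prime_one by blast

text \<open>Nakayama's lemma for a cyclic module: \<open>1 - r * x\<close> lies outside
  \<open>m\<close>, and an ideal containing such an element, here \<open>colon I a\<close>, is the
  whole ring.\<close>

lemma unit_cancel:
  assumes I: "cideal I" and x: "x \<in> m" and "(1 - r * x) * a \<in> I"
  shows "a \<in> I"
proof -
  have "1 - r * x \<in> colon I a" using assms by (simp add: colon_def mult.commute)
  moreover have "1 - r * x \<notin> m"
    using prime_one[OF m_prime] cideal_eqD[OF m_ideal cideal_mult[OF m_ideal x, of r], of 1] by blast
  ultimately have "1 \<in> colon I a" using proper_subset_m[OF colon_ideal[OF I], of a] by blast
  then show ?thesis by (simp add: colon_def)
qed

end

section \<open>The height theorem\<close>

definition saturation :: "'a::comm_ring_1 set \<Rightarrow> 'a set \<Rightarrow> 'a set" where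
  "saturation p I = {a. \<exists>s. s \<notin> p \<and> s * a \<in> I}"

definition saturated :: "'a::comm_ring_1 set \<Rightarrow> 'a set \<Rightarrow> bool" where
  "saturated p I \<longleftrightarrow> (\<forall>s a. s \<notin> p \<longrightarrow> s * a \<in> I \<longrightarrow> a \<in> I)"

lemma saturation_ideal:
  assumes p: "prime_ideal p" and I: "cideal I"
  shows "cideal (saturation p I)"
  unfolding cideal_def
proof (intro conjI ballI allI)
  show "0 \<in> saturation p I"
    using cideal_zero[OF I] prime_one[OF p] by (auto simp: saturation_def)
  fix a assume "a \<in> saturation p I"
  then obtain s where s: "s \<notin> p" "s * a \<in> I" by (auto simp: saturation_def)
  { fix b assume "b \<in> saturation p I"
    then obtain t where t: "t \<notin> p" "t * b \<in> I" by (auto simp: saturation_def)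
    have "s * t * (a + b) = t * (s * a) + s * (t * b)" by (simp add: algebra_simps)
    then have "s * t * (a + b) \<in> I"
      using cideal_add[OF I cideal_mult[OF I s(2)] cideal_mult[OF I t(2)]] by simp
    moreover have "s * t \<notin> p" using prime_mult[OF p] s t by blast
    ultimately show "a + b \<in> saturation p I" by (auto simp: saturation_def) }
  fix r
  have "s * (r * a) \<in> I" using cideal_mult[OF I s(2), of r] by (simp add: mult.left_commute)
  then show "r * a \<in> saturation p I" using s(1) by (auto simp: saturation_def)
qed

lemma saturated_saturation:
  assumes p: "prime_ideal p"
  shows "saturated p (saturation p I)"
  unfolding saturated_def
proof (intro allI impI)
  fix s a assume s: "s \<notin> p" "s * a \<in> saturation p I"
  then obtain t where t: "t \<notin> p" "t * (s * a) \<in> I" by (auto simp: saturation_def)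
  then have "t * s \<notin> p" "t * s * a \<in> I" using s prime_mult[OF p] by (auto simp: mult.assoc)
  then show "a \<in> saturation p I" unfolding saturation_def by blast
qed

lemma subset_saturation: "prime_ideal p \<Longrightarrow> I \<subseteq> saturation p I"
proof
  fix a assume p: "prime_ideal p" and "a \<in> I"
  then have "1 \<notin> p" "1 * a \<in> I" using prime_one by auto
  then show "a \<in> saturation p I" unfolding saturation_def by blast
qed

lemma saturation_mono: "I \<subseteq> J \<Longrightarrow> saturation p I \<subseteq> saturation p J"
  by (auto simp: saturation_def)

lemma adj_mono: "I \<subseteq> J \<Longrightarrow> adj I x \<subseteq> adj J x"
  by (auto simp: adj_def)

text \<open>Ideals that are saturated with respect to a prime \<open>p\<close> stand for the ideals of the
  localization at \<open>p\<close>.\<close>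

definition saturated_dcc :: "'a::comm_ring_1 set \<Rightarrow> 'a set \<Rightarrow> bool" where
  "saturated_dcc p I \<longleftrightarrow> (\<forall>C :: nat \<Rightarrow> 'a set.
     (\<forall>n. cideal (C n) \<and> saturated p (C n) \<and> I \<subseteq> C n \<and> C (Suc n) \<subseteq> C n) \<longrightarrow>
     (\<exists>N. \<forall>n\<ge>N. C n = C N))"

lemma saturated_dccD:
  assumes "saturated_dcc p I"
    and "\<And>n. cideal (C n)" "\<And>n. saturated p (C n)" "\<And>n. I \<subseteq> C n" "\<And>n. C (Suc n) \<subseteq> C n"
  shows "\<exists>N. \<forall>n\<ge>N. C n = C N"
  using assms unfolding saturated_dcc_def by blast

text \<open>After localization R/I is an extension of R/(I + aR) by R/(I : a). A chain above
  \<open>I\<close> is determined by its traces on the two pieces: the colon ideals and the saturated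
  sums with \<open>a\<close>.\<close>

lemma saturated_dcc_step:
  assumes p: "prime_ideal p" and I: "cideal I"
    and colon: "saturated_dcc p (colon I a)" and adj: "saturated_dcc p (adj I a)"
  shows "saturated_dcc p I"
  unfolding saturated_dcc_def
proof (intro allI impI)
  fix C :: "nat \<Rightarrow> 'a set"
  assume "\<forall>n. cideal (C n) \<and> saturated p (C n) \<and> I \<subseteq> C n \<and> C (Suc n) \<subseteq> C n"
  then have C: "cideal (C n)" "saturated p (C n)" "I \<subseteq> C n" "C (Suc n) \<subseteq> C n" for n by auto
  have "\<exists>N. \<forall>n\<ge>N. colon (C n) a = colon (C N) a"
  proof (rule saturated_dccD[OF colon])
    fix n
    show "cideal (colon (C n) a)" using colon_ideal[OF C(1)] .
    show "saturated p (colon (C n) a)"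
      using C(2)[of n] unfolding saturated_def colon_def by (simp add: mult.left_commute)
    show "colon I a \<subseteq> colon (C n) a" "colon (C (Suc n)) a \<subseteq> colon (C n) a"
      using C(3,4)[of n] by (auto simp: colon_def)
  qed
  then obtain N1 where N1: "\<And>n. n \<ge> N1 \<Longrightarrow> colon (C n) a = colon (C N1) a" by blast
  have "\<exists>N. \<forall>n\<ge>N. saturation p (adj (C n) a) = saturation p (adj (C N) a)"
  proof (rule saturated_dccD[OF adj])
    fix n
    show "cideal (saturation p (adj (C n) a))" using saturation_ideal[OF p adj_ideal[OF C(1)]] .
    show "saturated p (saturation p (adj (C n) a))" using saturated_saturation[OF p] .
    show "adj I a \<subseteq> saturation p (adj (C n) a)"
      using subset_saturation[OF p] adj_mono[OF C(3)] by blast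
    show "saturation p (adj (C (Suc n)) a) \<subseteq> saturation p (adj (C n) a)"
      using saturation_mono[OF adj_mono[OF C(4)]] .
  qed
  then obtain N2
    where N2: "\<And>n. n \<ge> N2 \<Longrightarrow> saturation p (adj (C n) a) = saturation p (adj (C N2) a)" by blast
  define N where "N = max N1 N2"
  have "C n = C N" if n: "n \<ge> N" for n
  proof
    show le: "C n \<subseteq> C N" using lift_Suc_antimono_le[of C, OF C(4) n] .
    show "C N \<subseteq> C n"
    proof
      fix c assume c: "c \<in> C N"
      \<comment> \<open>Equality of the saturated sums gives \<open>s * c = i + r * a\<close> with
        \<open>i\<close> in the smaller ideal. Then \<open>a * r\<close> lies in the larger ideal,
        and equality of the colon ideals puts it into the smaller one.\<close>
      have "c \<in> saturation p (adj (C n) a)"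
        using c subset_adj[of "C N" a] subset_saturation[OF p, of "adj (C N) a"] N2[of N] N2[of n] n
        unfolding N_def by auto
      then obtain s i r where s: "s \<notin> p" "s * c = i + r * a" "i \<in> C n"
        by (auto simp: saturation_def adj_def)
      have "i \<in> C N" using le s(3) by blast
      have "a * r = s * c - i" using s(2) by (simp add: mult.commute)
      then have "a * r \<in> C N"
        using cideal_diff[OF C(1) cideal_mult[OF C(1) c] \<open>i \<in> C N\<close>, of s] by simp
      then have "a * r \<in> C n"
        using N1[of N] N1[of n] n unfolding N_def colon_def by auto
      then have "s * c \<in> C n" using s(2,3) cideal_add[OF C(1)] by (metis mult.commute)
      then show "c \<in> C n" using C(2)[of n] s(1) unfolding saturated_def by blast
    qed
  qed
  then show "\<exists>N. \<forall>n\<ge>N. C n = C N" by blast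
qed

text \<open>A saturated ideal not inside \<open>p\<close> is the whole ring, so above a prime
  \<open>I\<close> inside \<open>p\<close> only \<open>p\<close> and the ring occur; the rest
  follows by extensions. The hypothesis holds vacuously when \<open>I\<close> is not inside
  \<open>p\<close>, and in this form it passes to the larger ideals of the induction.\<close>

lemma (in noetherian) saturated_dcc_minimal:
  fixes p I :: "'a set"
  assumes p: "prime_ideal p" and "cideal I"
    and "\<And>q. prime_ideal q \<Longrightarrow> I \<subseteq> q \<Longrightarrow> q \<subseteq> p \<Longrightarrow> q = p"
  shows "saturated_dcc p I"
  using assms(2,3)
proof (induction I rule: noetherian_prime_induct)
  case (prime I)
  have "saturated_dcc p I"
    unfolding saturated_dcc_def
  proof (intro allI impI)
    fix C :: "nat \<Rightarrow> 'a set"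
    assume "\<forall>n. cideal (C n) \<and> saturated p (C n) \<and> I \<subseteq> C n \<and> C (Suc n) \<subseteq> C n"
    then have C: "cideal (C n)" "saturated p (C n)" "I \<subseteq> C n" "C (Suc n) \<subseteq> C n" for n by auto
    have big: "C n = UNIV" if np: "\<not> C n \<subseteq> p" for n
    proof -
      obtain a where "a \<in> C n" "a \<notin> p" using np by blast
      then have "1 \<in> C n" using C(2)[of n] unfolding saturated_def by (metis mult.right_neutral)
      then show ?thesis using cideal_one[OF C(1)] by blast
    qed
    show "\<exists>N. \<forall>n\<ge>N. C n = C N"
    proof (cases "\<exists>N. C N \<subseteq> p")
      case False
      then show ?thesis using big by metis
    next
      case True
      then obtain N where N: "C N \<subseteq> p" by blast
      have "I = p" using prime.prems[OF prime.hyps, OF subset_refl] C(3)[of N] N by blast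
      then have "C n = p" if "n \<ge> N" for n
        using lift_Suc_antimono_le[of C, OF C(4) that] N C(3)[of n] by blast
      then show ?thesis by blast
    qed
  qed
  then show ?case .
next
  case (one I)
  have big: "C = UNIV" if "cideal C" "I \<subseteq> C" for C :: "'a set"
    using cideal_one[OF that(1)] that(2) one.hyps(2) by blast
  show ?case unfolding saturated_dcc_def
  proof (intro allI impI exI)
    fix C :: "nat \<Rightarrow> 'a set" and n
    assume "\<forall>n. cideal (C n) \<and> saturated p (C n) \<and> I \<subseteq> C n \<and> C (Suc n) \<subseteq> C n"
    then show "C n = C 0" using big[of "C n"] big[of "C 0"] by simp
  qed
next
  case (step I a)
  have "I \<subseteq> colon I a" "I \<subseteq> adj I a"
    using subset_colon[OF step.hyps] subset_adj by blast+
  then have "saturated_dcc p (colon I a)" "saturated_dcc p (adj I a)"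
    using step.IH step.prems by (metis order_trans)+
  then show ?case by (rule saturated_dcc_step[OF p step.hyps])
qed

text \<open>Nakayama's lemma at \<open>p\<close>, discarding generators one by one. From
  \<open>s * f = b + x * c\<close> and \<open>s' * c = g + r * f\<close> it follows that
  \<open>(s' * s - x * r) * f\<close> lies in the ideal of \<open>B\<close> and the remaining
  generators, and the coefficient stays outside \<open>p\<close> because \<open>x\<close> is in
  \<open>p\<close>.\<close>

lemma saturated_nakayama:
  assumes p: "prime_ideal p" and B: "cideal B" "saturated p B" and x: "x \<in> p"
    and A: "cideal A" and "finite F"
    and "\<And>a. a \<in> A \<Longrightarrow> a \<in> saturation p (gen_ideal (B \<union> F))" and "F \<subseteq> A"
    and step: "\<And>a. a \<in> A \<Longrightarrow> \<exists>s b c. s \<notin> p \<and> b \<in> B \<and> c \<in> A \<and> s * a = b + x * c"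
  shows "A \<subseteq> B"
  using assms(6,7,8)
proof (induction F rule: finite_induct)
  case empty
  then show ?case
    using B gen_ideal_eq[OF B(1)] unfolding saturated_def saturation_def by auto
next
  case (insert f F)
  define G where "G = gen_ideal (B \<union> F)"
  have G: "cideal G" unfolding G_def by (rule gen_ideal_ideal)
  have BG: "B \<subseteq> G" unfolding G_def using gen_ideal_superset[of "B \<union> F"] by blast
  have gen: "gen_ideal (B \<union> insert f F) = adj G f" unfolding G_def by (simp add: gen_ideal_insert)
  obtain s b c where s: "s \<notin> p" "b \<in> B" "c \<in> A" "s * f = b + x * c"
    using step[of f] insert.prems(2) by blast
  obtain s' g r where s': "s' \<notin> p" "g \<in> G" "s' * c = g + r * f"
    using insert.prems(1)[OF s(3)] unfolding gen by (auto simp: saturation_def adj_def)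
  define t where "t = s' * s - x * r"
  have "s' * s \<notin> p" using s s' prime_mult[OF p] by blast
  then have t: "t \<notin> p"
    unfolding t_def using cideal_eqD[OF prime_cideal[OF p] cideal_mult2[OF prime_cideal[OF p] x]] by blast
  have "t * f = s' * (s * f) - x * (r * f)" unfolding t_def by (simp add: algebra_simps)
  also have "\<dots> = s' * b + x * (s' * c) - x * (r * f)" unfolding s(4) by (simp add: algebra_simps)
  also have "\<dots> = s' * b + x * g" unfolding s'(3) by (simp add: algebra_simps)
  finally have tf: "t * f \<in> G" using BG s(2) s'(2) cideal_add[OF G] cideal_mult[OF G] by auto
  show ?case
  proof (rule insert.IH)
    fix a assume "a \<in> A"
    from insert.prems(1)[OF this] obtain u h r
      where u: "u \<notin> p" "h \<in> G" "u * a = h + r * f"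
      unfolding gen by (auto simp: saturation_def adj_def)
    have "t * u * a = t * (u * a)" by (simp add: algebra_simps)
    also have "\<dots> = t * h + r * (t * f)" unfolding u(3) by (simp add: algebra_simps)
    finally have "t * u * a = t * h + r * (t * f)" .
    then have "t * u * a \<in> G" using u(2) tf cideal_add[OF G] cideal_mult[OF G] by auto
    moreover have "t * u \<notin> p" using t u prime_mult[OF p] by blast
    ultimately show "a \<in> saturation p (gen_ideal (B \<union> F))"
      unfolding saturation_def G_def by blast
  qed (use insert.prems in auto)
qed

text \<open>If \<open>p2\<close> were minimal over \<open>p0 + (x)\<close>, then the ideals
  \<open>A k\<close>, the localized contractions of \<open>(y^k)\<close> from the ring with \<open>x\<close> inverted, would be
  stationary modulo \<open>x\<close>, hence stationary by Nakayama's lemma, making \<open>y\<close> divide a power of \<open>x\<close>.\<close>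

lemma (in noetherian) krull_principal_ideal:
  fixes p0 p1 p2 :: "'a set"
  assumes p0: "prime_ideal p0" and p1: "prime_ideal p1" and p2: "prime_ideal p2"
    and 01: "p0 \<subset> p1" and 12: "p1 \<subset> p2" and x: "x \<in> p2"
  shows "\<exists>q. prime_ideal q \<and> p0 \<subseteq> q \<and> x \<in> q \<and> q \<subset> p2"
proof (rule ccontr)
  assume no: "\<not> ?thesis"
  have I0: "cideal p0" using prime_cideal[OF p0] .
  have dcc: "saturated_dcc p2 (adj p0 x)"
  proof (rule saturated_dcc_minimal[OF p2 adj_ideal[OF I0]])
    fix q assume "prime_ideal q" "adj p0 x \<subseteq> q" "q \<subseteq> p2"
    then show "q = p2" using no subset_adj[of p0 x] mem_adj[OF I0, of x] by blast
  qed
  have x1: "x \<notin> p1" using no p1 01 12 by blast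
  obtain y where y: "y \<in> p1" "y \<notin> p0" using 01 by blast
  define A where "A k = {a. \<exists>s j. s \<notin> p2 \<and> s * x ^ j * a \<in> adj p0 (y ^ k)}" for k :: nat
  have Y: "cideal (adj p0 (y ^ k))" for k by (rule adj_ideal[OF I0])
  have AI: "cideal (A k)" for k
    unfolding cideal_def
  proof (intro conjI ballI allI)
    show "0 \<in> A k" unfolding A_def using prime_one[OF p2] cideal_zero[OF Y] by auto
    fix a assume "a \<in> A k"
    then obtain s j where s: "s \<notin> p2" "s * x ^ j * a \<in> adj p0 (y ^ k)" unfolding A_def by blast
    { fix b assume "b \<in> A k"
      then obtain t i where t: "t \<notin> p2" "t * x ^ i * b \<in> adj p0 (y ^ k)" unfolding A_def by blast
      have "s * t * x ^ (j + i) * (a + b) = (t * x ^ i) * (s * x ^ j * a) + (s * x ^ j) * (t * x ^ i * b)"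
        by (simp add: algebra_simps power_add)
      then have "s * t * x ^ (j + i) * (a + b) \<in> adj p0 (y ^ k)"
        using cideal_add[OF Y cideal_mult[OF Y s(2)] cideal_mult[OF Y t(2)]] by simp
      moreover have "s * t \<notin> p2" using s t prime_mult[OF p2] by blast
      ultimately show "a + b \<in> A k" unfolding A_def by blast }
    fix r
    have "s * x ^ j * (r * a) \<in> adj p0 (y ^ k)"
      using cideal_mult[OF Y s(2), of r] by (simp add: algebra_simps)
    then show "r * a \<in> A k" unfolding A_def using s(1) by blast
  qed
  have Asat: "saturated p2 (A k)" for k
    unfolding saturated_def
  proof (intro allI impI)
    fix s a assume s: "s \<notin> p2" "s * a \<in> A k"
    then obtain t j where t: "t \<notin> p2" "t * x ^ j * (s * a) \<in> adj p0 (y ^ k)" unfolding A_def by blast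
    then have "t * s * x ^ j * a \<in> adj p0 (y ^ k)" by (simp add: algebra_simps)
    moreover have "t * s \<notin> p2" using s t prime_mult[OF p2] by blast
    ultimately show "a \<in> A k" unfolding A_def by blast
  qed
  \<comment> \<open>\<open>A k\<close> is contracted from a ring in which \<open>x\<close> is a
    unit, so it admits division by \<open>x\<close>. This turns stationarity modulo \<open>x\<close>
    into the hypothesis of Nakayama's lemma.\<close>
  have Ax: "a \<in> A k" if xa: "x * a \<in> A k" for a k
  proof -
    obtain s j where s: "s \<notin> p2" "s * x ^ j * (x * a) \<in> adj p0 (y ^ k)" using xa unfolding A_def by blast
    have "s * x ^ Suc j * a \<in> adj p0 (y ^ k)" using s(2) by (simp add: algebra_simps)
    then show ?thesis unfolding A_def using s(1) by blast
  qed
  have A0: "adj p0 (y ^ k) \<subseteq> A k" for k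
  proof
    fix a assume "a \<in> adj p0 (y ^ k)"
    then have "1 * x ^ 0 * a \<in> adj p0 (y ^ k)" by simp
    then show "a \<in> A k" unfolding A_def using prime_one[OF p2] by blast
  qed
  have Adec: "A (Suc k) \<subseteq> A k" for k
  proof -
    have "y ^ Suc k \<in> adj p0 (y ^ k)" using cideal_mult[OF Y mem_adj[OF I0], of y] by simp
    then have "adj p0 (y ^ Suc k) \<subseteq> adj p0 (y ^ k)" by (rule adj_least[OF Y subset_adj])
    then show ?thesis unfolding A_def by blast
  qed
  have "\<exists>N. \<forall>n\<ge>N. saturation p2 (adj (A n) x) = saturation p2 (adj (A N) x)"
  proof (rule saturated_dccD[OF dcc])
    fix n
    show "cideal (saturation p2 (adj (A n) x))" by (intro saturation_ideal[OF p2] adj_ideal AI)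
    show "saturated p2 (saturation p2 (adj (A n) x))" by (rule saturated_saturation[OF p2])
    have "p0 \<subseteq> A n" using subset_adj A0 by blast
    then show "adj p0 x \<subseteq> saturation p2 (adj (A n) x)"
      using subset_saturation[OF p2] adj_mono by blast
    show "saturation p2 (adj (A (Suc n)) x) \<subseteq> saturation p2 (adj (A n) x)"
      by (intro saturation_mono adj_mono Adec)
  qed
  then obtain N where N: "saturation p2 (adj (A (Suc N)) x) = saturation p2 (adj (A N) x)"
    using le_Suc_eq by blast
  obtain F where F: "finite F" "A N = gen_ideal F" using finitely_generated[OF AI] by blast
  have "A N \<subseteq> A (Suc N)"
  proof (rule saturated_nakayama[OF p2 AI Asat x AI F(1)])
    fix a assume a: "a \<in> A N"
    show "a \<in> saturation p2 (gen_ideal (A (Suc N) \<union> F))"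
      using a F(2) gen_ideal_mono[of F "A (Suc N) \<union> F"] subset_saturation[OF p2] by blast
    have "a \<in> saturation p2 (adj (A (Suc N)) x)"
      using a N subset_adj[of "A N" x] subset_saturation[OF p2, of "adj (A N) x"] by blast
    then obtain s b r where s: "s \<notin> p2" "b \<in> A (Suc N)" "s * a = b + r * x"
      by (auto simp: saturation_def adj_def)
    have "x * r = s * a - b" using s(3) by (simp add: mult.commute)
    then have "x * r \<in> A N"
      using cideal_diff[OF AI cideal_mult[OF AI a], of b s] Adec[of N] s(2) by auto
    then have "r \<in> A N" by (rule Ax)
    then show "\<exists>s b c. s \<notin> p2 \<and> b \<in> A (Suc N) \<and> c \<in> A N \<and> s * a = b + x * c"
      using s by (metis mult.commute)
  next
    show "F \<subseteq> A N" using F(2) gen_ideal_superset by blast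
  qed
  moreover have "y ^ N \<in> A N" using A0[of N] mem_adj[OF I0, of "y ^ N"] by blast
  ultimately obtain s j where s: "s \<notin> p2" "s * x ^ j * y ^ N \<in> adj p0 (y ^ Suc N)"
    unfolding A_def by blast
  then obtain i r where ir: "i \<in> p0" "s * x ^ j * y ^ N = i + r * y ^ Suc N"
    unfolding adj_def by blast
  \<comment> \<open>Modulo the prime \<open>p0\<close> the factor \<open>y ^ N\<close> cancels. What
    remains puts \<open>s * x ^ j\<close> into \<open>p1\<close>, although neither \<open>s\<close>
    nor \<open>x\<close> lies there.\<close>
  have "y ^ N * (s * x ^ j - r * y) = i" using ir(2) by (simp add: algebra_simps)
  then have "s * x ^ j - r * y \<in> p0"
    using ir(1) prime_mult[OF p0] prime_power[OF p0] y(2) by blast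
  then have "s * x ^ j \<in> p1"
    using cideal_eqD[OF prime_cideal[OF p1] cideal_mult[OF prime_cideal[OF p1] y(1)]] 01 by blast
  then show False
    using prime_mult[OF p1] prime_power[OF p1] x1 s(1) 12 by blast
qed

section \<open>Chains of primes and dimension\<close>

primrec has_chain :: "nat \<Rightarrow> 'a::comm_ring_1 set \<Rightarrow> bool" where
  "has_chain 0 P \<longleftrightarrow> prime_ideal P"
| "has_chain (Suc d) P \<longleftrightarrow> prime_ideal P \<and> (\<exists>Q. P \<subset> Q \<and> has_chain d Q)"

lemma has_chain_prime: "has_chain d P \<Longrightarrow> prime_ideal P"
  by (cases d) auto

lemma has_chain_prime_chain: "has_chain d P \<longleftrightarrow> (\<exists>qs. prime_chain P qs \<and> length qs = Suc d)"
proof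
  show "has_chain d P \<Longrightarrow> \<exists>qs. prime_chain P qs \<and> length qs = Suc d"
  proof (induction d arbitrary: P)
    case 0
    then show ?case by (intro exI[of _ "[P]"]) (auto simp: prime_chain_def)
  next
    case (Suc d)
    then obtain Q where Q: "prime_ideal P" "P \<subset> Q" "has_chain d Q" by auto
    then obtain qs where qs: "prime_chain Q qs" "length qs = Suc d" using Suc.IH by blast
    obtain qs' where qs': "qs = Q # qs'" using qs(1) by (cases qs) (auto simp: prime_chain_def)
    have "prime_chain P (P # qs)" using Q qs unfolding qs' by (auto simp: prime_chain_def)
    then show ?case using qs(2) by (metis length_Cons)
  qed
  show "\<exists>qs. prime_chain P qs \<and> length qs = Suc d \<Longrightarrow> has_chain d P"
  proof (induction d arbitrary: P)
    case 0
    then obtain qs where "prime_chain P qs" "length qs = Suc 0" by auto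
    then show ?case by (cases qs) (auto simp: prime_chain_def)
  next
    case (Suc d)
    then obtain qs where qs: "prime_chain P qs" "length qs = Suc (Suc d)" by auto
    then obtain Q qs' where qs': "qs = P # Q # qs'"
      by (auto simp: prime_chain_def length_Suc_conv)
    have "prime_chain Q (Q # qs')" using qs unfolding qs' by (auto simp: prime_chain_def)
    moreover have "length (Q # qs') = Suc d" using qs(2) unfolding qs' by simp
    ultimately have "has_chain d Q" using Suc.IH by blast
    then show ?case using qs unfolding qs' by (auto simp: prime_chain_def)
  qed
qed

text \<open>A set that misses its finite supremum \<open>r\<close> would be bounded by
  \<open>r - 1\<close>. A finite dimension is therefore the length of an actual chain.\<close>

lemma enat_Sup_attained:
  assumes "Sup X = enat r" "X \<noteq> {}"
  shows "enat r \<in> X"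
proof (rule ccontr)
  assume "enat r \<notin> X"
  then have less: "x < enat r" if "x \<in> X" for x
    using that assms(1) Sup_upper[of x X] by (metis order.not_eq_order_implies_strict)
  obtain x0 where x0: "x0 \<in> X" using assms(2) by blast
  have r: "r > 0" using less[OF x0] by (cases r) (auto simp: zero_enat_def[symmetric])
  have "x \<le> enat (r - 1)" if "x \<in> X" for x
    using less[OF that] by (cases x) auto
  then have "Sup X \<le> enat (r - 1)" by (meson Sup_least)
  then show False using assms(1) r by simp
qed

lemma quot_dim_has_chain:
  assumes P: "prime_ideal P" and d: "quot_dim P = enat r"
  shows "has_chain r P" "\<not> has_chain (Suc r) P"
proof -
  let ?X = "{enat (length qs - 1) | qs. prime_chain P qs}"
  have ch: "has_chain d P \<longleftrightarrow> enat d \<in> ?X" for d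
    unfolding has_chain_prime_chain mem_Collect_eq
  proof
    assume "\<exists>qs. enat d = enat (length qs - 1) \<and> prime_chain P qs"
    then obtain qs where "d = length qs - 1" "prime_chain P qs" by auto
    then show "\<exists>qs. prime_chain P qs \<and> length qs = Suc d"
      by (intro exI[of _ qs]) (auto simp: prime_chain_def Suc_leI)
  next
    assume "\<exists>qs. prime_chain P qs \<and> length qs = Suc d"
    then obtain qs where "prime_chain P qs" "length qs = Suc d" by blast
    then show "\<exists>qs. enat d = enat (length qs - 1) \<and> prime_chain P qs"
      by (intro exI[of _ qs]) simp
  qed
  have "has_chain 0 P" using P by simp
  then have ne: "?X \<noteq> {}" using ch by blast
  have S: "Sup ?X = enat r" using d unfolding quot_dim_def .
  show "has_chain r P" unfolding ch using enat_Sup_attained[OF S ne] .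
  show "\<not> has_chain (Suc r) P"
    unfolding ch
  proof
    assume "enat (Suc r) \<in> ?X"
    then have "enat (Suc r) \<le> enat r" unfolding S[symmetric] by (rule Sup_upper)
    then show False by simp
  qed
qed

context noetherian_local
begin

text \<open>Induction on the tail gives a prime \<open>Q1\<close> containing \<open>x\<close>, at
  the cost of one step. If it lies strictly above \<open>P1\<close>, the principal ideal theorem for
  \<open>P\<close>, \<open>P1\<close>, \<open>Q1\<close> yields a prime containing \<open>x\<close>
  strictly below \<open>Q1\<close>, which restores that step.\<close>

lemma has_chain_through:
  "has_chain (Suc d) P \<Longrightarrow> x \<in> m \<Longrightarrow> \<exists>Q. P \<subseteq> Q \<and> x \<in> Q \<and> has_chain d Q"
proof (induction d arbitrary: P)
  case 0
  then show ?case using m_prime prime_subset_m by auto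
next
  case (Suc d)
  then obtain P1 where P1: "prime_ideal P" "P \<subset> P1" "has_chain (Suc d) P1" by auto
  then obtain Q1 where Q1: "P1 \<subseteq> Q1" "x \<in> Q1" "has_chain d Q1" using Suc by blast
  show ?case
  proof (cases "P1 = Q1")
    case True
    then show ?thesis using P1 Q1 by blast
  next
    case False
    then obtain q where "prime_ideal q" "P \<subseteq> q" "x \<in> q" "q \<subset> Q1"
      using krull_principal_ideal[OF P1(1) has_chain_prime[OF P1(3)] has_chain_prime[OF Q1(3)] P1(2)] Q1
      by blast
    then show ?thesis using Q1(3) by auto
  qed
qed

text \<open>Each element costs at most one step: replace the chain by one through \<open>x\<close>
  that is shorter by one, and continue with the remaining elements.\<close>

lemma krull_height:
  assumes "has_chain d P" "set xs \<subseteq> m"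
    and "\<And>Q. prime_ideal Q \<Longrightarrow> P \<subseteq> Q \<Longrightarrow> set xs \<subseteq> Q \<Longrightarrow> Q = m"
  shows "d \<le> length xs"
  using assms
proof (induction xs arbitrary: d P)
  case Nil
  have P: "P = m" using Nil.prems(3)[of P] has_chain_prime[OF Nil.prems(1)] by simp
  show ?case
  proof (cases d)
    case (Suc d')
    then obtain Q where Q: "P \<subset> Q" "has_chain d' Q" using Nil.prems(1) by auto
    then have "Q = m" using Nil.prems(3)[of Q] has_chain_prime[OF Q(2)] by auto
    then show ?thesis using Q P by blast
  qed simp
next
  case (Cons x xs)
  show ?case
  proof (cases d)
    case (Suc d')
    then obtain Q where Q: "P \<subseteq> Q" "x \<in> Q" "has_chain d' Q"
      using has_chain_through[of d' P x] Cons.prems by auto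
    have "d' \<le> length xs"
    proof (rule Cons.IH[OF Q(3)])
      fix Q' assume "prime_ideal Q'" "Q \<subseteq> Q'" "set xs \<subseteq> Q'"
      then show "Q' = m" using Cons.prems(3)[of Q'] Q by auto
    qed (use Cons.prems in auto)
    then show ?thesis using Suc by simp
  qed simp
qed

end

section \<open>Artinian subquotients\<close>

text \<open>Products of exactly \<open>n\<close> factors generate the \<open>n\<close>-th power of
  the ideal; annihilation by that power is tested on these generators.\<close>

primrec products :: "'a::comm_ring_1 set \<Rightarrow> nat \<Rightarrow> 'a set" where
  "products M 0 = {1}"
| "products M (Suc n) = {u * v | u v. u \<in> M \<and> v \<in> products M n}"

lemma products_add: "w \<in> products M (s + t) \<Longrightarrow> \<exists>u\<in>products M s. \<exists>v\<in>products M t. w = u * v"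
proof (induction s arbitrary: w)
  case (Suc s)
  then obtain a w' where w: "w = a * w'" "a \<in> M" "w' \<in> products M (s + t)" by auto
  from Suc.IH[OF w(3)] obtain u v where "u \<in> products M s" "v \<in> products M t" "w' = u * v" by blast
  then have "a * u \<in> products M (Suc s)" "v \<in> products M t" "w = (a * u) * v"
    using w by (auto simp: mult.assoc)
  then show ?case by blast
qed auto

lemma power_in_products: "x \<in> M \<Longrightarrow> x ^ s \<in> products M s"
  by (induction s) auto

lemma chain_stationary_wf:
  assumes "\<And>C :: nat \<Rightarrow> 'b set. (\<And>n. Q (C n)) \<Longrightarrow> (\<And>n. C (Suc n) \<subseteq> C n) \<Longrightarrow> \<exists>N. \<forall>n\<ge>N. C n = C N"
  shows "wf {(V, U). Q V \<and> Q U \<and> V \<subset> U}"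
proof (subst wf_iff_no_infinite_down_chain, rule notI)
  assume "\<exists>f. \<forall>i. (f (Suc i), f i) \<in> {(V, U). Q V \<and> Q U \<and> V \<subset> U}"
  then obtain f where "\<forall>i. (f (Suc i), f i) \<in> {(V, U). Q V \<and> Q U \<and> V \<subset> U}" by blast
  then have f: "Q (f i)" "f (Suc i) \<subset> f i" for i by auto
  then obtain N where "\<forall>n\<ge>N. f n = f N" using assms[of f] by blast
  then have "f (Suc N) = f N" by (meson le_SucI order_refl)
  then show False using f(2)[of N] by blast
qed

text \<open>Subquotients of one ambient module are given by pairs of submodules, so that chains and
  exact sequences become statements about sets.\<close>

locale ring_module = module scale
  for scale :: "'a::comm_ring_1 \<Rightarrow> 'b::ab_group_add \<Rightarrow> 'b"  (infixr "*s" 75)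
begin

lemma subspace_sums:
  assumes U: "subspace U" and V: "subspace V"
  shows "subspace {u + v | u v. u \<in> U \<and> v \<in> V}"
  unfolding subspace_def
proof (intro conjI ballI allI)
  have "0 = 0 + (0::'b)" by simp
  then show "0 \<in> {u + v | u v. u \<in> U \<and> v \<in> V}" using subspace_0[OF U] subspace_0[OF V] by blast
  fix a assume "a \<in> {u + v | u v. u \<in> U \<and> v \<in> V}"
  then obtain u v where a: "a = u + v" "u \<in> U" "v \<in> V" by blast
  { fix b assume "b \<in> {u + v | u v. u \<in> U \<and> v \<in> V}"
    then obtain u' v' where b: "b = u' + v'" "u' \<in> U" "v' \<in> V" by blast
    have "a + b = (u + u') + (v + v')" using a b by (simp add: algebra_simps)
    then show "a + b \<in> {u + v | u v. u \<in> U \<and> v \<in> V}"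
      using a b subspace_add[OF U] subspace_add[OF V] by blast }
  fix c
  have "c *s a = c *s u + c *s v" using a by (simp add: scale_right_distrib)
  then show "c *s a \<in> {u + v | u v. u \<in> U \<and> v \<in> V}"
    using a subspace_scale[OF U] subspace_scale[OF V] by blast
qed

lemma subspace_scale_plus:
  assumes U: "subspace U" and B: "subspace B"
  shows "subspace {a *s u + b | u b. u \<in> U \<and> b \<in> B}"
proof -
  have "subspace ((*s) a ` U)"
    unfolding subspace_def
  proof (intro conjI ballI allI)
    show "0 \<in> (*s) a ` U" using subspace_0[OF U] by (metis imageI scale_zero_right)
    fix v assume "v \<in> (*s) a ` U"
    then obtain u where u: "v = a *s u" "u \<in> U" by blast
    { fix w assume "w \<in> (*s) a ` U"
      then obtain t where "w = a *s t" "t \<in> U" by blast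
      then have "v + w = a *s (u + t)" "u + t \<in> U"
        using u subspace_add[OF U] by (auto simp: scale_right_distrib)
      then show "v + w \<in> (*s) a ` U" by blast }
    fix c
    have "c *s v = a *s (c *s u)" "c *s u \<in> U"
      using u subspace_scale[OF U] by (auto simp: mult.commute)
    then show "c *s v \<in> (*s) a ` U" by blast
  qed
  from subspace_sums[OF this B]
  have "subspace {v + b | v b. v \<in> (*s) a ` U \<and> b \<in> B}" .
  moreover have "{v + b | v b. v \<in> (*s) a ` U \<and> b \<in> B} = {a *s u + b | u b. u \<in> U \<and> b \<in> B}"
    by blast
  ultimately show ?thesis by simp
qed

lemma subspace_torsion:
  assumes U: "subspace U" and B: "subspace B"
  shows "subspace {u \<in> U. a *s u \<in> B}"
  unfolding subspace_def
proof (intro conjI ballI allI)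
  show "0 \<in> {u \<in> U. a *s u \<in> B}" using subspace_0[OF U] subspace_0[OF B] by simp
  fix v assume v: "v \<in> {u \<in> U. a *s u \<in> B}"
  { fix w assume "w \<in> {u \<in> U. a *s u \<in> B}"
    then show "v + w \<in> {u \<in> U. a *s u \<in> B}"
      using v subspace_add[OF U] subspace_add[OF B] by (simp add: scale_right_distrib) }
  fix c
  have "a *s (c *s v) = c *s (a *s v)" by (rule scale_left_commute)
  then show "c *s v \<in> {u \<in> U. a *s u \<in> B}"
    using v subspace_scale[OF U] subspace_scale[OF B] by (auto simp del: scale_scale)
qed

text \<open>\<open>artinian B Z\<close> says that the subquotient \<open>Z / B\<close> satisfies the descending chain
  condition.\<close>

definition artinian :: "'b set \<Rightarrow> 'b set \<Rightarrow> bool" where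
  "artinian B Z \<longleftrightarrow> (\<forall>C :: nat \<Rightarrow> 'b set.
     (\<forall>n. subspace (C n) \<and> B \<subseteq> C n \<and> C n \<subseteq> Z \<and> C (Suc n) \<subseteq> C n) \<longrightarrow> (\<exists>N. \<forall>n\<ge>N. C n = C N))"

lemma artinianI:
  assumes "\<And>C :: nat \<Rightarrow> 'b set. (\<And>n. subspace (C n)) \<Longrightarrow> (\<And>n. B \<subseteq> C n) \<Longrightarrow> (\<And>n. C n \<subseteq> Z) \<Longrightarrow>
    (\<And>n. C (Suc n) \<subseteq> C n) \<Longrightarrow> (\<And>i j. i \<le> j \<Longrightarrow> C j \<subseteq> C i) \<Longrightarrow> \<exists>N. \<forall>n\<ge>N. C n \<supseteq> C N"
  shows "artinian B Z"
  unfolding artinian_def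
proof (intro allI impI)
  fix C :: "nat \<Rightarrow> 'b set"
  assume "\<forall>n. subspace (C n) \<and> B \<subseteq> C n \<and> C n \<subseteq> Z \<and> C (Suc n) \<subseteq> C n"
  then have C: "subspace (C n)" "B \<subseteq> C n" "C n \<subseteq> Z" "C (Suc n) \<subseteq> C n" for n by auto
  have dec: "C j \<subseteq> C i" if "i \<le> j" for i j
    using lift_Suc_antimono_le[of C, OF C(4) that] .
  show "\<exists>N. \<forall>n\<ge>N. C n = C N"
    using assms[of C, OF C(1-4) dec] dec by blast
qed

lemma artinianD:
  assumes "artinian B Z"
    and "\<And>n. subspace (C n)" "\<And>n. B \<subseteq> C n" "\<And>n. C n \<subseteq> Z" "\<And>n. C (Suc n) \<subseteq> C n"
  shows "\<exists>N. \<forall>n\<ge>N. C n = C N"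
  using assms unfolding artinian_def by blast

lemma artinian_wf:
  assumes "artinian B Z"
  shows "wf {(V, U). (subspace V \<and> B \<subseteq> V \<and> V \<subseteq> Z) \<and> (subspace U \<and> B \<subseteq> U \<and> U \<subseteq> Z) \<and> V \<subset> U}"
  by (rule chain_stationary_wf) (use artinianD[OF assms] in blast)


text \<open>In the sequence Z1/B1 -> Z/B -> Z3/B3, exact in the middle and starting with
  multiplication by \<open>x\<close>, a chain in Z/B is determined by its preimages \<open>L\<close>
  on the left and its images \<open>U\<close> on the right.\<close>

lemma artinian_extension:
  assumes sub: "subspace B1" "subspace Z1" "subspace B" "subspace Z" "subspace B3" "subspace Z3"
    and incl: "Z \<subseteq> Z3" "B \<subseteq> B3" "B3 \<subseteq> Z3" "B1 \<subseteq> Z1"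
    and left: "artinian B1 Z1" and right: "artinian B3 Z3"
    and map: "\<And>c. c \<in> B1 \<Longrightarrow> x *s c \<in> B"
    and exact: "\<And>c. c \<in> Z \<Longrightarrow> c \<in> B3 \<Longrightarrow> \<exists>c'\<in>Z1. c - x *s c' \<in> B"
  shows "artinian B Z"
proof (rule artinianI)
  fix C :: "nat \<Rightarrow> 'b set"
  assume C: "\<And>n. subspace (C n)" "\<And>n. B \<subseteq> C n" "\<And>n. C n \<subseteq> Z" "\<And>n. C (Suc n) \<subseteq> C n"
    and dec: "\<And>i j. i \<le> j \<Longrightarrow> C j \<subseteq> C i"
  define L where "L n = {c \<in> Z1. x *s c \<in> C n}" for n
  define U where "U n = {c + b | c b. c \<in> C n \<and> b \<in> B3}" for n
  have "\<exists>N. \<forall>n\<ge>N. L n = L N"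
  proof (rule artinianD[OF left])
    fix n
    show "subspace (L n)"
      unfolding L_def by (rule subspace_torsion[OF sub(2) C(1)])
    show "B1 \<subseteq> L n" "L n \<subseteq> Z1" "L (Suc n) \<subseteq> L n"
      using incl(4) map C(2,4) unfolding L_def by blast+
  qed
  then obtain N1 where N1: "\<And>n. n \<ge> N1 \<Longrightarrow> L n = L N1" by blast
  have "\<exists>N. \<forall>n\<ge>N. U n = U N"
  proof (rule artinianD[OF right])
    fix n
    show "subspace (U n)" unfolding U_def by (rule subspace_sums[OF C(1) sub(5)])
    show "B3 \<subseteq> U n"
    proof
      fix b assume "b \<in> B3"
      moreover have "0 \<in> C n" "b = 0 + b" using subspace_0[OF C(1)] by auto
      ultimately show "b \<in> U n" unfolding U_def by blast
    qed
    show "U n \<subseteq> Z3"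
      using C(3)[of n] incl subspace_add[OF sub(6)] unfolding U_def by blast
    show "U (Suc n) \<subseteq> U n" using C(4)[of n] unfolding U_def by blast
  qed
  then obtain N2 where N2: "\<And>n. n \<ge> N2 \<Longrightarrow> U n = U N2" by blast
  define N where "N = max N1 N2"
  have "C N \<subseteq> C n" if n: "n \<ge> N" for n
  proof
    fix c assume c: "c \<in> C N"
    have "c = c + 0" "0 \<in> B3" using subspace_0[OF sub(5)] by auto
    then have "c \<in> U N" using c unfolding U_def by blast
    then have "c \<in> U n" using N2[of N] N2[of n] n unfolding N_def by auto
    then obtain d b where d: "d \<in> C n" "b \<in> B3" "c = d + b" unfolding U_def by blast
    \<comment> \<open>The elements \<open>c\<close> and \<open>d\<close> agree on the right, so
      their difference comes from the left, where the preimages have stabilized.\<close>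
    have b: "b = c - d" using d(3) by simp
    have dN: "d \<in> C N" using d(1) dec[OF n] by blast
    have bN: "b \<in> C N" unfolding b by (rule subspace_diff[OF C(1) c dN])
    then obtain c' where c': "c' \<in> Z1" "b - x *s c' \<in> B" using exact[of b] C(3) d(2) by blast
    have "x *s c' = b - (b - x *s c')" by simp
    then have "x *s c' \<in> C N" using subspace_diff[OF C(1) bN, of "b - x *s c'"] c'(2) C(2) by auto
    then have "c' \<in> L N" using c'(1) unfolding L_def by blast
    then have "x *s c' \<in> C n" using N1[of N] N1[of n] n unfolding N_def L_def by auto
    moreover have "c = d + ((b - x *s c') + x *s c')" using d(3) by simp
    ultimately show "c \<in> C n" using d(1) c'(2) C(2) subspace_add[OF C(1)] by (metis subsetD)
  qed
  then show "\<exists>N. \<forall>n\<ge>N. C N \<subseteq> C n" by blast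
qed

text \<open>The chain condition is pulled back along \<open>\<rho>\<close>. A relation is used
  instead of a map because the connecting homomorphism is available only as a relation between
  representatives; that \<open>\<rho> 0 c\<close> forces \<open>c\<close> into \<open>B\<close> is
  its single-valuedness.\<close>

lemma artinian_correspondence:
  assumes sub: "subspace B1" "subspace Z1" "subspace B" "subspace Z"
    and incl: "B1 \<subseteq> Z1" "B \<subseteq> Z" and art: "artinian B1 Z1"
    and add: "\<And>b c b' c'. \<rho> b c \<Longrightarrow> \<rho> b' c' \<Longrightarrow> \<rho> (b + b') (c + c')"
    and scale: "\<And>r b c. \<rho> b c \<Longrightarrow> \<rho> (r *s b) (r *s c)"
    and zero: "\<rho> 0 0" "\<And>c. c \<in> Z \<Longrightarrow> \<rho> 0 c \<Longrightarrow> c \<in> B"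
    and onto: "\<And>c. c \<in> Z \<Longrightarrow> \<exists>b\<in>Z1. \<rho> b c"
    and B: "\<And>b. b \<in> B1 \<Longrightarrow> \<exists>c\<in>B. \<rho> b c"
  shows "artinian B Z"
proof (rule artinianI)
  fix C :: "nat \<Rightarrow> 'b set"
  assume C: "\<And>n. subspace (C n)" "\<And>n. B \<subseteq> C n" "\<And>n. C n \<subseteq> Z" "\<And>n. C (Suc n) \<subseteq> C n"
    and dec: "\<And>i j. i \<le> j \<Longrightarrow> C j \<subseteq> C i"
  define L where "L n = {b \<in> Z1. \<exists>c\<in>C n. \<rho> b c}" for n
  have "\<exists>N. \<forall>n\<ge>N. L n = L N"
  proof (rule artinianD[OF art])
    fix n
    show "subspace (L n)"
      unfolding subspace_def
    proof (intro conjI ballI allI)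
      show "0 \<in> L n"
        using subspace_0[OF sub(2)] subspace_0[OF C(1)] zero(1) unfolding L_def by blast
      fix a assume "a \<in> L n"
      then obtain c where a: "a \<in> Z1" "c \<in> C n" "\<rho> a c" unfolding L_def by blast
      { fix b assume "b \<in> L n"
        then obtain d where b: "b \<in> Z1" "d \<in> C n" "\<rho> b d" unfolding L_def by blast
        have "a + b \<in> Z1" "c + d \<in> C n" "\<rho> (a + b) (c + d)"
          using subspace_add[OF sub(2) a(1) b(1)] subspace_add[OF C(1) a(2) b(2)] add[OF a(3) b(3)] by auto
        then show "a + b \<in> L n" unfolding L_def by blast }
      fix r
      have "r *s a \<in> Z1" "r *s c \<in> C n" "\<rho> (r *s a) (r *s c)"
        using subspace_scale[OF sub(2) a(1)] subspace_scale[OF C(1) a(2)] scale[OF a(3)] by auto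
      then show "r *s a \<in> L n" unfolding L_def by blast
    qed
    show "B1 \<subseteq> L n" "L n \<subseteq> Z1" "L (Suc n) \<subseteq> L n"
      using incl B C(2,4) unfolding L_def by blast+
  qed
  then obtain N where N: "\<And>n. n \<ge> N \<Longrightarrow> L n = L N" by blast
  have "C N \<subseteq> C n" if n: "n \<ge> N" for n
  proof
    fix c assume c: "c \<in> C N"
    then obtain b where b: "b \<in> Z1" "\<rho> b c" using onto C(3) by blast
    then have "b \<in> L n" using c N[OF n] unfolding L_def by blast
    then obtain c' where c': "c' \<in> C n" "\<rho> b c'" unfolding L_def by blast
    have "\<rho> (b + (-1) *s b) (c + (-1) *s c')" by (intro add scale b c')
    then have "\<rho> 0 (c - c')" by simp
    moreover have "c - c' \<in> Z" using c c' C(3) subspace_diff[OF sub(4)] by blast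
    ultimately have "c - c' \<in> C n" using zero(2) C(2) by blast
    then show "c \<in> C n" using subspace_add[OF C(1) _ c'(1)] by fastforce
  qed
  then show "\<exists>N. \<forall>n\<ge>N. C N \<subseteq> C n" by blast
qed

text \<open>Melkersson's criterion. The subspaces \<open>V j n\<close> of the \<open>x\<close>-torsion, the images
  under \<open>x^n\<close> of the \<open>x^(n+1)\<close>-torsion of \<open>C j\<close>, decrease in both indices and determine the
  chain \<open>C\<close>.\<close>

lemma artinian_torsion:
  assumes sub: "subspace B" "subspace Z" and incl: "B \<subseteq> Z"
    and art: "artinian B {c \<in> Z. x *s c \<in> B}"
    and tors: "\<And>c. c \<in> Z \<Longrightarrow> \<exists>k. x ^ k *s c \<in> B"
  shows "artinian B Z"
proof (rule artinianI)
  fix C :: "nat \<Rightarrow> 'b set"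
  assume C: "\<And>n. subspace (C n)" "\<And>n. B \<subseteq> C n" "\<And>n. C n \<subseteq> Z" "\<And>n. C (Suc n) \<subseteq> C n"
    and dec: "\<And>i j. i \<le> j \<Longrightarrow> C j \<subseteq> C i"
  define V where "V j n = {x ^ n *s c + b | c b. c \<in> {c \<in> C j. x ^ Suc n *s c \<in> B} \<and> b \<in> B}" for j n
  have tsub: "subspace {c \<in> C j. x ^ n *s c \<in> B}" for j n
    by (rule subspace_torsion[OF C(1) sub(1)])
  have Vsub: "subspace (V j n)" for j n
    unfolding V_def by (rule subspace_scale_plus[OF tsub sub(1)])
  have VB: "B \<subseteq> V j n" for j n
  proof
    fix b assume "b \<in> B"
    moreover have "b = x ^ n *s 0 + b" by simp
    moreover have "0 \<in> {c \<in> C j. x ^ Suc n *s c \<in> B}" using subspace_0[OF tsub] .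
    ultimately show "b \<in> V j n" unfolding V_def by blast
  qed
  have VZ: "V j n \<subseteq> {c \<in> Z. x *s c \<in> B}" for j n
  proof
    fix v assume "v \<in> V j n"
    then obtain c b where v: "v = x ^ n *s c + b" "c \<in> C j" "x ^ Suc n *s c \<in> B" "b \<in> B"
      unfolding V_def by blast
    have "x *s v = x ^ Suc n *s c + x *s b" unfolding v(1) by (simp add: scale_right_distrib)
    then have "x *s v \<in> B" using v subspace_add[OF sub(1)] subspace_scale[OF sub(1)] by auto
    moreover have "v \<in> Z"
      unfolding v(1) using v C(3)[of j] incl subspace_add[OF sub(2)] subspace_scale[OF sub(2)] by blast
    ultimately show "v \<in> {c \<in> Z. x *s c \<in> B}" by blast
  qed
  have Vj: "V j' n \<subseteq> V j n" if "j \<le> j'" for j j' n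
    using dec[OF that] unfolding V_def by blast
  have Vn1: "V j (Suc n) \<subseteq> V j n" for j n
  proof
    fix v assume "v \<in> V j (Suc n)"
    then obtain c b where v: "v = x ^ Suc n *s c + b" "c \<in> C j" "x ^ Suc (Suc n) *s c \<in> B" "b \<in> B"
      unfolding V_def by blast
    have "v = x ^ n *s (x *s c) + b" "x ^ Suc n *s (x *s c) \<in> B"
      using v(1,3) by (simp_all add: mult.commute mult.left_commute)
    moreover have "x *s c \<in> C j" using v(2) subspace_scale[OF C(1)] by blast
    ultimately show "v \<in> V j n" using v(4) unfolding V_def by blast
  qed
  have Vn: "V j n' \<subseteq> V j n" if "n \<le> n'" for j n n'
    using lift_Suc_antimono_le[of "V j", OF Vn1 that] .
  have stat: "\<exists>N. \<forall>j\<ge>N. V j n = V N n" for n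
    by (rule artinianD[OF art Vsub VB VZ]) (rule Vj, simp)
  \<comment> \<open>The diagonal controls all \<open>n\<close> beyond \<open>K\<close> at once,
    since \<open>V\<close> decreases in both indices. The finitely many rows up to \<open>K\<close>
    are covered by the maximum in \<open>N\<close>.\<close>
  have "\<exists>N. \<forall>k\<ge>N. V k k = V N N"
    by (rule artinianD[OF art Vsub VB VZ]) (use Vj Vn1 in \<open>blast intro: le_SucI\<close>)
  then obtain K where K: "\<And>k. k \<ge> K \<Longrightarrow> V k k = V K K" by blast
  from stat obtain g where g: "\<And>n j. j \<ge> g n \<Longrightarrow> V j n = V (g n) n" by metis
  define N where "N = max K (Max (g ` {..K}))"
  have gN: "g n \<le> N" if "n \<le> K" for n
    using that unfolding N_def by (simp add: le_max_iff_disj)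
  have V: "V N n \<subseteq> V j n" if j: "j \<ge> N" for j n
  proof (cases "n \<le> K")
    case True
    then show ?thesis using g[of n N] g[of n j] gN[OF True] j by auto
  next
    case False
    then have "V N n \<subseteq> V K K" using Vj[of K N n] Vn[of K n K] unfolding N_def by auto
    also have "\<dots> = V (max j n) (max j n)" using K[of "max j n"] j unfolding N_def by auto
    also have "\<dots> \<subseteq> V j n" using Vj[of j "max j n" "max j n"] Vn[of n "max j n" j] by auto
    finally show ?thesis .
  qed
  \<comment> \<open>Induction on the order of torsion: the inclusion of \<open>V N k\<close> in
    \<open>V j k\<close> provides \<open>d\<close> in the smaller member such that
    \<open>c - d\<close> has order one less.\<close>
  have "c \<in> C j" if j: "j \<ge> N" and "c \<in> C N" "x ^ k *s c \<in> B" for j k c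
    using that(2,3)
  proof (induction k arbitrary: c)
    case 0
    then show ?case using C(2)[of j] by auto
  next
    case (Suc k)
    have "x ^ k *s c + 0 \<in> V N k"
      using Suc.prems subspace_0[OF sub(1)] unfolding V_def by blast
    then have "x ^ k *s c \<in> V j k" using V[OF j] by auto
    then obtain d b where d: "x ^ k *s c = x ^ k *s d + b" "d \<in> C j" "b \<in> B"
      unfolding V_def by blast
    have "x ^ k *s (c - d) = b" using d(1) by (simp add: scale_right_diff_distrib)
    moreover have "c - d \<in> C N" using Suc.prems(1) d(2) dec[OF j] subspace_diff[OF C(1)] by blast
    ultimately have "c - d \<in> C j" using Suc.IH d(3) by blast
    then show ?case using subspace_add[OF C(1) _ d(2)] by fastforce
  qed
  then have "C N \<subseteq> C n" if "n \<ge> N" for n using that tors C(3)[of N] by blast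
  then show "\<exists>N. \<forall>n\<ge>N. C N \<subseteq> C n" by blast
qed

text \<open>Dual of the statement that the zero divisors of a finitely generated module are covered
  by finitely many primes.\<close>

lemma artinian_avoidance:
  assumes art: "artinian B Z" and sub: "subspace B" "subspace Z" and incl: "B \<subseteq> Z"
  shows "\<exists>F s. finite F \<and> (\<forall>q\<in>F. prime_ideal q \<and> q \<noteq> m) \<and>
    (\<forall>x. (\<forall>q\<in>F. x \<notin> q) \<longrightarrow> (\<forall>u\<in>products m s. \<forall>z\<in>Z. \<exists>z'\<in>Z. u *s z - x *s z' \<in> B))"
proof -
  let ?sub = "\<lambda>U. subspace U \<and> B \<subseteq> U \<and> U \<subseteq> Z"
  define good where "good U F s \<longleftrightarrow> finite F \<and> (\<forall>q\<in>F. prime_ideal q \<and> q \<noteq> m) \<and>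
    (\<forall>x. (\<forall>q\<in>F. x \<notin> q) \<longrightarrow> (\<forall>u\<in>products m s. \<forall>z\<in>U. \<exists>z'\<in>U. u *s z - x *s z' \<in> B))" for U F s
  have "?sub U \<Longrightarrow> \<exists>F s. good U F s" for U
  proof (induction U rule: wf_induct_rule[OF artinian_wf[OF art]])
    case (1 U)
    then have U: "subspace U" "B \<subseteq> U" "U \<subseteq> Z" by auto
    have IH: "\<exists>F s. good V F s" if V: "subspace V" "B \<subseteq> V" "V \<subset> U" for V
      by (rule "1.IH"[of V]) (use V U in blast)+
    show ?case
    proof (cases "U = B")
      case True
      have "good U {} 0"
        unfolding good_def
      proof (intro conjI allI impI ballI)
        fix x u z assume "z \<in> U"
        then have "u *s z - x *s 0 \<in> B" using True subspace_scale[OF sub(1)] by simp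
        then show "\<exists>z'\<in>U. u *s z - x *s z' \<in> B" using True subspace_0[OF sub(1)] by blast
      qed auto
      then show ?thesis by blast
    next
      case UB: False
      show ?thesis
      proof (cases "\<exists>a. \<not> (\<forall>u\<in>U. a *s u \<in> B) \<and> \<not> U \<subseteq> {a *s u + b | u b. u \<in> U \<and> b \<in> B}")
        case True
        then obtain a where a: "\<not> (\<forall>u\<in>U. a *s u \<in> B)" "\<not> U \<subseteq> {a *s u + b | u b. u \<in> U \<and> b \<in> B}"
          by blast
        \<comment> \<open>Since \<open>a\<close> is neither zero nor surjective on U/B, its image
          \<open>V\<close> and kernel \<open>K\<close> are proper. Given \<open>z\<close>, a product
          \<open>u2\<close> allows division of the image of \<open>z\<close> by \<open>x\<close>
          inside \<open>V\<close>; the error of the lifted quotient lies in \<open>K\<close>, where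
          \<open>u1\<close> allows division again. Hence the exponents add.\<close>
        define V where "V = {a *s u + b | u b. u \<in> U \<and> b \<in> B}"
        define K where "K = {u \<in> U. a *s u \<in> B}"
        have Vs: "subspace V" unfolding V_def by (rule subspace_scale_plus[OF U(1) sub(1)])
        have Vi: "v \<in> V" if "v = a *s u + b" "u \<in> U" "b \<in> B" for v u b using that unfolding V_def by blast
        have "B \<subseteq> V" using Vi[of _ 0] subspace_0[OF U(1)] by auto
        moreover have "V \<subseteq> U"
          using U subspace_add[OF U(1)] subspace_scale[OF U(1)] unfolding V_def by blast
        ultimately obtain F2 s2 where V: "good V F2 s2"
          using IH[OF Vs] a(2) unfolding V_def[symmetric] by blast
        have Ks: "subspace K"
          unfolding K_def by (rule subspace_torsion[OF U(1) sub(1)])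
        have "B \<subseteq> K" using U(2) subspace_scale[OF sub(1)] unfolding K_def by blast
        moreover have "K \<subset> U" using a(1) unfolding K_def by blast
        ultimately obtain F1 s1 where K: "good K F1 s1" using IH[OF Ks] by blast
        have "good U (F1 \<union> F2) (s1 + s2)"
          unfolding good_def
      proof (intro conjI allI impI ballI)
          fix x u z assume x: "\<forall>q\<in>F1 \<union> F2. x \<notin> q" and u: "u \<in> products m (s1 + s2)" and z: "z \<in> U"
          obtain u1 u2 where u12: "u1 \<in> products m s1" "u2 \<in> products m s2" "u = u1 * u2"
            using products_add[OF u] by blast
          have "a *s z \<in> V" using Vi[of "a *s z" z 0] z subspace_0[OF sub(1)] by simp
          then obtain v where v: "v \<in> V" "u2 *s (a *s z) - x *s v \<in> B" using V x u12(2) unfolding good_def by blast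
          then obtain w b where w: "v = a *s w + b" "w \<in> U" "b \<in> B" unfolding V_def by blast
          have "a *s (u2 *s z - x *s w) = (u2 *s (a *s z) - x *s v) + x *s b"
            unfolding w(1)
            by (simp add: scale_right_diff_distrib scale_right_distrib mult.commute[of a])
          then have "a *s (u2 *s z - x *s w) \<in> B"
            using subspace_add[OF sub(1) v(2) subspace_scale[OF sub(1) w(3)]] by simp
          then have "u2 *s z - x *s w \<in> K"
            unfolding K_def using z w(2) subspace_diff[OF U(1)] subspace_scale[OF U(1)] by blast
          then obtain k where k: "k \<in> K" "u1 *s (u2 *s z - x *s w) - x *s k \<in> B"
            using K x u12(1) unfolding good_def by blast
          have "u *s z - x *s (u1 *s w + k) = u1 *s (u2 *s z - x *s w) - x *s k"
            unfolding u12(3)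
            by (simp add: scale_right_diff_distrib scale_right_distrib mult.commute[of x])
          moreover have "u1 *s w + k \<in> U"
            using w(2) k(1) subspace_add[OF U(1)] subspace_scale[OF U(1)] unfolding K_def by blast
          ultimately show "\<exists>z'\<in>U. u *s z - x *s z' \<in> B" using k(2) by metis
        qed (use V K in \<open>auto simp: good_def\<close>)
        then show ?thesis by blast
      next
        case False
        \<comment> \<open>Now every \<open>a\<close> acts on U/B as zero or surjectively: the module
          is secondary and \<open>q\<close> is its attached prime. If \<open>q = m\<close>, one
          factor from \<open>m\<close> already kills it and no prime has to be avoided.\<close>
        define q where "q = {a. \<forall>u\<in>U. a *s u \<in> B}"
        have div: "U \<subseteq> {a *s u + b | u b. u \<in> U \<and> b \<in> B}" if "a \<notin> q" for a
          using False that unfolding q_def by blast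
        have "cideal q"
          unfolding cideal_def q_def using subspace_0[OF sub(1)]
          by (auto simp: scale_left_distrib scale_scale[symmetric] simp del: scale_scale
            intro: subspace_add[OF sub(1)] subspace_scale[OF sub(1)])
        moreover have "1 \<notin> q" using UB U(2) unfolding q_def by auto
        moreover have "b \<in> q" if ab: "a * b \<in> q" "a \<notin> q" for a b
        proof -
          have "b *s u \<in> B" if u: "u \<in> U" for u
          proof -
            obtain v c where v: "u = a *s v + c" "v \<in> U" "c \<in> B" using div[OF ab(2)] u by blast
            have "b *s u = (a * b) *s v + b *s c"
              unfolding v(1) by (simp add: scale_right_distrib mult.commute[of a])
            moreover have "(a * b) *s v \<in> B" using ab(1) v(2) unfolding q_def by blast
            ultimately show ?thesis using v(3) subspace_add[OF sub(1)] subspace_scale[OF sub(1)] by metis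
          qed
          then show ?thesis unfolding q_def by blast
        qed
        ultimately have q: "prime_ideal q" unfolding prime_ideal_def by blast
        show ?thesis
        proof (cases "q = m")
          case True
          have "good U {} (Suc 0)"
            unfolding good_def
      proof (intro conjI allI impI ballI)
            fix x u z assume "u \<in> products m (Suc 0)" "z \<in> U"
            then have "u *s z - x *s 0 \<in> B" using True unfolding q_def by auto
            then show "\<exists>z'\<in>U. u *s z - x *s z' \<in> B" using subspace_0[OF U(1)] by blast
          qed auto
          then show ?thesis by blast
        next
          case False
          have "good U {q} 0"
            unfolding good_def
      proof (intro conjI allI impI ballI)
            fix x u z assume "\<forall>q\<in>{q}. x \<notin> q" "u \<in> products m 0" "z \<in> U"
            then obtain v c where "z = x *s v + c" "v \<in> U" "c \<in> B" "u = 1" using div[of x] by auto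
            then show "\<exists>z'\<in>U. u *s z - x *s z' \<in> B" by (intro bexI[of _ v]) auto
          qed (use q False in auto)
          then show ?thesis by blast
        qed
      qed
    qed
  qed
  then have "\<exists>F s. good Z F s" using sub incl by blast
  then show ?thesis unfolding good_def .
qed

end

section \<open>Limits of Koszul cohomology\<close>

text \<open>Koszul cochains of the powers \<open>w^n\<close> of a list of ring elements: \<open>bool list\<close> indexes the
  subsets of the list, so a cochain of \<open>w # ws\<close> is a pair \<open>(a, b)\<close> of cochains of \<open>ws\<close>
  with differential \<open>(d a, w^n a - d b)\<close>. The factors \<open>kweight\<close> are the transition maps from
  the complex of \<open>w^n\<close> to that of \<open>w^(n+1)\<close>, whose limit is the Cech complex.\<close>

primrec kd :: "nat \<Rightarrow> 'a::comm_ring_1 list \<Rightarrow> (bool list \<Rightarrow> 'a) \<Rightarrow> bool list \<Rightarrow> 'a" where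
  "kd n [] c = (\<lambda>l. 0)"
| "kd n (w # ws) c = (\<lambda>l. case l of [] \<Rightarrow> 0 | b # l' \<Rightarrow>
     if b then w ^ n * c (False # l') - kd n ws (\<lambda>k. c (True # k)) l'
     else kd n ws (\<lambda>k. c (False # k)) l')"

primrec kweight :: "'a::comm_ring_1 list \<Rightarrow> bool list \<Rightarrow> 'a" where
  "kweight [] l = 1"
| "kweight (w # ws) l = (case l of [] \<Rightarrow> 1 | b # l' \<Rightarrow> (if b then w else 1) * kweight ws l')"

text \<open>Contraction with the \<open>j\<close>-th basis vector. The minus sign answers the one in
  the differential of a pair.\<close>

primrec khomotopy :: "nat \<Rightarrow> (bool list \<Rightarrow> 'a::comm_ring_1) \<Rightarrow> bool list \<Rightarrow> 'a" where
  "khomotopy 0 c = (\<lambda>l. case l of [] \<Rightarrow> 0 | b # l' \<Rightarrow> if b then 0 else c (True # l'))"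
| "khomotopy (Suc j) c = (\<lambda>l. case l of [] \<Rightarrow> 0 | b # l' \<Rightarrow>
     if b then - khomotopy j (\<lambda>k. c (True # k)) l' else khomotopy j (\<lambda>k. c (False # k)) l')"

definition cochain :: "'a::comm_ring_1 list \<Rightarrow> nat \<Rightarrow> (bool list \<Rightarrow> 'a) \<Rightarrow> bool" where
  "cochain ws i c \<longleftrightarrow> (\<forall>l. c l \<noteq> 0 \<longrightarrow> length l = length ws \<and> count_list l True = i)"

text \<open>Cochains of degree \<open>i - 1\<close>; only \<open>0\<close> for \<open>i = 0\<close>.\<close>

definition precochain :: "'a::comm_ring_1 list \<Rightarrow> nat \<Rightarrow> (bool list \<Rightarrow> 'a) \<Rightarrow> bool" where
  "precochain ws i c \<longleftrightarrow> (\<forall>l. c l \<noteq> 0 \<longrightarrow> length l = length ws \<and> Suc (count_list l True) = i)"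

lemma precochain_Suc: "precochain ws (Suc i) c \<longleftrightarrow> cochain ws i c"
  by (simp add: precochain_def cochain_def)

lemma precochain_zero: "precochain ws 0 c \<longleftrightarrow> c = (\<lambda>l. 0)"
  by (auto simp: precochain_def)

lemma kd_zero [simp]: "kd n ws (\<lambda>l. 0) l = 0"
  by (induction ws arbitrary: l) (auto split: list.split)

lemma kd_add: "kd n ws (\<lambda>l. c l + d l) l = kd n ws c l + kd n ws d l"
  by (induction ws arbitrary: c d l) (auto split: list.split simp: algebra_simps)

lemma kd_plus: "kd n ws (c + d) l = kd n ws c l + kd n ws d l"
  using kd_add[of n ws c d l] by (simp add: plus_fun_def)

lemma kd_scale: "kd n ws (\<lambda>l. r * c l) l = r * kd n ws c l"
  by (induction ws arbitrary: c l) (auto split: list.split simp: algebra_simps)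

lemma kd_uminus: "kd n ws (\<lambda>l. - c l) l = - kd n ws c l"
  using kd_scale[of n ws "-1" c l] by simp

lemma kd_diff: "kd n ws (\<lambda>l. c l - d l) l = kd n ws c l - kd n ws d l"
  using kd_add[of n ws c "\<lambda>l. - d l" l] by (simp add: kd_uminus)

lemma kd_kd [simp]: "kd n ws (kd n ws c) l = 0"
proof (induction ws arbitrary: c l)
  case (Cons w ws)
  then show ?case
    by (auto split: list.split simp: kd_diff kd_scale)
qed simp

text \<open>Adding \<open>w\<close> to an index multiplies the weight by \<open>w\<close>, and its
  \<open>t\<close>-th power turns the coefficient \<open>w ^ n\<close> of the differential into
  \<open>w ^ (n + t)\<close>. The weights thus form chain maps between the stages.\<close>

lemma kd_kweight:
  "kd (n + t) ws (\<lambda>l. kweight ws l ^ t * c l) l = kweight ws l ^ t * kd n ws c l"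
proof (induction ws arbitrary: c l)
  case (Cons w ws)
  have "kd (n + t) ws (\<lambda>k. (w * kweight ws k) ^ t * c (True # k)) l'
      = w ^ t * (kweight ws l' ^ t * kd n ws (\<lambda>k. c (True # k)) l')" for l'
  proof -
    have "kd (n + t) ws (\<lambda>k. (w * kweight ws k) ^ t * c (True # k)) l'
        = kd (n + t) ws (\<lambda>k. w ^ t * (kweight ws k ^ t * c (True # k))) l'"
      by (simp add: power_mult_distrib mult.assoc)
    then show ?thesis by (simp only: kd_scale Cons.IH)
  qed
  then show ?case
    by (auto split: list.split simp: Cons.IH power_mult_distrib power_add right_diff_distrib mult.assoc)
qed simp

lemma kd_ideal: "cideal I \<Longrightarrow> (\<And>l. c l \<in> I) \<Longrightarrow> kd n ws c l \<in> I"
  by (induction ws arbitrary: c l)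
    (auto split: list.split simp: cideal_zero intro!: cideal_diff cideal_mult)

lemma cochain_kd: "precochain ws i b \<Longrightarrow> cochain ws i (kd n ws b)"
proof (induction ws arbitrary: b i)
  case (Cons w ws)
  show ?case
  proof (cases i)
    case 0
    then show ?thesis using Cons.prems by (simp add: precochain_zero cochain_def split: list.split)
  next
    case (Suc i')
    have "precochain ws i' (\<lambda>k. b (True # k))" "precochain ws i (\<lambda>k. b (False # k))"
      using Cons.prems unfolding Suc precochain_def by force+
    then have IH: "cochain ws i' (kd n ws (\<lambda>k. b (True # k)))" "cochain ws i (kd n ws (\<lambda>k. b (False # k)))"
      using Cons.IH by auto
    have F: "length l = length ws \<and> count_list l True = i'" if "b (False # l) \<noteq> 0" for l
      using Cons.prems that unfolding precochain_def Suc by force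
    show ?thesis
      unfolding cochain_def
    proof (intro allI impI)
      fix l assume l: "kd n (w # ws) b l \<noteq> 0"
      then obtain a l' where a: "l = a # l'" by (cases l) auto
      show "length l = length (w # ws) \<and> count_list l True = i"
      proof (cases a)
        case True
        then have "b (False # l') \<noteq> 0 \<or> kd n ws (\<lambda>k. b (True # k)) l' \<noteq> 0"
          using l a by auto
        then have "length l' = length ws \<and> count_list l' True = i'"
          using F IH(1) unfolding cochain_def by blast
        then show ?thesis using a True Suc by simp
      next
        case False
        then have "kd n ws (\<lambda>k. b (False # k)) l' \<noteq> 0" using l a by auto
        then show ?thesis using IH(2) a False unfolding cochain_def by auto
      qed
    qed
  qed
qed (simp add: cochain_def)

lemma khomotopy_zero [simp]: "khomotopy j (\<lambda>l. 0) l = 0"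
  by (induction j arbitrary: l) (auto split: list.split)

lemma khomotopy_add: "khomotopy j (\<lambda>l. c l + d l) l = khomotopy j c l + khomotopy j d l"
  by (induction j arbitrary: c d l) (auto split: list.split simp: algebra_simps)

lemma khomotopy_scale: "khomotopy j (\<lambda>l. r * c l) l = r * khomotopy j c l"
  by (induction j arbitrary: c l) (auto split: list.split simp: algebra_simps)

lemma khomotopy_diff: "khomotopy j (\<lambda>l. c l - d l) l = khomotopy j c l - khomotopy j d l"
  using khomotopy_add[of j c "\<lambda>l. - d l" l] khomotopy_scale[of j "-1" d l] by simp

lemma khomotopy_ideal: "cideal I \<Longrightarrow> (\<And>l. c l \<in> I) \<Longrightarrow> khomotopy j c l \<in> I"
  by (induction j arbitrary: c l) (auto split: list.split simp: cideal_zero intro!: cideal_minus)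

text \<open>In first position both sides can be read off from the differential of a pair; in later
  positions the mixed terms with factor \<open>w ^ n\<close> cancel by the sign. Consequently
  \<open>(ws ! j) ^ n\<close> annihilates Koszul cohomology at stage \<open>n\<close>.\<close>

lemma khomotopy:
  "j < length ws \<Longrightarrow> length l = length ws \<Longrightarrow>
    kd n ws (khomotopy j c) l + khomotopy j (kd n ws c) l = (ws ! j) ^ n * c l"
proof (induction ws arbitrary: j c l)
  case (Cons w ws)
  obtain b l' where l: "l = b # l'" "length l' = length ws" using Cons.prems by (cases l) auto
  show ?case
  proof (cases j)
    case 0
    then show ?thesis unfolding l(1) by (auto simp: kd_scale)
  next
    case (Suc j')
    have j': "j' < length ws" using Cons.prems Suc by simp
    show ?thesis
    proof (cases b)
      case True
      have "kd n ws (khomotopy j' (\<lambda>k. c (True # k))) l' + khomotopy j' (kd n ws (\<lambda>k. c (True # k))) l'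
          = ws ! j' ^ n * c (True # l')"
        using Cons.IH[OF j' l(2)] .
      then show ?thesis
        unfolding l(1) Suc using True
        by (simp add: kd_uminus khomotopy_diff khomotopy_scale algebra_simps)
    next
      case False
      then show ?thesis
        unfolding l(1) Suc using Cons.IH[OF j' l(2), of "\<lambda>k. c (False # k)"] by simp
    qed
  qed
qed simp

lemma precochain_khomotopy:
  "j < length ws \<Longrightarrow> cochain ws i c \<Longrightarrow> precochain ws i (khomotopy j c)"
proof (induction ws arbitrary: j c i)
  case (Cons w ws)
  show ?case
    unfolding precochain_def
  proof (intro allI impI)
    fix l assume nz: "khomotopy j c l \<noteq> 0"
    then obtain b l' where l: "l = b # l'" by (cases l; cases j) auto
    show "length l = length (w # ws) \<and> Suc (count_list l True) = i"
    proof (cases j)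
      case 0
      then have "\<not> b" "c (True # l') \<noteq> 0" using nz l by (auto split: if_splits)
      then show ?thesis using Cons.prems(2) unfolding l cochain_def by auto
    next
      case (Suc j')
      then have j': "j' < length ws" using Cons.prems by simp
      show ?thesis
      proof (cases b)
        case True
        then have nz': "khomotopy j' (\<lambda>k. c (True # k)) l' \<noteq> 0" using nz l Suc by auto
        have "cochain ws (i - 1) (\<lambda>k. c (True # k))"
          using Cons.prems(2) unfolding cochain_def by force
        moreover have "i \<noteq> 0"
        proof
          assume "i = 0"
          then have "(\<lambda>k. c (True # k)) = (\<lambda>k. 0)" using Cons.prems(2) unfolding cochain_def by force
          then show False using nz' by simp
        qed
        ultimately show ?thesis
          using Cons.IH[OF j'] nz' l True unfolding precochain_def by force
      next
        case False
        then have "khomotopy j' (\<lambda>k. c (False # k)) l' \<noteq> 0" using nz l Suc by auto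
        moreover have "cochain ws i (\<lambda>k. c (False # k))"
          using Cons.prems(2) unfolding cochain_def by force
        ultimately show ?thesis using Cons.IH[OF j'] l False unfolding precochain_def by force
      qed
    qed
  qed
qed simp

text \<open>In top degree only the index with all entries \<open>True\<close> survives. Together
  with \<open>kd_top_onto\<close> this identifies the top Koszul cohomology at stage
  \<open>n\<close> with the ring modulo the powers \<open>w ^ n\<close>.\<close>

lemma kd_top_mem: "kd n ws b (replicate (length ws) True) \<in> gen_ideal ((\<lambda>w. w ^ n) ` set ws)"
proof (induction ws arbitrary: b)
  case Nil
  then show ?case using cideal_zero[OF gen_ideal_ideal] by simp
next
  case (Cons w ws)
  have "w ^ n \<in> gen_ideal ((\<lambda>w. w ^ n) ` set (w # ws))"
    using gen_ideal_superset[of "(\<lambda>w. w ^ n) ` set (w # ws)"] by auto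
  moreover have "gen_ideal ((\<lambda>w. w ^ n) ` set ws) \<subseteq> gen_ideal ((\<lambda>w. w ^ n) ` set (w # ws))"
    by (rule gen_ideal_mono) auto
  ultimately show ?case
    using Cons.IH[of "\<lambda>k. b (True # k)"]
    by (auto intro!: cideal_diff[OF gen_ideal_ideal] cideal_mult2[OF gen_ideal_ideal] simp del: set_simps)
qed

lemma kd_top_onto:
  assumes P: "cideal P"
  shows "u \<in> gen_ideal (P \<union> (\<lambda>w. w ^ n) ` set ws) \<Longrightarrow>
    \<exists>b. precochain ws (length ws) b \<and> u - kd n ws b (replicate (length ws) True) \<in> P"
proof (induction ws arbitrary: u)
  case Nil
  then show ?case
    using gen_ideal_eq[OF P] by (intro exI[of _ "\<lambda>l. 0"]) (simp add: precochain_def)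
next
  case (Cons w ws)
  have "u \<in> adj (gen_ideal (P \<union> (\<lambda>w. w ^ n) ` set ws)) (w ^ n)"
    using Cons.prems by (simp add: gen_ideal_insert)
  then obtain v r where v: "v \<in> gen_ideal (P \<union> (\<lambda>w. w ^ n) ` set ws)" "u = v + r * w ^ n"
    by (auto simp: adj_def)
  obtain b where b: "precochain ws (length ws) b" "v - kd n ws b (replicate (length ws) True) \<in> P"
    using Cons.IH[OF v(1)] by blast
  \<comment> \<open>The sign cancels the one in the differential; the new coefficient
    \<open>r\<close> sits at the index that misses exactly the first element.\<close>
  define b' where "b' l = (case l of [] \<Rightarrow> 0 | t # k \<Rightarrow>
    if t then - b k else if k = replicate (length ws) True then r else 0)" for l
  have cnt: "count_list (replicate (length ws) True) True = length ws"
    by (induction ws) auto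
  have "precochain (w # ws) (length (w # ws)) b'"
    using b(1) cnt unfolding precochain_def b'_def by (auto split: list.split_asm if_split_asm)
  moreover have "kd n (w # ws) b' (replicate (length (w # ws)) True)
      = r * w ^ n + kd n ws b (replicate (length ws) True)"
    by (simp add: b'_def kd_uminus mult.commute)
  ultimately show ?case using b(2) v(2) by (intro exI[of _ b']) (simp add: algebra_simps)
qed

section \<open>Cocycles and coboundaries in the limit over the stages\<close>

definition seq_scale :: "'a::comm_ring_1 \<Rightarrow> (nat \<Rightarrow> bool list \<Rightarrow> 'a) \<Rightarrow> nat \<Rightarrow> bool list \<Rightarrow> 'a" where
  "seq_scale r c = (\<lambda>n l. r * c n l)"

interpretation seq: ring_module seq_scale
  by unfold_locales (auto simp: seq_scale_def fun_eq_iff algebra_simps)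

text \<open>An element of the limit of the Koszul cohomology groups of \<open>R/I\<close> is represented by a
  sequence of cochains that is eventually compatible with the transition maps.\<close>

definition cocycles :: "'a::comm_ring_1 list \<Rightarrow> nat \<Rightarrow> 'a set \<Rightarrow> (nat \<Rightarrow> bool list \<Rightarrow> 'a) set" where
  "cocycles ws i I = {c. (\<forall>n. cochain ws i (c n)) \<and> (\<exists>k. \<forall>n\<ge>k.
     (\<forall>l. c (Suc n) l - kweight ws l * c n l \<in> I) \<and> (\<forall>l. kd n ws (c n) l \<in> I))}"

definition coboundary_at :: "'a::comm_ring_1 list \<Rightarrow> nat \<Rightarrow> 'a set \<Rightarrow> nat \<Rightarrow> (bool list \<Rightarrow> 'a) \<Rightarrow> bool" where
  "coboundary_at ws i I n c \<longleftrightarrow> (\<exists>b. precochain ws i b \<and> (\<forall>l. c l - kd n ws b l \<in> I))"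

definition coboundaries :: "'a::comm_ring_1 list \<Rightarrow> nat \<Rightarrow> 'a set \<Rightarrow> (nat \<Rightarrow> bool list \<Rightarrow> 'a) set" where
  "coboundaries ws i I = {c \<in> cocycles ws i I. \<exists>k. \<forall>n\<ge>k. coboundary_at ws i I n (c n)}"

text \<open>Pushes one cochain from stage \<open>n\<close> along the transition maps. Zeros are a
  safe default before \<open>n\<close>, since cocycle and compatibility conditions concern late
  stages only.\<close>

definition germ :: "'a::comm_ring_1 list \<Rightarrow> nat \<Rightarrow> (bool list \<Rightarrow> 'a) \<Rightarrow> nat \<Rightarrow> bool list \<Rightarrow> 'a" where
  "germ ws n a = (\<lambda>k l. if k < n then 0 else kweight ws l ^ (k - n) * a l)"

text \<open>Expresses that the \<open>i\<close>-th local cohomology of R/I with support in the ideal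
  generated by \<open>ws\<close> is zero.\<close>

definition vanishes :: "'a::comm_ring_1 list \<Rightarrow> nat \<Rightarrow> 'a set \<Rightarrow> bool" where
  "vanishes ws i I \<longleftrightarrow> cocycles ws i I \<subseteq> coboundaries ws i I"

lemma coboundaries_subset: "coboundaries ws i I \<subseteq> cocycles ws i I"
  by (auto simp: coboundaries_def)

lemma cocyclesE:
  assumes "c \<in> cocycles ws i I"
  obtains k where "\<And>n. cochain ws i (c n)"
    "\<And>n l. n \<ge> k \<Longrightarrow> c (Suc n) l - kweight ws l * c n l \<in> I"
    "\<And>n l. n \<ge> k \<Longrightarrow> kd n ws (c n) l \<in> I"
  using assms unfolding cocycles_def by blast

lemma cocyclesI:
  assumes "\<And>n. cochain ws i (c n)"
    "\<And>n l. n \<ge> k \<Longrightarrow> c (Suc n) l - kweight ws l * c n l \<in> I"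
    "\<And>n l. n \<ge> k \<Longrightarrow> kd n ws (c n) l \<in> I"
  shows "c \<in> cocycles ws i I"
  using assms unfolding cocycles_def by blast

lemma cocycle_shift:
  assumes I: "cideal I" and c: "\<And>n l. n \<ge> k \<Longrightarrow> c (Suc n) l - kweight ws l * c n l \<in> I"
    and n: "n \<ge> k"
  shows "c (n + t) l - kweight ws l ^ t * c n l \<in> I"
proof (induction t)
  case 0
  then show ?case using cideal_zero[OF I] by simp
next
  case (Suc t)
  have "c (n + Suc t) l - kweight ws l ^ Suc t * c n l
    = (c (Suc (n + t)) l - kweight ws l * c (n + t) l)
      + kweight ws l * (c (n + t) l - kweight ws l ^ t * c n l)"
    by (simp add: algebra_simps)
  moreover have "c (Suc (n + t)) l - kweight ws l * c (n + t) l \<in> I" using c n by simp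
  ultimately show ?case using cideal_add[OF I _ cideal_mult[OF I Suc]] by (simp only:)
qed

lemma cochain_scale: "cochain ws i c \<Longrightarrow> cochain ws i (\<lambda>l. r l * c l)"
  unfolding cochain_def by (metis mult_zero_right)

lemma cochain_add: "cochain ws i c \<Longrightarrow> cochain ws i d \<Longrightarrow> cochain ws i (\<lambda>l. c l + d l)"
  unfolding cochain_def by (metis add_0)

lemma cochain_diff: "cochain ws i c \<Longrightarrow> cochain ws i d \<Longrightarrow> cochain ws i (\<lambda>l. c l - d l)"
  unfolding cochain_def by (metis diff_0_right)

lemma precochain_scale: "precochain ws i c \<Longrightarrow> precochain ws i (\<lambda>l. r l * c l)"
  unfolding precochain_def by (metis mult_zero_right)

lemma precochain_add: "precochain ws i c \<Longrightarrow> precochain ws i d \<Longrightarrow> precochain ws i (\<lambda>l. c l + d l)"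
  unfolding precochain_def by (metis add_0)

lemma germ_cocycle:
  assumes I: "cideal I" and a: "cochain ws i a" "\<And>l. kd n ws a l \<in> I"
  shows "germ ws n a \<in> cocycles ws i I"
proof (rule cocyclesI)
  show "cochain ws i (germ ws n a k)" for k
    using a(1) unfolding germ_def cochain_def by (metis mult_zero_right)
  fix k l assume k: "n \<le> k"
  have "k - n + 1 = Suc k - n" using k by simp
  then have "germ ws n a (Suc k) l = kweight ws l * germ ws n a k l"
    using k unfolding germ_def by (simp add: Suc_diff_le mult.assoc)
  then show "germ ws n a (Suc k) l - kweight ws l * germ ws n a k l \<in> I"
    using cideal_zero[OF I] by simp
  have "germ ws n a k = (\<lambda>l. kweight ws l ^ (k - n) * a l)" using k by (simp add: germ_def)
  then have "kd k ws (germ ws n a k) l = kweight ws l ^ (k - n) * kd n ws a l"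
    using kd_kweight[of n "k - n" ws a l] k by simp
  then show "kd k ws (germ ws n a k) l \<in> I" using cideal_mult[OF I a(2)] by simp
qed

lemma germ_later: "germ ws n a (n + t) l = kweight ws l ^ t * a l"
  by (simp add: germ_def)

lemma coboundary_at_later:
  assumes I: "cideal I" and c: "\<And>n l. n \<ge> k \<Longrightarrow> c (Suc n) l - kweight ws l * c n l \<in> I"
    and n: "n \<ge> k" and b: "coboundary_at ws i I n (c n)"
  shows "coboundary_at ws i I (n + t) (c (n + t))"
proof -
  obtain b where b: "precochain ws i b" "\<And>l. c n l - kd n ws b l \<in> I"
    using b unfolding coboundary_at_def by blast
  have "c (n + t) l - kd (n + t) ws (\<lambda>l. kweight ws l ^ t * b l) l \<in> I" for l
  proof -
    have "c (n + t) l - kd (n + t) ws (\<lambda>l. kweight ws l ^ t * b l) l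
      = (c (n + t) l - kweight ws l ^ t * c n l) + kweight ws l ^ t * (c n l - kd n ws b l)"
      unfolding kd_kweight by (simp add: algebra_simps)
    then show ?thesis
      by (rule ssubst[where P = "\<lambda>v. v \<in> I"]) (rule cideal_add[OF I cocycle_shift[where c = c and n = n, OF I c n] cideal_mult[OF I b(2)]])
  qed
  then show ?thesis using precochain_scale[OF b(1), of "\<lambda>l. kweight ws l ^ t"] unfolding coboundary_at_def by blast
qed

text \<open>The transition maps carry coboundaries to coboundaries, so single stages, if they can be
  found arbitrarily late, are enough.\<close>

lemma coboundariesI:
  assumes I: "cideal I" and c: "c \<in> cocycles ws i I"
    and b: "\<And>k. \<exists>n\<ge>k. coboundary_at ws i I n (c n)"
  shows "c \<in> coboundaries ws i I"
proof -
  obtain k where k: "\<And>n l. n \<ge> k \<Longrightarrow> c (Suc n) l - kweight ws l * c n l \<in> I"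
    using cocyclesE[OF c] by metis
  obtain n where n: "n \<ge> k" "coboundary_at ws i I n (c n)" using b by blast
  have "coboundary_at ws i I n' (c n')" if "n' \<ge> n" for n'
    using coboundary_at_later[OF I k n, of "n' - n"] that by simp
  then show ?thesis using c unfolding coboundaries_def by blast
qed

lemma coboundaryD:
  assumes "c \<in> coboundaries ws i I"
  shows "\<exists>n\<ge>k. \<exists>b. precochain ws i b \<and> (\<forall>l. c n l - kd n ws b l \<in> I)"
proof -
  obtain k' where "\<forall>n\<ge>k'. coboundary_at ws i I n (c n)" using assms unfolding coboundaries_def by blast
  then have "coboundary_at ws i I (max k k') (c (max k k'))" by simp
  then show ?thesis unfolding coboundary_at_def by (intro exI[of _ "max k k'"]) auto
qed

lemma subspace_cocycles:
  assumes I: "cideal I"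
  shows "seq.subspace (cocycles ws i I)"
  unfolding seq.subspace_def
proof (intro conjI ballI allI)
  show "0 \<in> cocycles ws i I"
    by (rule cocyclesI[where k = 0]) (auto simp: cochain_def cideal_zero[OF I] zero_fun_def)
  fix c assume "c \<in> cocycles ws i I"
  then obtain k where c: "\<And>n. cochain ws i (c n)"
    "\<And>n l. n \<ge> k \<Longrightarrow> c (Suc n) l - kweight ws l * c n l \<in> I"
    "\<And>n l. n \<ge> k \<Longrightarrow> kd n ws (c n) l \<in> I" using cocyclesE by metis
  { fix d assume "d \<in> cocycles ws i I"
    then obtain k' where d: "\<And>n. cochain ws i (d n)"
      "\<And>n l. n \<ge> k' \<Longrightarrow> d (Suc n) l - kweight ws l * d n l \<in> I"
      "\<And>n l. n \<ge> k' \<Longrightarrow> kd n ws (d n) l \<in> I" using cocyclesE by metis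
    show "c + d \<in> cocycles ws i I"
    proof (rule cocyclesI[where k = "max k k'"])
      show "cochain ws i ((c + d) n)" for n
        using cochain_add[OF c(1)[of n] d(1)[of n]] by (simp add: plus_fun_def)
      fix n l assume n: "max k k' \<le> n"
      have "(c + d) (Suc n) l - kweight ws l * (c + d) n l
        = (c (Suc n) l - kweight ws l * c n l) + (d (Suc n) l - kweight ws l * d n l)"
        by (simp add: algebra_simps)
      moreover have "c (Suc n) l - kweight ws l * c n l \<in> I" "d (Suc n) l - kweight ws l * d n l \<in> I"
        using n c(2) d(2) by auto
      ultimately show "(c + d) (Suc n) l - kweight ws l * (c + d) n l \<in> I"
        using cideal_add[OF I] by (simp only:)
      show "kd n ws ((c + d) n) l \<in> I"
        using n cideal_add[OF I c(3) d(3)] kd_add[of n ws "c n" "d n" l] by (simp add: plus_fun_def)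
    qed }
  fix r
  show "seq_scale r c \<in> cocycles ws i I"
  proof (rule cocyclesI[where k = k])
    show "cochain ws i (seq_scale r c n)" for n
      using cochain_scale[OF c(1)[of n], of "\<lambda>_. r"] by (simp add: seq_scale_def)
    fix n l assume n: "k \<le> n"
    have "seq_scale r c (Suc n) l - kweight ws l * seq_scale r c n l
      = r * (c (Suc n) l - kweight ws l * c n l)"
      by (simp add: algebra_simps seq_scale_def)
    then show "seq_scale r c (Suc n) l - kweight ws l * seq_scale r c n l \<in> I"
      using cideal_mult[OF I c(2)[OF n]] by simp
    show "kd n ws (seq_scale r c n) l \<in> I"
      using cideal_mult[OF I c(3)[OF n]] by (simp add: seq_scale_def kd_scale)
  qed
qed

lemma coboundary_at_add:
  assumes I: "cideal I" and "coboundary_at ws i I n c" "coboundary_at ws i I n d"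
  shows "coboundary_at ws i I n (\<lambda>l. c l + d l)"
proof -
  obtain a b where ab: "precochain ws i a" "precochain ws i b"
    "\<And>l. c l - kd n ws a l \<in> I" "\<And>l. d l - kd n ws b l \<in> I"
    using assms(2,3) unfolding coboundary_at_def by blast
  have "c l + d l - kd n ws (\<lambda>l. a l + b l) l = (c l - kd n ws a l) + (d l - kd n ws b l)" for l
    by (simp add: kd_add)
  then show ?thesis
    using precochain_add[OF ab(1,2)] cideal_add[OF I ab(3,4)] unfolding coboundary_at_def by metis
qed

lemma coboundary_at_scale:
  assumes I: "cideal I" and "coboundary_at ws i I n c"
  shows "coboundary_at ws i I n (\<lambda>l. r * c l)"
proof -
  obtain b where b: "precochain ws i b" "\<And>l. c l - kd n ws b l \<in> I"
    using assms(2) unfolding coboundary_at_def by blast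
  have "r * c l - kd n ws (\<lambda>l. r * b l) l = r * (c l - kd n ws b l)" for l
    by (simp add: kd_scale algebra_simps)
  then show ?thesis
    using precochain_scale[OF b(1), of "\<lambda>_. r"] cideal_mult[OF I b(2)]
    unfolding coboundary_at_def by metis
qed

lemma coboundary_at_ideal: "(\<And>l. c l \<in> I) \<Longrightarrow> coboundary_at ws i I n c"
  unfolding coboundary_at_def by (intro exI[of _ "\<lambda>l. 0"]) (auto simp: precochain_def)

lemma subspace_coboundaries:
  assumes I: "cideal I"
  shows "seq.subspace (coboundaries ws i I)"
  unfolding seq.subspace_def
proof (intro conjI ballI allI)
  note Z = subspace_cocycles[OF I, of ws i]
  show "0 \<in> coboundaries ws i I"
    using seq.subspace_0[OF Z] cideal_zero[OF I]
    by (auto simp: coboundaries_def intro!: coboundary_at_ideal)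
  fix c assume "c \<in> coboundaries ws i I"
  then obtain k where c: "c \<in> cocycles ws i I" "\<And>n. n \<ge> k \<Longrightarrow> coboundary_at ws i I n (c n)"
    unfolding coboundaries_def by blast
  { fix d assume "d \<in> coboundaries ws i I"
    then obtain k' where d: "d \<in> cocycles ws i I" "\<And>n. n \<ge> k' \<Longrightarrow> coboundary_at ws i I n (d n)"
      unfolding coboundaries_def by blast
    have "coboundary_at ws i I n ((c + d) n)" if "n \<ge> max k k'" for n
      using coboundary_at_add[OF I c(2) d(2), of n] that by (simp add: plus_fun_def)
    then show "c + d \<in> coboundaries ws i I"
      using seq.subspace_add[OF Z c(1) d(1)] unfolding coboundaries_def by blast }
  fix r
  have "coboundary_at ws i I n (seq_scale r c n)" if "n \<ge> k" for n
    using coboundary_at_scale[OF I c(2)[OF that]] by (simp add: seq_scale_def)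
  then show "seq_scale r c \<in> coboundaries ws i I"
    using seq.subspace_scale[OF Z c(1)] unfolding coboundaries_def by blast
qed

lemma cocycles_mono:
  assumes "I \<subseteq> J"
  shows "cocycles ws i I \<subseteq> cocycles ws i J"
proof
  fix c assume "c \<in> cocycles ws i I"
  then obtain k where k: "\<And>n. cochain ws i (c n)"
    "\<And>n l. n \<ge> k \<Longrightarrow> c (Suc n) l - kweight ws l * c n l \<in> I"
    "\<And>n l. n \<ge> k \<Longrightarrow> kd n ws (c n) l \<in> I" using cocyclesE by metis
  then show "c \<in> cocycles ws i J"
    using assms by (intro cocyclesI[where k = k]) auto
qed

lemma coboundaries_mono: "I \<subseteq> J \<Longrightarrow> coboundaries ws i I \<subseteq> coboundaries ws i J"
proof
  fix c assume IJ: "I \<subseteq> J" and "c \<in> coboundaries ws i I"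
  then obtain k where "c \<in> cocycles ws i I" "\<And>n. n \<ge> k \<Longrightarrow> coboundary_at ws i I n (c n)"
    unfolding coboundaries_def by blast
  moreover from this(2) have "coboundary_at ws i J n (c n)" if "n \<ge> k" for n
    using that IJ unfolding coboundary_at_def by (meson subsetD)
  ultimately show "c \<in> coboundaries ws i J"
    using cocycles_mono[OF IJ, of ws i] unfolding coboundaries_def by blast
qed

lemma coboundaries_cong:
  assumes I: "cideal I" and c: "c \<in> cocycles ws i I" and e: "\<And>n l. n \<ge> k \<Longrightarrow> c n l \<in> I"
  shows "c \<in> coboundaries ws i I"
  using c coboundary_at_ideal[of "c _" I] e unfolding coboundaries_def by blast

lemma scale_cocycles:
  assumes "c \<in> cocycles ws i (colon I x)"
  shows "seq_scale x c \<in> cocycles ws i I"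
proof -
  obtain k where c: "\<And>n. cochain ws i (c n)"
    "\<And>n l. n \<ge> k \<Longrightarrow> c (Suc n) l - kweight ws l * c n l \<in> colon I x"
    "\<And>n l. n \<ge> k \<Longrightarrow> kd n ws (c n) l \<in> colon I x" using cocyclesE[OF assms] by metis
  show ?thesis
    by (rule cocyclesI[where k = k])
      (use c cochain_scale[OF c(1), of "\<lambda>_. x"] in
        \<open>auto simp: seq_scale_def colon_def kd_scale algebra_simps\<close>)
qed

lemma scale_coboundaries:
  assumes "c \<in> coboundaries ws i (colon I x)"
  shows "seq_scale x c \<in> coboundaries ws i I"
proof -
  obtain k where k: "\<And>n. n \<ge> k \<Longrightarrow> coboundary_at ws i (colon I x) n (c n)"
    using assms unfolding coboundaries_def by blast
  have "coboundary_at ws i I n (seq_scale x c n)" if n: "n \<ge> k" for n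
  proof -
    obtain b where b: "precochain ws i b" "\<And>l. c n l - kd n ws b l \<in> colon I x"
      using k[OF n] unfolding coboundary_at_def by blast
    have "seq_scale x c n l - kd n ws (\<lambda>l. x * b l) l \<in> I" for l
      using b(2)[of l] by (simp add: colon_def seq_scale_def kd_scale algebra_simps)
    then show ?thesis using precochain_scale[OF b(1), of "\<lambda>_. x"] unfolding coboundary_at_def by blast
  qed
  then show ?thesis
    using scale_cocycles assms unfolding coboundaries_def by blast
qed

section \<open>The long exact sequence and its connecting map\<close>

lemma adj_cochain:
  assumes I: "cideal I" and c: "cochain ws i c" "\<And>l. c l \<in> adj I x"
  shows "\<exists>a. cochain ws i a \<and> (\<forall>l. c l - x * a l \<in> I)"
proof -
  \<comment> \<open>A zero entry is divided to zero, so that the quotient keeps the degree of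
    \<open>c\<close>.\<close>
  have "\<forall>l. \<exists>r. (c l = 0 \<longrightarrow> r = 0) \<and> c l - x * r \<in> I"
  proof
    fix l
    obtain j r where j: "j \<in> I" "c l = j + r * x" using c(2)[of l] unfolding adj_def by blast
    then have "c l - x * r \<in> I" by (simp add: mult.commute)
    then show "\<exists>r. (c l = 0 \<longrightarrow> r = 0) \<and> c l - x * r \<in> I"
      by (cases "c l = 0") (use cideal_zero[OF I] in auto)
  qed
  then obtain a where a: "\<And>l. c l = 0 \<Longrightarrow> a l = 0" "\<And>l. c l - x * a l \<in> I" by metis
  have "cochain ws i a" using c(1) a(1) unfolding cochain_def by metis
  then show ?thesis using a(2) by blast
qed

text \<open>Exactness here and below refers to the long cohomology sequence of
  \<open>0 \<rightarrow> R/(I:x) \<rightarrow> R/I \<rightarrow> R/(I + xR) \<rightarrow> 0\<close>, whose first map is multiplication by \<open>x\<close>.\<close>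

lemma exact_middle:
  assumes I: "cideal I" and c: "c \<in> cocycles ws i I" "c \<in> coboundaries ws i (adj I x)"
  shows "\<exists>c'\<in>cocycles ws i (colon I x). c - seq_scale x c' \<in> coboundaries ws i I"
proof -
  obtain k where k: "\<And>n. cochain ws i (c n)"
    "\<And>n l. n \<ge> k \<Longrightarrow> c (Suc n) l - kweight ws l * c n l \<in> I"
    "\<And>n l. n \<ge> k \<Longrightarrow> kd n ws (c n) l \<in> I" using cocyclesE[OF c(1)] by metis
  obtain n b where n: "n \<ge> k" and b: "precochain ws i b" "\<And>l. c n l - kd n ws b l \<in> adj I x"
    using coboundaryD[OF c(2), of k] by blast
  have "cochain ws i (\<lambda>l. c n l - kd n ws b l)"
    by (rule cochain_diff[OF k(1) cochain_kd[OF b(1)]])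
  from adj_cochain[OF I this b(2)] obtain a
    where a: "cochain ws i a" "\<And>l. c n l - kd n ws b l - x * a l \<in> I" by blast
  have "kd n ws a l \<in> colon I x" for l
  proof -
    have "kd n ws (\<lambda>l. c n l - kd n ws b l - x * a l) l \<in> I" by (rule kd_ideal[OF I a(2)])
    then have "kd n ws (c n) l - x * kd n ws a l \<in> I" by (simp add: kd_diff kd_scale)
    then show ?thesis
      using cideal_diff[OF I k(3)[OF n, of l], of "kd n ws (c n) l - x * kd n ws a l"]
      by (simp add: colon_def)
  qed
  then have g: "germ ws n a \<in> cocycles ws i (colon I x)"
    by (intro germ_cocycle colon_ideal[OF I] a(1))
  have Z: "c - seq_scale x (germ ws n a) \<in> cocycles ws i I"
    by (rule seq.subspace_diff[OF subspace_cocycles[OF I] c(1) scale_cocycles[OF g]])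
  have "coboundary_at ws i I (n + t) ((c - seq_scale x (germ ws n a)) (n + t))" for t
  proof -
    have "(c - seq_scale x (germ ws n a)) (n + t) l - kd (n + t) ws (\<lambda>l. kweight ws l ^ t * b l) l \<in> I" for l
    proof -
      have "(c - seq_scale x (germ ws n a)) (n + t) l - kd (n + t) ws (\<lambda>l. kweight ws l ^ t * b l) l
        = (c (n + t) l - kweight ws l ^ t * c n l) + kweight ws l ^ t * (c n l - kd n ws b l - x * a l)"
        unfolding kd_kweight by (simp add: seq_scale_def germ_later algebra_simps)
      then show ?thesis
        by (rule ssubst[where P = "\<lambda>v. v \<in> I"]) (rule cideal_add[OF I cocycle_shift[where c = c and n = n, OF I k(2) n] cideal_mult[OF I a(2)]])
    qed
    then show ?thesis using precochain_scale[OF b(1), of "\<lambda>l. kweight ws l ^ t"] unfolding coboundary_at_def by blast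
  qed
  then have "c - seq_scale x (germ ws n a) \<in> coboundaries ws i I"
    by (intro coboundariesI[OF I Z]) (metis le_add1 le_add2)
  then show ?thesis using g by blast
qed

text \<open>The obstruction to lifting \<open>c\<close> is the class of \<open>a\<close>, where
  modulo \<open>I\<close> the coboundary of \<open>c\<close> at stage \<open>n\<close> is
  \<open>x\<close> times \<open>a\<close>. Its vanishing provides \<open>f\<close> at a later stage
  \<open>N\<close>, and the transported \<open>c\<close> minus \<open>x * f\<close> is a cocycle
  modulo \<open>I\<close>.\<close>

lemma exact_right:
  assumes I: "cideal I" and v: "vanishes ws (Suc i) (colon I x)" and c: "c \<in> cocycles ws i (adj I x)"
  shows "\<exists>c'\<in>cocycles ws i I. c - c' \<in> coboundaries ws i (adj I x)"
proof -
  note J = adj_ideal[OF I, of x]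
  obtain n where k: "\<And>n. cochain ws i (c n)"
    "\<And>k l. k \<ge> n \<Longrightarrow> c (Suc k) l - kweight ws l * c k l \<in> adj I x"
    "\<And>k l. k \<ge> n \<Longrightarrow> kd k ws (c k) l \<in> adj I x" using cocyclesE[OF c] by metis
  have "cochain ws (Suc i) (kd n ws (c n))" by (rule cochain_kd) (simp add: precochain_Suc k(1))
  from adj_cochain[OF I this k(3)] obtain a
    where a: "cochain ws (Suc i) a" "\<And>l. kd n ws (c n) l - x * a l \<in> I" by blast
  have "kd n ws a l \<in> colon I x" for l
  proof -
    have "kd n ws (\<lambda>l. kd n ws (c n) l - x * a l) l \<in> I" by (rule kd_ideal[OF I a(2)])
    then show ?thesis
      using cideal_minus[OF I, of "- (x * kd n ws a l)"] by (simp add: kd_diff kd_scale colon_def)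
  qed
  then have "germ ws n a \<in> cocycles ws (Suc i) (colon I x)"
    by (intro germ_cocycle colon_ideal[OF I] a(1))
  then have "germ ws n a \<in> coboundaries ws (Suc i) (colon I x)" using v unfolding vanishes_def by blast
  from coboundaryD[OF this, of n] obtain N f where N: "N \<ge> n"
    and f: "precochain ws (Suc i) f" "\<And>l. germ ws n a N l - kd N ws f l \<in> colon I x" by blast
  define t where "t = N - n"
  have N': "N = n + t" using N unfolding t_def by simp
  define b where "b l = kweight ws l ^ t * c n l - x * f l" for l
  have fc: "cochain ws i f" using f(1) by (simp add: precochain_Suc)
  have bc: "cochain ws i b"
    unfolding b_def using cochain_diff[OF cochain_scale[OF k(1)] cochain_scale[OF fc, of "\<lambda>_. x"]] .
  have "kd N ws b l \<in> I" for l
  proof -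
    have "kd N ws b l = kweight ws l ^ t * kd n ws (c n) l - x * kd N ws f l"
      unfolding b_def N' by (simp add: kd_diff kd_scale kd_kweight)
    also have "\<dots> = kweight ws l ^ t * (kd n ws (c n) l - x * a l) + x * (germ ws n a N l - kd N ws f l)"
      unfolding N' germ_later by (simp add: algebra_simps)
    finally show ?thesis
      using cideal_add[OF I cideal_mult[OF I a(2)]] f(2)[of l] unfolding colon_def by simp
  qed
  then have g: "germ ws N b \<in> cocycles ws i I" by (rule germ_cocycle[OF I bc])
  have "c - germ ws N b \<in> cocycles ws i (adj I x)"
    using seq.subspace_diff[OF subspace_cocycles[OF J] c] cocycles_mono[OF subset_adj] g by blast
  then have "c - germ ws N b \<in> coboundaries ws i (adj I x)"
  proof (rule coboundaries_cong[OF J])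
    fix k' l assume "k' \<ge> N"
    then obtain s where s: "k' = N + s" using le_Suc_ex by blast
    have "(c - germ ws N b) k' l
      = (c (n + (t + s)) l - kweight ws l ^ (t + s) * c n l) + (kweight ws l ^ s * f l) * x"
      unfolding s minus_apply germ_later b_def unfolding N' by (simp add: algebra_simps power_add)
    then show "(c - germ ws N b) k' l \<in> adj I x"
      using cideal_add[OF J cocycle_shift[where c = c and n = n, OF J k(2) order_refl] cideal_mult[OF J mem_adj[OF I]]] by simp
  qed
  then show ?thesis using g by blast
qed

text \<open>The connecting map is a relation between representatives. The coboundary of \<open>f\<close> has to be
  admitted because lifting the boundary part of a coboundary \<open>b\<close> is not compatible with the
  transition maps.\<close>

definition connecting :: "'a::comm_ring_1 list \<Rightarrow> nat \<Rightarrow> 'a set \<Rightarrow> 'a \<Rightarrow>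
    (nat \<Rightarrow> bool list \<Rightarrow> 'a) \<Rightarrow> (nat \<Rightarrow> bool list \<Rightarrow> 'a) \<Rightarrow> bool" where
  "connecting ws i I x b c \<longleftrightarrow> (\<exists>k. \<forall>n\<ge>k. \<exists>f. cochain ws i f \<and>
     (\<forall>l. kd n ws (b n) l - x * c n l - x * kd n ws f l \<in> I))"

lemma connecting_add:
  assumes I: "cideal I" and 1: "connecting ws i I x b c" and 2: "connecting ws i I x b' c'"
  shows "connecting ws i I x (b + b') (c + c')"
proof -
  obtain k k' where
    k: "\<And>n. n \<ge> k \<Longrightarrow> \<exists>f. cochain ws i f \<and> (\<forall>l. kd n ws (b n) l - x * c n l - x * kd n ws f l \<in> I)"
    "\<And>n. n \<ge> k' \<Longrightarrow> \<exists>f. cochain ws i f \<and> (\<forall>l. kd n ws (b' n) l - x * c' n l - x * kd n ws f l \<in> I)"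
    using 1 2 unfolding connecting_def by blast
  show ?thesis
    unfolding connecting_def
  proof (intro exI[of _ "max k k'"] allI impI)
    fix n assume "max k k' \<le> n"
    then obtain f g where f: "cochain ws i f" "\<And>l. kd n ws (b n) l - x * c n l - x * kd n ws f l \<in> I"
      and g: "cochain ws i g" "\<And>l. kd n ws (b' n) l - x * c' n l - x * kd n ws g l \<in> I"
      using k[of n] by auto
    have "kd n ws ((b + b') n) l - x * (c + c') n l - x * kd n ws (\<lambda>l. f l + g l) l
      = (kd n ws (b n) l - x * c n l - x * kd n ws f l) + (kd n ws (b' n) l - x * c' n l - x * kd n ws g l)" for l
      by (simp add: kd_add kd_plus algebra_simps)
    then have "kd n ws ((b + b') n) l - x * (c + c') n l - x * kd n ws (\<lambda>l. f l + g l) l \<in> I" for l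
      using cideal_add[OF I f(2) g(2)] by simp
    then show "\<exists>f. cochain ws i f \<and> (\<forall>l. kd n ws ((b + b') n) l - x * (c + c') n l - x * kd n ws f l \<in> I)"
      using cochain_add[OF f(1) g(1)] by blast
  qed
qed

lemma connecting_scale:
  assumes I: "cideal I" and 1: "connecting ws i I x b c"
  shows "connecting ws i I x (seq_scale r b) (seq_scale r c)"
proof -
  obtain k where
    k: "\<And>n. n \<ge> k \<Longrightarrow> \<exists>f. cochain ws i f \<and> (\<forall>l. kd n ws (b n) l - x * c n l - x * kd n ws f l \<in> I)"
    using 1 unfolding connecting_def by blast
  show ?thesis
    unfolding connecting_def
  proof (intro exI[of _ k] allI impI)
    fix n assume "k \<le> n"
    then obtain f where f: "cochain ws i f" "\<And>l. kd n ws (b n) l - x * c n l - x * kd n ws f l \<in> I"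
      using k[of n] by auto
    have "kd n ws (seq_scale r b n) l - x * seq_scale r c n l - x * kd n ws (\<lambda>l. r * f l) l
      = r * (kd n ws (b n) l - x * c n l - x * kd n ws f l)" for l
      by (simp add: kd_scale seq_scale_def algebra_simps)
    then have "kd n ws (seq_scale r b n) l - x * seq_scale r c n l - x * kd n ws (\<lambda>l. r * f l) l \<in> I" for l
      using cideal_mult[OF I f(2)] by simp
    then show "\<exists>f. cochain ws i f \<and>
        (\<forall>l. kd n ws (seq_scale r b n) l - x * seq_scale r c n l - x * kd n ws f l \<in> I)"
      using cochain_scale[OF f(1), of "\<lambda>_. r"] by blast
  qed
qed

lemma connecting_zero: "cideal I \<Longrightarrow> connecting ws i I x 0 0"
  unfolding connecting_def
  by (intro exI[of _ 0] allI impI exI[of _ "\<lambda>l. 0"]) (auto simp: cochain_def cideal_zero zero_fun_def)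

text \<open>If \<open>x * c\<close> is the coboundary of \<open>b\<close> at one stage, then
  \<open>b\<close> is a cocycle modulo \<open>I + xR\<close>, and its germ is related to
  \<open>c\<close> with correction \<open>f = 0\<close>. So the x-torsion lies in the image of the
  connecting map.\<close>

lemma connecting_onto:
  assumes I: "cideal I" and c: "c \<in> cocycles ws (Suc i) I" and xc: "seq_scale x c \<in> coboundaries ws (Suc i) I"
  shows "\<exists>b\<in>cocycles ws i (adj I x). connecting ws i I x b c"
proof -
  note J = adj_ideal[OF I, of x]
  obtain k where k: "\<And>n l. n \<ge> k \<Longrightarrow> c (Suc n) l - kweight ws l * c n l \<in> I"
    using cocyclesE[OF c] by metis
  obtain n b where n: "n \<ge> k" and b: "precochain ws (Suc i) b" "\<And>l. seq_scale x c n l - kd n ws b l \<in> I"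
    using coboundaryD[OF xc, of k] by blast
  have bc: "cochain ws i b" using b(1) by (simp add: precochain_Suc)
  have "kd n ws b l \<in> adj I x" for l
  proof -
    have "c n l * x \<in> adj I x" by (rule cideal_mult[OF J mem_adj[OF I]])
    then show ?thesis
      using cideal_diff[OF J, of "c n l * x" "c n l * x - kd n ws b l"] b(2)[of l] subset_adj[of I x]
      by (auto simp: seq_scale_def mult.commute)
  qed
  then have g: "germ ws n b \<in> cocycles ws i (adj I x)" by (rule germ_cocycle[OF J bc])
  have "connecting ws i I x (germ ws n b) c"
    unfolding connecting_def
  proof (intro exI[of _ n] allI impI)
    fix k' assume "n \<le> k'"
    then obtain t where t: "k' = n + t" using le_Suc_ex by blast
    have gt: "germ ws n b (n + t) = (\<lambda>l. kweight ws l ^ t * b l)" by (simp add: fun_eq_iff germ_later)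
    have "kd k' ws (germ ws n b k') l - x * c k' l - x * kd k' ws (\<lambda>l. 0) l \<in> I" for l
    proof -
      have "kd k' ws (germ ws n b k') l - x * c k' l - x * kd k' ws (\<lambda>l. 0) l
        = - (kweight ws l ^ t * (seq_scale x c n l - kd n ws b l) + x * (c (n + t) l - kweight ws l ^ t * c n l))"
        unfolding t gt kd_kweight by (simp add: seq_scale_def algebra_simps)
      then show ?thesis
        using cideal_minus[OF I cideal_add[OF I cideal_mult[OF I b(2)] cideal_mult[OF I cocycle_shift[where c = c and n = n, OF I k n]]]]
        by metis
    qed
    moreover have "cochain ws i (\<lambda>l. 0)" by (simp add: cochain_def)
    ultimately show "\<exists>f. cochain ws i f \<and> (\<forall>l. kd k' ws (germ ws n b k') l - x * c k' l - x * kd k' ws f l \<in> I)"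
      by blast
  qed
  then show ?thesis using g by blast
qed

text \<open>Modulo \<open>I\<close>, each \<open>b n\<close> is a coboundary plus
  \<open>x * f\<close>. The differential leaves \<open>x\<close> times the coboundary of
  \<open>f\<close>, which the relation absorbs.\<close>

lemma connecting_coboundary:
  assumes I: "cideal I" and b: "b \<in> coboundaries ws i (adj I x)"
  shows "connecting ws i I x b 0"
proof -
  obtain k where k: "\<And>n. n \<ge> k \<Longrightarrow> coboundary_at ws i (adj I x) n (b n)"
    using b unfolding coboundaries_def by blast
  have bc: "cochain ws i (b n)" for n using b unfolding coboundaries_def cocycles_def by blast
  show ?thesis
    unfolding connecting_def
  proof (intro exI[of _ k] allI impI)
    fix n assume "k \<le> n"
    then obtain e where e: "precochain ws i e" "\<And>l. b n l - kd n ws e l \<in> adj I x"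
      using k unfolding coboundary_at_def by blast
    from adj_cochain[OF I cochain_diff[OF bc cochain_kd[OF e(1)]] e(2)] obtain f
      where f: "cochain ws i f" "\<And>l. b n l - kd n ws e l - x * f l \<in> I" by blast
    have "kd n ws (\<lambda>l. b n l - kd n ws e l - x * f l) l \<in> I" for l by (rule kd_ideal[OF I f(2)])
    then have "kd n ws (b n) l - x * (0 :: nat \<Rightarrow> bool list \<Rightarrow> _) n l - x * kd n ws f l \<in> I" for l
      by (simp add: kd_diff kd_scale)
    then show "\<exists>f. cochain ws i f \<and>
        (\<forall>l. kd n ws (b n) l - x * (0 :: nat \<Rightarrow> bool list \<Rightarrow> _) n l - x * kd n ws f l \<in> I)"
      using f(1) by blast
  qed
qed

text \<open>A nonzerodivisor \<open>x\<close> modulo \<open>I\<close> can be cancelled, which leaves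
  \<open>c\<close> as the coboundary of \<open>- f\<close>; the relation is then single valued on
  classes.\<close>

lemma connecting_kernel:
  assumes I: "cideal I" "colon I x = I" and c: "c \<in> cocycles ws (Suc i) I"
    and con: "connecting ws i I x 0 c"
  shows "c \<in> coboundaries ws (Suc i) I"
proof (rule coboundariesI[OF I(1) c])
  fix k
  obtain k' where k': "\<And>n. n \<ge> k' \<Longrightarrow> \<exists>f. cochain ws i f \<and>
      (\<forall>l. kd n ws ((0 :: nat \<Rightarrow> bool list \<Rightarrow> _) n) l - x * c n l - x * kd n ws f l \<in> I)"
    using con unfolding connecting_def by blast
  obtain f where f: "cochain ws i f" "\<And>l. - (x * c (max k k') l) - x * kd (max k k') ws f l \<in> I"
    using k'[of "max k k'"] by (auto simp: zero_fun_def)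
  have "c (max k k') l - kd (max k k') ws (\<lambda>l. - f l) l \<in> I" for l
  proof -
    have "x * (c (max k k') l - kd (max k k') ws (\<lambda>l. - f l) l) \<in> I"
      using cideal_minus[OF I(1) f(2)[of l]] by (simp add: kd_uminus algebra_simps)
    then show ?thesis using I(2) unfolding colon_def by blast
  qed
  moreover have "precochain ws (Suc i) (\<lambda>l. - f l)"
    using f(1) by (auto simp: precochain_Suc cochain_def)
  ultimately show "\<exists>n\<ge>k. coboundary_at ws (Suc i) I n (c n)"
    unfolding coboundary_at_def by (intro exI[of _ "max k k'"]) auto
qed

text \<open>The Koszul homotopy at a stage \<open>n\<close> where \<open>c\<close> has become a
  cocycle exhibits \<open>w ^ n * c\<close> as a coboundary; later stages follow by
  transport.\<close>

lemma torsion_cocycles: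
  assumes I: "cideal I" and c: "c \<in> cocycles ws i I" and w: "w \<in> set ws"
  shows "\<exists>k. seq_scale (w ^ k) c \<in> coboundaries ws i I"
proof -
  obtain j where j: "j < length ws" "w = ws ! j" using w by (metis in_set_conv_nth)
  obtain n where k: "\<And>n. cochain ws i (c n)"
    "\<And>k l. k \<ge> n \<Longrightarrow> c (Suc k) l - kweight ws l * c k l \<in> I"
    "\<And>k l. k \<ge> n \<Longrightarrow> kd k ws (c k) l \<in> I" using cocyclesE[OF c] by metis
  have Z: "seq_scale (w ^ n) c \<in> cocycles ws i I"
    by (rule seq.subspace_scale[OF subspace_cocycles[OF I] c])
  have pre: "precochain ws i (khomotopy j (c n))" by (rule precochain_khomotopy[OF j(1) k(1)])
  have "w ^ n * c n l - kd n ws (khomotopy j (c n)) l \<in> I" for l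
  proof (cases "length l = length ws")
    case True
    have "w ^ n * c n l - kd n ws (khomotopy j (c n)) l = khomotopy j (kd n ws (c n)) l"
      using khomotopy[OF j(1) True, of n "c n"] unfolding j(2) by (metis add_diff_cancel_left')
    then show ?thesis using khomotopy_ideal[OF I k(3)[OF order_refl]] by simp
  next
    case False
    then have "c n l = 0" "kd n ws (khomotopy j (c n)) l = 0"
      using k(1)[of n] cochain_kd[OF pre, of n] unfolding cochain_def by blast+
    then show ?thesis using cideal_zero[OF I] by simp
  qed
  then have b: "coboundary_at ws i I n (seq_scale (w ^ n) c n)"
    using pre unfolding coboundary_at_def seq_scale_def by blast
  have shift: "seq_scale (w ^ n) c (Suc m) l - kweight ws l * seq_scale (w ^ n) c m l \<in> I" if "m \<ge> n" for m l
    using cideal_mult[OF I k(2)[OF that, of l], of "w ^ n"] by (simp add: seq_scale_def algebra_simps)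
  have "coboundary_at ws i I (n + t) (seq_scale (w ^ n) c (n + t))" for t
    by (rule coboundary_at_later[OF I shift order_refl b])
  then have "seq_scale (w ^ n) c \<in> coboundaries ws i I"
    by (intro coboundariesI[OF I Z]) (metis le_add1 le_add2)
  then show ?thesis by blast
qed

section \<open>Vanishing and nonvanishing of local cohomology\<close>

text \<open>In H^i(R/I) -> H^i(R/(I + xR)) -> H^(i+1)(R/(I : x)) both ends are zero.\<close>

lemma vanishes_adj:
  assumes I: "cideal I" and v: "vanishes ws i I" "vanishes ws (Suc i) (colon I x)"
  shows "vanishes ws i (adj I x)"
  unfolding vanishes_def
proof
  fix c assume "c \<in> cocycles ws i (adj I x)"
  then obtain c' where c': "c' \<in> cocycles ws i I" "c - c' \<in> coboundaries ws i (adj I x)"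
    using exact_right[OF I v(2)] by blast
  then have "c' \<in> coboundaries ws i (adj I x)"
    using v(1) coboundaries_mono[OF subset_adj] unfolding vanishes_def by blast
  from seq.subspace_add[OF subspace_coboundaries[OF adj_ideal[OF I]] c'(2) this]
  show "c \<in> coboundaries ws i (adj I x)" by simp
qed

text \<open>In H^i(R/(I : x)) -> H^i(R/I) -> H^i(R/(I + xR)) both ends are zero.\<close>

lemma vanishes_middle:
  assumes I: "cideal I" and v: "vanishes ws i (colon I x)" "vanishes ws i (adj I x)"
  shows "vanishes ws i I"
  unfolding vanishes_def
proof
  fix c assume c: "c \<in> cocycles ws i I"
  then have "c \<in> coboundaries ws i (adj I x)"
    using v(2) cocycles_mono[OF subset_adj] unfolding vanishes_def by blast
  from exact_middle[OF I c this] obtain c'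
    where c': "c' \<in> cocycles ws i (colon I x)" "c - seq_scale x c' \<in> coboundaries ws i I" by blast
  have "seq_scale x c' \<in> coboundaries ws i I"
    using c'(1) v(1) scale_coboundaries unfolding vanishes_def by blast
  from seq.subspace_add[OF subspace_coboundaries[OF I] c'(2) this]
  show "c \<in> coboundaries ws i I" by simp
qed

lemma vanishes_one:
  assumes I: "cideal I" "1 \<in> I"
  shows "vanishes ws i I"
  unfolding vanishes_def using coboundaries_cong[OF I(1)] cideal_one[OF I] by blast

lemma vanishes_degree:
  assumes I: "cideal I" and i: "i > length ws"
  shows "vanishes ws i I"
  unfolding vanishes_def
proof
  fix c assume c: "c \<in> cocycles ws i I"
  have "c n l = 0" for n l
  proof (rule ccontr)
    assume "c n l \<noteq> 0"
    then have "length l = length ws" "count_list l True = i"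
      using c unfolding cocycles_def cochain_def by blast+
    then show False using i count_le_length[of l True] by simp
  qed
  then show "c \<in> coboundaries ws i I"
    using coboundaries_cong[OF I c] cideal_zero[OF I] by simp
qed

lemma kweight_dvd:
  "length l = length ws \<Longrightarrow> count_list l True > 0 \<Longrightarrow> \<exists>w\<in>set ws. w dvd kweight ws l"
proof (induction ws arbitrary: l)
  case (Cons w ws)
  then obtain b l' where l: "l = b # l'" by (cases l) auto
  show ?case
  proof (cases b)
    case False
    then obtain v where "v \<in> set ws" "v dvd kweight ws l'" using Cons l by auto
    then show ?thesis using l False by auto
  qed (auto simp: l)
qed simp

lemma finite_bound:
  assumes "finite A" and "\<And>x. x \<in> A \<Longrightarrow> \<exists>k :: nat. \<forall>n\<ge>k. Q x n"
  shows "\<exists>k. \<forall>x\<in>A. \<forall>n\<ge>k. Q x n"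
proof -
  have "\<forall>x\<in>A. \<exists>k :: nat. \<forall>n\<ge>k. Q x n" using assms(2) by blast
  then obtain f where f: "\<And>x n. x \<in> A \<Longrightarrow> n \<ge> f x \<Longrightarrow> Q x n" by metis
  have "f x \<le> Max (f ` A)" if "x \<in> A" for x using assms(1) that by simp
  then show ?thesis using f by (meson order_trans)
qed

lemma power_mem_mono: "cideal I \<Longrightarrow> w ^ k \<in> I \<Longrightarrow> k \<le> n \<Longrightarrow> w ^ n \<in> I"
  using cideal_mult[of I "w ^ k" "w ^ (n - k)"] by (simp add: power_add[symmetric])

text \<open>In positive degree every weight is divisible by some \<open>w\<close>, so its
  \<open>t\<close>-th power lies in \<open>I\<close> for large \<open>t\<close>: composed transition
  maps are eventually zero.\<close>

lemma vanishes_nilpotent: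
  assumes I: "cideal I" and i: "i > 0" and w: "\<And>w. w \<in> set ws \<Longrightarrow> \<exists>k. w ^ k \<in> I"
  shows "vanishes ws i I"
  unfolding vanishes_def
proof
  fix c assume c: "c \<in> cocycles ws i I"
  obtain n where k: "\<And>n. cochain ws i (c n)"
    "\<And>k l. k \<ge> n \<Longrightarrow> c (Suc k) l - kweight ws l * c k l \<in> I" using cocyclesE[OF c] by metis
  have "\<exists>K. \<forall>w\<in>set ws. \<forall>n\<ge>K. w ^ n \<in> I"
    by (rule finite_bound[OF finite_set]) (metis w power_mem_mono[OF I])
  then obtain K where K: "\<And>w n. w \<in> set ws \<Longrightarrow> n \<ge> K \<Longrightarrow> w ^ n \<in> I" by blast
  show "c \<in> coboundaries ws i I"
  proof (rule coboundaries_cong[OF I c])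
    fix j l assume "n + K \<le> j"
    then obtain t where t: "j = n + t" "t \<ge> K" by (metis add_leD1 le_Suc_ex nat_add_left_cancel_le)
    show "c j l \<in> I"
    proof (cases "c n l = 0")
      case True
      then show ?thesis
        using cocycle_shift[where c = c and n = n and t = t and l = l, OF I k(2) order_refl] t by simp
    next
      case False
      then have "length l = length ws" "count_list l True = i" using k(1) unfolding cochain_def by blast+
      then obtain w where w: "w \<in> set ws" "w dvd kweight ws l" using kweight_dvd i by metis
      then have "w ^ t dvd kweight ws l ^ t * c n l" using dvd_power_same by (metis dvd_mult2)
      then have "kweight ws l ^ t * c n l \<in> I"
        using K[OF w(1) t(2)] cideal_mult2[OF I] by (auto elim!: dvdE)
      then show ?thesis
        using cideal_eqD[OF I _ cocycle_shift[where c = c and n = n and t = t and l = l, OF I k(2) order_refl]]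
        unfolding t(1) by blast
    qed
  qed
qed

text \<open>The exponent has to be positive because \<open>w ^ 0 = 1\<close>. Socle elements
  therefore become cocycles only from stage 1 on.\<close>

lemma kd_annihilated:
  "cideal I \<Longrightarrow> (\<And>l w. w \<in> set ws \<Longrightarrow> w * c l \<in> I) \<Longrightarrow> kd (Suc n) ws c l \<in> I"
proof (induction ws arbitrary: c l)
  case (Cons w ws)
  have "w ^ Suc n * c l \<in> I" for l
    using cideal_mult[OF Cons.prems(1) Cons.prems(2)[of w l], of "w ^ n"]
    by (simp add: mult.assoc mult.left_commute)
  moreover have "kd (Suc n) ws (\<lambda>k. c (b # k)) l \<in> I" for b l
    by (rule Cons.IH[OF Cons.prems(1)]) (use Cons.prems(2) in simp)
  ultimately show ?case
    using Cons.prems(1) by (auto split: list.split intro!: cideal_diff simp: cideal_zero)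
qed (simp add: cideal_zero)

lemma kweight_False [simp]: "kweight ws (replicate (length ws) False) = 1"
  by (induction ws) auto

lemma cochain_0:
  assumes "cochain ws 0 c" "l \<noteq> replicate (length ws) False"
  shows "c l = 0"
proof (rule ccontr)
  assume "c l \<noteq> 0"
  then have l: "length l = length ws" "count_list l True = 0" using assms(1) unfolding cochain_def by auto
  then have "\<forall>b\<in>set l. b = False" by (metis (full_types) count_list_0_iff)
  then have "l = replicate (length l) False" by (metis replicate_length_same)
  then show False using l assms(2) by simp
qed

lemma coboundaries_0:
  assumes "c \<in> coboundaries ws 0 I"
  shows "\<exists>k. \<forall>n\<ge>k. \<forall>l. c n l \<in> I"
proof -
  obtain k where "\<And>n. n \<ge> k \<Longrightarrow> coboundary_at ws 0 I n (c n)"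
    using assms unfolding coboundaries_def by blast
  then have "\<forall>n\<ge>k. \<forall>l. c n l \<in> I" unfolding coboundary_at_def precochain_zero by auto
  then show ?thesis by blast
qed

lemma colon_power_regular:
  assumes "cideal I" "colon I x = I"
  shows "colon I (x ^ n) = I"
proof (induction n)
  case (Suc n)
  have "a \<in> colon I (x ^ Suc n) \<longleftrightarrow> x ^ n * a \<in> colon I x" for a
    by (simp add: colon_def mult.assoc)
  then show ?case using Suc assms(2) by (auto simp: colon_def)
qed (simp add: colon_def)

text \<open>For proper \<open>I\<close> this says that \<open>m\<close> is not an associated prime
  of R/I, that is, the depth is positive.\<close>

definition socle_free :: "'a::comm_ring_1 set \<Rightarrow> 'a set \<Rightarrow> bool" where
  "socle_free m I \<longleftrightarrow> (\<forall>a. (\<forall>u\<in>m. u * a \<in> I) \<longrightarrow> a \<in> I)"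

lemma socle_free_products:
  assumes "socle_free m I"
  shows "(\<And>u. u \<in> products m s \<Longrightarrow> u * c \<in> I) \<Longrightarrow> c \<in> I"
proof (induction s arbitrary: c)
  case (Suc s)
  have "v * c \<in> I" if v: "v \<in> products m s" for v
  proof -
    have "u * (v * c) \<in> I" if "u \<in> m" for u
      using Suc.prems[of "u * v"] v that by (auto simp: mult.assoc)
    then show ?thesis using assms unfolding socle_free_def by blast
  qed
  then show ?case by (rule Suc.IH)
qed simp

text \<open>Multiplication by an \<open>x\<close> avoiding \<open>F\<close> is injective on R/I up
  to elements killed by the \<open>s\<close>-th power of \<open>m\<close>. Keeping \<open>m\<close>
  out of \<open>F\<close> leaves room for such \<open>x\<close> inside \<open>m\<close>.\<close>

definition prime_bound :: "'a::comm_ring_1 set \<Rightarrow> 'a set \<Rightarrow> 'a set set \<Rightarrow> nat \<Rightarrow> bool" where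
  "prime_bound m I F s \<longleftrightarrow> finite F \<and> (\<forall>q\<in>F. prime_ideal q \<and> q \<noteq> m) \<and>
    (\<forall>x c u. (\<forall>q\<in>F. x \<notin> q) \<longrightarrow> x * c \<in> I \<longrightarrow> u \<in> products m s \<longrightarrow> u * c \<in> I)"

section \<open>Associated primes and Grothendieck's vanishing theorem\<close>

context noetherian
begin

text \<open>In an extension the sets of primes are united and the exponents added; a piece R/m
  contributes an exponent instead of a prime.\<close>

lemma zero_divisor_avoidance:
  fixes m :: "'a set"
  assumes "cideal I"
  shows "\<exists>F s. prime_bound m I F s"
  using assms
proof (induction I rule: noetherian_prime_induct)
  case (prime I)
  show ?case
  proof (cases "I = m")
    case True
    then have "prime_bound m I {} (Suc 0)"
      using cideal_mult2[OF prime_cideal[OF prime]] by (auto simp: prime_bound_def)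
    then show ?thesis by blast
  next
    case False
    then have "prime_bound m I {I} 0"
      using prime prime_mult[OF prime] by (auto simp: prime_bound_def)
    then show ?thesis by blast
  qed
next
  case (one I)
  then have "prime_bound m I {} 0" using cideal_one by (auto simp: prime_bound_def)
  then show ?case by blast
next
  case (step I a)
  obtain F1 s1 where "prime_bound m (colon I a) F1 s1" using step.IH(1) by blast
  then have 1: "finite F1" "\<forall>q\<in>F1. prime_ideal q \<and> q \<noteq> m"
    "(\<forall>q\<in>F1. x \<notin> q) \<Longrightarrow> x * c \<in> colon I a \<Longrightarrow> u \<in> products m s1 \<Longrightarrow> u * c \<in> colon I a" for x c u
    unfolding prime_bound_def by blast+
  obtain F2 s2 where "prime_bound m (adj I a) F2 s2" using step.IH(2) by blast
  then have 2: "finite F2" "\<forall>q\<in>F2. prime_ideal q \<and> q \<noteq> m"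
    "(\<forall>q\<in>F2. x \<notin> q) \<Longrightarrow> x * c \<in> adj I a \<Longrightarrow> u \<in> products m s2 \<Longrightarrow> u * c \<in> adj I a" for x c u
    unfolding prime_bound_def by blast+
  have "prime_bound m I (F1 \<union> F2) (s1 + s2)"
    unfolding prime_bound_def
  proof (intro conjI allI impI ballI)
    fix x c w assume x: "\<forall>q\<in>F1 \<union> F2. x \<notin> q" and xc: "x * c \<in> I" and w: "w \<in> products m (s1 + s2)"
    obtain u v where uv: "u \<in> products m s1" "v \<in> products m s2" "w = u * v"
      using products_add[OF w] by blast
    \<comment> \<open>A product from the second piece moves \<open>c\<close> into
      \<open>I + aR\<close>, with a coefficient \<open>r\<close> that \<open>x\<close> sends into
      \<open>colon I a\<close>; a product from the first piece then sends \<open>r\<close> there as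
      well.\<close>
    have "v * c \<in> adj I a" using 2(3)[of x c v] x xc uv(2) subset_adj by blast
    then obtain i r where i: "i \<in> I" "v * c = i + r * a" unfolding adj_def by blast
    have "a * (x * r) = v * (x * c) - x * i"
      using i(2) by (metis add_diff_cancel_left' mult.commute mult.left_commute right_diff_distrib)
    then have "x * r \<in> colon I a"
      using cideal_diff[OF step.hyps cideal_mult[OF step.hyps xc] cideal_mult[OF step.hyps i(1)]]
      unfolding colon_def by simp
    then have "u * r \<in> colon I a" using 1(3)[of x r u] x uv(1) by blast
    then have "a * (u * r) \<in> I" by (simp add: colon_def)
    moreover have "w * c = u * i + a * (u * r)"
      unfolding uv(3) mult.assoc i(2) by (simp add: algebra_simps)
    ultimately show "w * c \<in> I"
      using cideal_add[OF step.hyps cideal_mult[OF step.hyps i(1)]] by simp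
  qed (use 1 2 in auto)
  then show ?case by blast
qed

text \<open>A maximal annihilator is prime: if \<open>u * v\<close> kills \<open>a\<close> modulo
  \<open>I\<close> but neither factor does, then \<open>a * u\<close> has a strictly larger
  annihilator.\<close>

lemma associated_prime:
  assumes I: "cideal (I :: 'a set)"
  shows "a \<notin> I \<Longrightarrow> \<exists>b. prime_ideal (colon I (a * b))"
proof -
  have "\<forall>a. K = colon I a \<longrightarrow> a \<notin> I \<longrightarrow> (\<exists>b. prime_ideal (colon I (a * b)))" if "cideal K" for K
    using that
  proof (induction K rule: noetherian_induct)
    case (step K)
    show ?case
    proof (intro allI impI)
      fix a assume a: "K = colon I a" "a \<notin> I"
      show "\<exists>b. prime_ideal (colon I (a * b))"
      proof (cases "prime_ideal K")
        case True
        then show ?thesis using a by (intro exI[of _ 1]) simp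
      next
        case False
        have "1 \<notin> K" using a by (simp add: colon_def)
        then obtain u v where uv: "u * v \<in> K" "u \<notin> K" "v \<notin> K"
          using False step.hyps unfolding prime_ideal_def by blast
        have "v \<in> colon I (a * u)" using uv(1) a(1) by (simp add: colon_def mult.assoc)
        moreover have "K \<subseteq> colon I (a * u)"
        proof
          fix x assume "x \<in> K"
          then have "u * (a * x) \<in> I" using cideal_mult[OF I] unfolding a(1) colon_def by blast
          then show "x \<in> colon I (a * u)" by (simp add: colon_def ac_simps)
        qed
        ultimately have "K \<subset> colon I (a * u)" using uv(3) by blast
        moreover have "a * u \<notin> I" using uv(2) a(1) by (simp add: colon_def)
        ultimately obtain b where "prime_ideal (colon I (a * u * b))"
          using step.IH[OF colon_ideal[OF I]] by blast
        then show ?thesis by (metis mult.assoc)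
      qed
    qed
  qed
  then show "a \<notin> I \<Longrightarrow> \<exists>b. prime_ideal (colon I (a * b))" using colon_ideal[OF I] by blast
qed

lemma exists_prime_not_vanishing:
  assumes "cideal (I :: 'a set)" "\<not> vanishes ws i I"
  shows "\<exists>Q. prime_ideal Q \<and> I \<subseteq> Q \<and> \<not> vanishes ws i Q"
  using assms
proof (induction I rule: noetherian_prime_induct)
  case (one I)
  then show ?case using vanishes_one by blast
next
  case (step I a)
  then have "\<not> vanishes ws i (colon I a) \<or> \<not> vanishes ws i (adj I a)"
    using vanishes_middle by blast
  then show ?case
    using step.IH subset_colon[OF step.hyps, of a] subset_adj[of I a] by blast
qed blast

text \<open>Some \<open>x\<close> in \<open>ws\<close> is outside \<open>Q\<close>. If H^i vanished
  modulo \<open>Q + xR\<close>, the connecting map would make \<open>x\<close> injective on the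
  degree \<open>i + 1\<close> group of R/Q, which is x-power torsion and would be zero. So a prime
  strictly above \<open>Q\<close> has nonzero cohomology in degree \<open>i\<close>.\<close>

lemma not_vanishes_has_chain:
  "prime_ideal (Q :: 'a set) \<Longrightarrow> \<not> vanishes ws i Q \<Longrightarrow> has_chain i Q"
proof (induction i arbitrary: Q)
  case (Suc i)
  have Q: "cideal Q" using prime_cideal[OF Suc.prems(1)] .
  have "\<exists>w\<in>set ws. w \<notin> Q"
  proof (rule ccontr)
    assume "\<not> ?thesis"
    then have "vanishes ws (Suc i) Q" by (intro vanishes_nilpotent[OF Q]) (auto intro: exI[of _ 1])
    then show False using Suc.prems by blast
  qed
  then obtain x where x: "x \<in> set ws" "x \<notin> Q" by blast
  have colon: "colon Q x = Q"
    using prime_mult[OF Suc.prems(1)] x(2) cideal_mult[OF Q] unfolding colon_def by blast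
  have "\<not> vanishes ws i (adj Q x)"
  proof
    assume v: "vanishes ws i (adj Q x)"
    have step: "c \<in> coboundaries ws (Suc i) Q"
      if c: "c \<in> cocycles ws (Suc i) Q" and xc: "seq_scale x c \<in> coboundaries ws (Suc i) Q" for c
    proof -
      obtain b where b: "b \<in> cocycles ws i (adj Q x)" "connecting ws i Q x b c"
        using connecting_onto[OF Q c xc] by blast
      then have "connecting ws i Q x b 0"
        using connecting_coboundary[OF Q] v unfolding vanishes_def by blast
      from connecting_add[OF Q b(2) connecting_scale[OF Q this, of "-1"]]
      have "connecting ws i Q x 0 c" by (simp add: seq_scale_def fun_eq_iff plus_fun_def zero_fun_def)
      then show ?thesis by (rule connecting_kernel[OF Q colon c])
    qed
    have "c \<in> coboundaries ws (Suc i) Q"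
      if "c \<in> cocycles ws (Suc i) Q" "seq_scale (x ^ k) c \<in> coboundaries ws (Suc i) Q" for k c
      using that
    proof (induction k arbitrary: c)
      case (Suc k)
      have "seq_scale (x ^ k) (seq_scale x c) \<in> coboundaries ws (Suc i) Q"
        using Suc.prems(2) by (simp add: seq_scale_def algebra_simps)
      then have "seq_scale x c \<in> coboundaries ws (Suc i) Q"
        using Suc.IH seq.subspace_scale[OF subspace_cocycles[OF Q] Suc.prems(1)] by blast
      then show ?case using step Suc.prems(1) by blast
    qed (simp add: seq_scale_def)
    then have "vanishes ws (Suc i) Q"
      using torsion_cocycles[OF Q _ x(1)] unfolding vanishes_def by blast
    then show False using Suc.prems by blast
  qed
  then obtain Q1 where Q1: "prime_ideal Q1" "adj Q x \<subseteq> Q1" "\<not> vanishes ws i Q1"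
    using exists_prime_not_vanishing[OF adj_ideal[OF Q]] by blast
  then have "Q \<subset> Q1" using subset_adj[of Q x] mem_adj[OF Q, of x] x(2) by blast
  then show ?case using Suc.prems(1) Suc.IH[OF Q1(1,3)] by auto
qed simp

end

section \<open>Cohomology of elements that are m-primary modulo P\<close>

locale koszul_local = noetherian_local m for m :: "'a::comm_ring_1 set" +
  fixes ws :: "'a list" and P :: "'a set"
  assumes ws_m: "set ws \<subseteq> m" and P_prime: "prime_ideal P"
    and primary: "\<And>Q. prime_ideal Q \<Longrightarrow> P \<subseteq> Q \<Longrightarrow> set ws \<subseteq> Q \<Longrightarrow> Q = m"
begin

text \<open>Prime avoidance is applied to the primes that bound the zero divisors of R/I together
  with \<open>G\<close>; absence of a socle removes the m-power torsion that
  \<open>prime_bound\<close> leaves open.\<close>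

lemma regular_element:
  assumes I: "cideal I" "1 \<notin> I" "socle_free m I"
    and G: "finite G" "\<And>q. q \<in> G \<Longrightarrow> prime_ideal q \<and> q \<noteq> m"
  shows "\<exists>x\<in>m. (\<forall>q\<in>G. x \<notin> q) \<and> colon I x = I \<and> x \<notin> I"
proof -
  obtain F s where "prime_bound m I F s" using zero_divisor_avoidance[OF I(1), of m] by blast
  then have F: "finite F" "\<And>q. q \<in> F \<Longrightarrow> prime_ideal q \<and> q \<noteq> m"
    "(\<forall>q\<in>F. x \<notin> q) \<Longrightarrow> x * c \<in> I \<Longrightarrow> u \<in> products m s \<Longrightarrow> u * c \<in> I" for x c u
    unfolding prime_bound_def by blast+
  have "prime_ideal q \<and> \<not> m \<subseteq> q" if "q \<in> F \<union> G" for q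
    using that F(2) G(2) prime_subset_m[of q] by blast
  then obtain x where x: "x \<in> m" "\<forall>q\<in>F \<union> G. x \<notin> q"
    using prime_avoidance[of "F \<union> G" m] F(1) G(1) m_ideal by blast
  have "c \<in> I" if "x * c \<in> I" for c
    by (rule socle_free_products[OF I(3), of s]) (use F(3) x(2) that in blast)
  then have c: "colon I x = I" using cideal_mult[OF I(1)] unfolding colon_def by blast
  have "x \<notin> I"
  proof
    assume "x \<in> I"
    then have "1 \<in> colon I x" by (simp add: colon_def)
    then show False using c I(2) by blast
  qed
  then show ?thesis using x c by blast
qed

text \<open>R/(I : a) is a quotient of the residue field, on which the elements of \<open>ws\<close>
  act as zero.\<close>

lemma vanishes_socle: "cideal I \<Longrightarrow> (\<And>u. u \<in> m \<Longrightarrow> u * a \<in> I) \<Longrightarrow> i > 0 \<Longrightarrow> vanishes ws i (colon I a)"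
  using ws_m by (intro vanishes_nilpotent colon_ideal) (auto intro!: exI[of _ 1] simp: colon_def mult.commute)

text \<open>A socle element at the empty index is a cocycle from stage 1 on. In degree 0 nonzero
  coboundaries do not exist and the weight is 1, so vanishing of its class means that it lies in
  \<open>I\<close>.\<close>

lemma vanishes_0_socle_free:
  assumes I: "cideal I" and v: "vanishes ws 0 I"
  shows "socle_free m I"
  unfolding socle_free_def
proof (intro allI impI)
  fix a assume a: "\<forall>u\<in>m. u * a \<in> I"
  define c where "c l = (if l = replicate (length ws) False then a else 0)" for l
  have "cochain ws 0 c" unfolding cochain_def c_def by (auto simp: count_list_0_iff)
  moreover have "kd (Suc 0) ws c l \<in> I" for l
    by (rule kd_annihilated[OF I]) (use a ws_m cideal_zero[OF I] in \<open>auto simp: c_def\<close>)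
  ultimately have "germ ws (Suc 0) c \<in> cocycles ws 0 I" by (intro germ_cocycle[OF I])
  then have "germ ws (Suc 0) c \<in> coboundaries ws 0 I" using v unfolding vanishes_def by blast
  from coboundaries_0[OF this] obtain k where "\<And>n l. n \<ge> k \<Longrightarrow> germ ws (Suc 0) c n l \<in> I" by blast
  from this[of "Suc k" "replicate (length ws) False"]
  show "a \<in> I" by (simp add: germ_def c_def)
qed

text \<open>Degree 0 yields a nonzerodivisor \<open>x\<close> in \<open>m\<close>. Cohomology still
  vanishes modulo \<open>I + xR\<close>, which by induction is the unit ideal, and Nakayama's lemma
  removes \<open>x\<close>.\<close>

lemma vanishes_all:
  assumes "cideal I" "\<And>i. vanishes ws i I"
  shows "1 \<in> I"
  using assms
proof (induction I rule: noetherian_induct)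
  case (step I)
  show ?case
  proof (rule ccontr)
    assume 1: "1 \<notin> I"
    have "socle_free m I" by (rule vanishes_0_socle_free[OF step.hyps step.prems])
    from regular_element[OF step.hyps 1 this, of "{}"] obtain x
      where x: "x \<in> m" "colon I x = I" "x \<notin> I" by auto
    have "1 \<in> adj I x"
      by (rule step.IH[OF adj_ideal[OF step.hyps] adj_psubset[OF step.hyps x(3)]])
        (use vanishes_adj[OF step.hyps] step.prems x(2) in auto)
    then obtain i r where "i \<in> I" "1 = i + r * x" unfolding adj_def by blast
    then have "(1 - r * x) * 1 \<in> I" by (metis add_diff_cancel_right' mult.right_neutral)
    then show False using unit_cancel[OF step.hyps x(1)] 1 by blast
  qed
qed

text \<open>Degree 0 classes are killed by powers of \<open>ws\<close>. An associated prime of the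
  submodule generated by a nonzero value contains \<open>P\<close> and \<open>ws\<close>, hence is
  \<open>m\<close>, which gives a socle element.\<close>

lemma vanishes_0:
  assumes I: "cideal I" "P \<subseteq> I" "socle_free m I"
  shows "vanishes ws 0 I"
  unfolding vanishes_def
proof
  fix c assume c: "c \<in> cocycles ws 0 I"
  have "\<exists>k. \<forall>n\<ge>k. \<forall>l. \<exists>j. w ^ j * c n l \<in> I" if w: "w \<in> set ws" for w
  proof -
    obtain j where "seq_scale (w ^ j) c \<in> coboundaries ws 0 I" using torsion_cocycles[OF I(1) c w] by blast
    from coboundaries_0[OF this] show ?thesis unfolding seq_scale_def by blast
  qed
  then have "\<exists>k. \<forall>w\<in>set ws. \<forall>n\<ge>k. \<forall>l. \<exists>j. w ^ j * c n l \<in> I" by (intro finite_bound) auto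
  then obtain k where k: "\<And>w n l. w \<in> set ws \<Longrightarrow> n \<ge> k \<Longrightarrow> \<exists>j. w ^ j * c n l \<in> I" by blast
  show "c \<in> coboundaries ws 0 I"
  proof (rule coboundaries_cong[OF I(1) c])
    fix n l assume n: "k \<le> n"
    show "c n l \<in> I"
    proof (rule ccontr)
      assume no: "c n l \<notin> I"
      then obtain b where b: "prime_ideal (colon I (c n l * b))" using associated_prime[OF I(1)] by blast
      have "colon I (c n l * b) = m"
      proof (rule primary[OF b])
        show "P \<subseteq> colon I (c n l * b)" using I subset_colon by blast
        show "set ws \<subseteq> colon I (c n l * b)"
        proof
          fix w assume "w \<in> set ws"
          then obtain j where "w ^ j * c n l \<in> I" using k n by blast
          then have "b * (w ^ j * c n l) \<in> I" by (rule cideal_mult[OF I(1)])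
          then have "w ^ j \<in> colon I (c n l * b)" by (simp add: colon_def algebra_simps)
          then show "w \<in> colon I (c n l * b)" by (rule prime_power[OF b])
        qed
      qed
      then have "\<forall>u\<in>m. u * (c n l * b) \<in> I" by (auto simp: colon_def mult.commute)
      then have "c n l * b \<in> I" using I(3) unfolding socle_free_def by blast
      then have "1 \<in> colon I (c n l * b)" by (simp add: colon_def)
      then show False using prime_one[OF b] by blast
    qed
  qed
qed

text \<open>Vanishing of the next group makes H^i(R/I) -> H^i(R/(I + xR)) surjective. The hypothesis
  on \<open>u\<close> concerns images modulo \<open>I + xR\<close>, so it also covers a
  \<open>u\<close> that acts on H^i(R/I) through multiples of \<open>x\<close>.\<close>

lemma killed_adj:
  assumes I: "cideal I" and v: "vanishes ws (Suc i) (colon I x)"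
    and u: "\<And>c. c \<in> cocycles ws i I \<Longrightarrow> seq_scale u c \<in> coboundaries ws i (adj I x)"
    and c: "c \<in> cocycles ws i (adj I x)"
  shows "seq_scale u c \<in> coboundaries ws i (adj I x)"
proof -
  note S = subspace_coboundaries[OF adj_ideal[OF I, of x], of ws i]
  obtain c' where c': "c' \<in> cocycles ws i I" "c - c' \<in> coboundaries ws i (adj I x)"
    using exact_right[OF I v c] by blast
  have "seq_scale u c = seq_scale u (c - c') + seq_scale u c'"
    by (simp add: seq_scale_def fun_eq_iff algebra_simps)
  then show ?thesis
    using seq.subspace_add[OF S seq.subspace_scale[OF S c'(2)] u[OF c'(1)]] by simp
qed

text \<open>The module in question does not change when \<open>I\<close> is enlarged by a nonzerodivisor from
  the power of \<open>m\<close> that kills it.\<close>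

lemma vanishes_top:
  assumes "cideal I" "c > 0" "\<And>i. i > c \<Longrightarrow> vanishes ws i I"
    and "\<And>u z. u \<in> products m s \<Longrightarrow> z \<in> cocycles ws c I \<Longrightarrow> seq_scale u z \<in> coboundaries ws c I"
  shows "vanishes ws c I"
  using assms(1,3,4)
proof (induction I rule: noetherian_induct)
  case (step I)
  note I = step.hyps
  have adj: "vanishes ws c (adj I x)"
    if x: "x \<notin> I" "\<And>i. i > c \<Longrightarrow> vanishes ws i (colon I x)" for x
  proof (rule step.IH[OF adj_ideal[OF I] adj_psubset[OF I x(1)]])
    show "vanishes ws i (adj I x)" if "i > c" for i
      using vanishes_adj[OF I] step.prems(1) x(2) that by simp
    show "seq_scale u z \<in> coboundaries ws c (adj I x)"
      if "u \<in> products m s" "z \<in> cocycles ws c (adj I x)" for u z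
      by (rule killed_adj[OF I x(2)[OF lessI] _ that(2)])
        (use step.prems(2)[OF that(1)] coboundaries_mono[OF subset_adj] in blast)
  qed
  show ?case
  proof (cases "1 \<in> I")
    case True
    then show ?thesis by (rule vanishes_one[OF I])
  next
    case one: False
    show ?thesis
    proof (cases "socle_free m I")
      case False
      then obtain a where a: "\<And>u. u \<in> m \<Longrightarrow> u * a \<in> I" "a \<notin> I" unfolding socle_free_def by blast
      have "vanishes ws i (colon I a)" if "i > 0" for i by (rule vanishes_socle[OF I a(1) that])
      then show ?thesis using vanishes_middle[OF I] adj[OF a(2)] assms(2) by auto
    next
      case True
      from regular_element[OF I one True, of "{}"] obtain x
        where x: "x \<in> m" "colon I x = I" "x \<notin> I" by auto
      \<comment> \<open>Being a nonzerodivisor, \<open>y\<close> acts surjectively on the degree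
        \<open>c\<close> group by the induction hypothesis; being in the \<open>s\<close>-th power
        of \<open>m\<close>, it acts as zero.\<close>
      define y where "y = x ^ s"
      have y: "colon I y = I" unfolding y_def by (rule colon_power_regular[OF I x(2)])
      have "y \<notin> I"
      proof
        assume "y \<in> I"
        then have "1 \<in> colon I y" by (simp add: colon_def)
        then show False using y one by blast
      qed
      then have v: "vanishes ws c (adj I y)" using adj[of y] y step.prems(1) by simp
      show ?thesis
        unfolding vanishes_def
      proof
        fix z assume z: "z \<in> cocycles ws c I"
        then have "z \<in> coboundaries ws c (adj I y)"
          using v cocycles_mono[OF subset_adj] unfolding vanishes_def by blast
        from exact_middle[OF I z this] obtain z'
          where z': "z' \<in> cocycles ws c I" "z - seq_scale y z' \<in> coboundaries ws c I"
          unfolding y by blast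
        have "seq_scale y z' \<in> coboundaries ws c I"
          using step.prems(2)[OF _ z'(1)] power_in_products[OF x(1)] unfolding y_def by blast
        from seq.subspace_add[OF subspace_coboundaries[OF I] z'(2) this]
        show "z \<in> coboundaries ws c I" by simp
      qed
    qed
  qed
qed

text \<open>When \<open>ws\<close> lies in \<open>I\<close>, the degree 0 group is R/I, and
  \<open>m\<close> is the only prime above \<open>I\<close>. Chains of submodules become chains of
  ideals \<open>D n\<close>, which are saturated at \<open>m\<close> because the ring is
  local.\<close>

lemma artinian_0:
  assumes I: "cideal I" "P \<subseteq> I" and nil: "set ws \<subseteq> I"
  shows "seq.artinian (coboundaries ws 0 I) (cocycles ws 0 I)"
proof (rule seq.artinianI)
  fix C :: "nat \<Rightarrow> (nat \<Rightarrow> bool list \<Rightarrow> 'a) set"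
  assume C: "\<And>n. seq.subspace (C n)" "\<And>n. coboundaries ws 0 I \<subseteq> C n"
    "\<And>n. C n \<subseteq> cocycles ws 0 I" "\<And>n. C (Suc n) \<subseteq> C n" and dec: "\<And>i j. i \<le> j \<Longrightarrow> C j \<subseteq> C i"
  let ?F = "replicate (length ws) False"
  \<comment> \<open>Collects the eventual values at the empty index, where the weight is 1 and a
    cocycle is constant modulo \<open>I\<close>.\<close>
  define D where "D n = {a. \<exists>c\<in>C n. \<exists>k. \<forall>j\<ge>k. c j ?F - a \<in> I}" for n
  have Did: "cideal (D n)" for n
    unfolding cideal_def
  proof (intro conjI ballI allI)
    show "0 \<in> D n"
      unfolding D_def using seq.subspace_0[OF C(1)[of n]] cideal_zero[OF I(1)]
      by (auto intro!: bexI[of _ 0])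
    fix a assume "a \<in> D n"
    then obtain c k where c: "c \<in> C n" "\<And>j. j \<ge> k \<Longrightarrow> c j ?F - a \<in> I" unfolding D_def by blast
    { fix b assume "b \<in> D n"
      then obtain d k' where d: "d \<in> C n" "\<And>j. j \<ge> k' \<Longrightarrow> d j ?F - b \<in> I" unfolding D_def by blast
      have "(c + d) j ?F - (a + b) \<in> I" if "j \<ge> max k k'" for j
      proof -
        have "(c + d) j ?F - (a + b) = (c j ?F - a) + (d j ?F - b)" by simp
        moreover have "c j ?F - a \<in> I" "d j ?F - b \<in> I" using c(2) d(2) that by auto
        ultimately show ?thesis using cideal_add[OF I(1)] by metis
      qed
      then show "a + b \<in> D n" using seq.subspace_add[OF C(1) c(1) d(1)] unfolding D_def by blast }
    fix r
    have "seq_scale r c j ?F - r * a \<in> I" if "j \<ge> k" for j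
      using cideal_mult[OF I(1) c(2)[OF that], of r] by (simp add: seq_scale_def algebra_simps)
    then show "r * a \<in> D n" using seq.subspace_scale[OF C(1) c(1)] unfolding D_def by blast
  qed
  have sat: "saturated m (D n)" for n
    unfolding saturated_def
  proof (intro allI impI)
    fix s a assume s: "s \<notin> m" "s * a \<in> D n"
    then have "s \<in> colon (D n) a" by (simp add: colon_def mult.commute)
    then have "1 \<in> colon (D n) a" using proper_subset_m[OF colon_ideal[OF Did]] s(1) by blast
    then show "a \<in> D n" by (simp add: colon_def)
  qed
  have "saturated_dcc m I"
  proof (rule saturated_dcc_minimal[OF m_prime I(1)])
    fix q assume q: "prime_ideal q" "I \<subseteq> q"
    show "q = m"
      by (rule primary[OF q(1)]) (use I(2) q nil in blast)+
  qed
  then have "\<exists>N. \<forall>n\<ge>N. D n = D N"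
  proof (rule saturated_dccD)
    fix n
    show "cideal (D n)" "saturated m (D n)" by (fact Did sat)+
    show "I \<subseteq> D n"
      unfolding D_def using seq.subspace_0[OF C(1)[of n]] cideal_minus[OF I(1)]
      by (auto intro!: bexI[of _ 0])
    show "D (Suc n) \<subseteq> D n" using C(4) unfolding D_def by blast
  qed
  then obtain N where N: "\<And>n. n \<ge> N \<Longrightarrow> D n = D N" by blast
  have "C N \<subseteq> C n" if n: "n \<ge> N" for n
  proof
    fix c assume c: "c \<in> C N"
    then have cz: "c \<in> cocycles ws 0 I" using C(3) by blast
    obtain k where k: "\<And>n. cochain ws 0 (c n)"
      "\<And>n l. n \<ge> k \<Longrightarrow> c (Suc n) l - kweight ws l * c n l \<in> I" using cocyclesE[OF cz] by metis
    have const: "c j ?F - c k ?F \<in> I" if "j \<ge> k" for j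
      using cocycle_shift[where c = c and n = k and t = "j - k" and l = ?F, OF I(1) k(2) order_refl] that
      by simp
    then have "c k ?F \<in> D N" using c unfolding D_def by blast
    then have "c k ?F \<in> D n" using N[OF n] by simp
    then obtain d k' where d: "d \<in> C n" "\<And>j. j \<ge> k' \<Longrightarrow> d j ?F - c k ?F \<in> I" unfolding D_def by blast
    have dz: "d \<in> cocycles ws 0 I" using d(1) C(3) by blast
    have "c - d \<in> coboundaries ws 0 I"
    proof (rule coboundaries_cong[OF I(1), where k = "max k k'"])
      show Z: "c - d \<in> cocycles ws 0 I" by (rule seq.subspace_diff[OF subspace_cocycles[OF I(1)] cz dz])
      fix j l assume j: "max k k' \<le> j"
      show "(c - d) j l \<in> I"
      proof (cases "l = ?F")
        case True
        have "(c - d) j ?F = (c j ?F - c k ?F) - (d j ?F - c k ?F)" by simp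
        then show ?thesis using cideal_diff[OF I(1) const[of j] d(2)[of j]] j True by simp
      next
        case False
        have "cochain ws 0 ((c - d) j)" using Z unfolding cocycles_def by blast
        then show ?thesis using cochain_0[OF _ False] cideal_zero[OF I(1)] by metis
      qed
    qed
    then have "c - d \<in> C n" using C(2) by blast
    from seq.subspace_add[OF C(1) this d(1)] show "c \<in> C n" by simp
  qed
  then show "\<exists>N. \<forall>n\<ge>N. C N \<subseteq> C n" by blast
qed

text \<open>While some \<open>x\<close> in \<open>ws\<close> is outside \<open>I\<close>, the ideal
  \<open>I + xR\<close> is larger. If \<open>x\<close> is a zero divisor modulo \<open>I\<close>,
  then \<open>colon I x\<close> is larger too and extensions apply. Otherwise the x-torsion in
  degree \<open>i > 0\<close> is an image of cohomology modulo \<open>I + xR\<close> in degree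
  \<open>i - 1\<close>, and Melkersson's criterion passes from the torsion to the whole
  group.\<close>

lemma artinian_cohomology:
  assumes "cideal I" "P \<subseteq> I"
  shows "seq.artinian (coboundaries ws i I) (cocycles ws i I)"
  using assms
proof (induction I arbitrary: i rule: noetherian_induct)
  case (step I)
  note I = step.hyps
  note subs = subspace_coboundaries subspace_cocycles
  show ?case
  proof (cases "set ws \<subseteq> I")
    case nil: True
    show ?thesis
    proof (cases "i = 0")
      case True
      then show ?thesis using artinian_0[OF I step.prems] nil by blast
    next
      case False
      have v: "cocycles ws i I \<subseteq> coboundaries ws i I"
        using vanishes_nilpotent[OF I, of i ws] False nil power_one_right
        unfolding vanishes_def by (metis gr0I subsetD)
      show ?thesis by (rule seq.artinianI) (use v in blast)
    qed
  next
    case False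
    then obtain x where x: "x \<in> set ws" "x \<notin> I" by blast
    have adj: "seq.artinian (coboundaries ws i (adj I x)) (cocycles ws i (adj I x))" for i
      by (rule step.IH[OF adj_ideal[OF I] adj_psubset[OF I x(2)]])
        (use step.prems subset_adj[of I x] in blast)
    show ?thesis
    proof (cases "colon I x = I")
      case False
      then have "I \<subset> colon I x" using subset_colon[OF I] by blast
      then have colon: "seq.artinian (coboundaries ws i (colon I x)) (cocycles ws i (colon I x))"
        using step.IH[OF colon_ideal[OF I]] step.prems by blast
      show ?thesis
        by (rule seq.artinian_extension[OF subs[OF colon_ideal[OF I]] subs[OF I] subs[OF adj_ideal[OF I]]
              cocycles_mono[OF subset_adj] coboundaries_mono[OF subset_adj] coboundaries_subset
              coboundaries_subset colon adj scale_coboundaries exact_middle[OF I]])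
    next
      case True
      have tors: "seq.artinian (coboundaries ws i I) {c \<in> cocycles ws i I. seq_scale x c \<in> coboundaries ws i I}"
      proof (cases i)
        case 0
        have "{c \<in> cocycles ws 0 I. seq_scale x c \<in> coboundaries ws 0 I} \<subseteq> coboundaries ws 0 I"
        proof
          fix c assume c: "c \<in> {c \<in> cocycles ws 0 I. seq_scale x c \<in> coboundaries ws 0 I}"
          then obtain k where "\<And>n l. n \<ge> k \<Longrightarrow> x * c n l \<in> I"
            using coboundaries_0[of "seq_scale x c"] unfolding seq_scale_def by blast
          then have "c n l \<in> I" if "n \<ge> k" for n l using True that unfolding colon_def by blast
          then show "c \<in> coboundaries ws 0 I" using coboundaries_cong[OF I] c by blast
        qed
        then show ?thesis unfolding 0 by (intro seq.artinianI) blast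
      next
        case (Suc i')
        show ?thesis
          unfolding Suc
        proof (rule seq.artinian_correspondence[OF subs[OF adj_ideal[OF I]] subs(1)[OF I]
              seq.subspace_torsion[OF subspace_cocycles[OF I] subspace_coboundaries[OF I]] coboundaries_subset _ adj[of i'],
              where \<rho> = "connecting ws i' I x"])
          show "coboundaries ws (Suc i') I \<subseteq>
              {c \<in> cocycles ws (Suc i') I. seq_scale x c \<in> coboundaries ws (Suc i') I}"
            using coboundaries_subset seq.subspace_scale[OF subs(1)[OF I]] by blast
          show "\<exists>c\<in>coboundaries ws (Suc i') I. connecting ws i' I x b c"
            if "b \<in> coboundaries ws i' (adj I x)" for b
            using connecting_coboundary[OF I that] seq.subspace_0[OF subs(1)[OF I]] by blast
          show "c \<in> coboundaries ws (Suc i') I"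
            if "c \<in> {c \<in> cocycles ws (Suc i') I. seq_scale x c \<in> coboundaries ws (Suc i') I}"
              "connecting ws i' I x 0 c" for c
            using connecting_kernel[OF I True _ that(2)] that(1) by blast
          show "\<exists>b\<in>cocycles ws i' (adj I x). connecting ws i' I x b c"
            if "c \<in> {c \<in> cocycles ws (Suc i') I. seq_scale x c \<in> coboundaries ws (Suc i') I}" for c
            using connecting_onto[OF I] that by blast
        qed (use connecting_add[OF I] connecting_scale[OF I] connecting_zero[OF I] in auto)
      qed
      show ?thesis
      proof (rule seq.artinian_torsion[OF subs[OF I] coboundaries_subset tors])
        show "\<exists>k. seq_scale (x ^ k) c \<in> coboundaries ws i I" if "c \<in> cocycles ws i I" for c
          using torsion_cocycles[OF I that x(1)] .
      qed
    qed
  qed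
qed

text \<open>A socle element \<open>a\<close> can be added to \<open>I\<close> harmlessly: a prime
  above \<open>I\<close> that misses \<open>a\<close> contains \<open>m\<close>. Without socle,
  \<open>c = 0\<close> makes all cohomology vanish, so that \<open>I\<close> is the unit ideal; for
  larger \<open>c\<close> one element of \<open>m\<close> lowers the bound.\<close>

lemma vanishes_parameters:
  assumes "cideal I" "P \<subseteq> I" "\<And>i. i > c \<Longrightarrow> vanishes ws i I"
  shows "\<exists>xs. length xs = c \<and> set xs \<subseteq> m \<and>
    (\<forall>Q. prime_ideal Q \<longrightarrow> I \<subseteq> Q \<longrightarrow> set xs \<subseteq> Q \<longrightarrow> m \<subseteq> Q)"
  using assms
proof (induction c arbitrary: I)
  case (0 I)
  then show ?case
  proof (induction I rule: noetherian_induct)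
    case (step I)
    note I = step.hyps
    show ?case
    proof (cases "1 \<in> I")
      case True
      then show ?thesis using prime_one by (intro exI[of _ "[]"]) auto
    next
      case one: False
      have nsf: "\<not> socle_free m I"
      proof
        assume sf: "socle_free m I"
        have "vanishes ws i I" for i
          using vanishes_0[OF I step.prems(1) sf] step.prems(2) by (cases i) auto
        then show False using vanishes_all[OF I] one by blast
      qed
      then obtain a where a: "\<And>u. u \<in> m \<Longrightarrow> u * a \<in> I" "a \<notin> I" unfolding socle_free_def by blast
      have "vanishes ws i (adj I a)" if "i > 0" for i
        using vanishes_adj[OF I] step.prems(2) vanishes_socle[OF I a(1)] that by simp
      then have IH: "m \<subseteq> Q" if "prime_ideal Q" "adj I a \<subseteq> Q" for Q
        using step.IH[OF adj_ideal[OF I] adj_psubset[OF I a(2)]] step.prems(1) subset_adj[of I a] that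
        by auto
      have "m \<subseteq> Q" if Q: "prime_ideal Q" "I \<subseteq> Q" for Q
      proof (cases "a \<in> Q")
        case True
        then show ?thesis using IH[OF Q(1)] adj_least[OF prime_cideal[OF Q(1)] Q(2)] by blast
      next
        case False
        then show ?thesis using a(1) Q prime_mult[OF Q(1)] by blast
      qed
      then show ?thesis by (intro exI[of _ "[]"]) auto
    qed
  qed
next
  case (Suc c I)
  note outer = Suc.IH
  from Suc.prems show ?case
  proof (induction I rule: noetherian_induct)
    case (step I)
    note I = step.hyps
    show ?case
    proof (cases "1 \<in> I")
      case True
      \<comment> \<open>No prime lies above the unit ideal, so zeros pad the list to its prescribed
        length.\<close>
      then show ?thesis
        using prime_one cideal_zero[OF m_ideal] by (intro exI[of _ "replicate (Suc c) 0"]) auto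
    next
      case one: False
      show ?thesis
      proof (cases "socle_free m I")
        case False
        then obtain a where a: "\<And>u. u \<in> m \<Longrightarrow> u * a \<in> I" "a \<notin> I" unfolding socle_free_def by blast
        have "vanishes ws i (adj I a)" if "i > Suc c" for i
          using vanishes_adj[OF I] step.prems(2) vanishes_socle[OF I a(1)] that by simp
        then obtain xs where xs: "length xs = Suc c" "set xs \<subseteq> m"
          "\<And>Q. prime_ideal Q \<Longrightarrow> adj I a \<subseteq> Q \<Longrightarrow> set xs \<subseteq> Q \<Longrightarrow> m \<subseteq> Q"
          using step.IH[OF adj_ideal[OF I] adj_psubset[OF I a(2)]] step.prems(1) subset_adj[of I a]
          by (meson order_trans)
        have "m \<subseteq> Q" if Q: "prime_ideal Q" "I \<subseteq> Q" "set xs \<subseteq> Q" for Q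
        proof (cases "a \<in> Q")
          case True
          then show ?thesis using xs(3)[OF Q(1) _ Q(3)] adj_least[OF prime_cideal[OF Q(1)] Q(2)] by blast
        next
          case False
          then show ?thesis using a(1) Q prime_mult[OF Q(1)] by blast
        qed
        then show ?thesis using xs by blast
      next
        case sf: True
        \<comment> \<open>Outside the primes of \<open>F\<close>, multiplication by \<open>x\<close>
          on the top group has a cokernel killed by the \<open>s\<close>-th power of
          \<open>m\<close>; \<open>x\<close> is then chosen to be regular modulo \<open>I\<close> as
          well.\<close>
        obtain F s where F: "finite F" "\<And>q. q \<in> F \<Longrightarrow> prime_ideal q \<and> q \<noteq> m"
          "\<And>x u z. (\<forall>q\<in>F. x \<notin> q) \<Longrightarrow> u \<in> products m s \<Longrightarrow> z \<in> cocycles ws (Suc c) I \<Longrightarrow>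
            \<exists>z'\<in>cocycles ws (Suc c) I. seq_scale u z - seq_scale x z' \<in> coboundaries ws (Suc c) I"
          using seq.artinian_avoidance[where m = m, OF artinian_cohomology[OF I step.prems(1), of "Suc c"]
              subspace_coboundaries[OF I] subspace_cocycles[OF I] coboundaries_subset]
          by metis
        obtain x where x: "x \<in> m" "\<forall>q\<in>F. x \<notin> q" "colon I x = I" "x \<notin> I"
          using regular_element[OF I one sf F(1,2)] by blast
        note J = adj_ideal[OF I, of x]
        have v: "vanishes ws i (adj I x)" if "i > Suc c" for i
          using vanishes_adj[OF I] step.prems(2) x(3) that by simp
        \<comment> \<open>The top group modulo \<open>I + xR\<close> is the cokernel of
          \<open>x\<close>. Killed by a power of \<open>m\<close> and of positive degree, it
          vanishes, so the bound drops to \<open>c\<close>.\<close>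
        have "vanishes ws (Suc c) (adj I x)"
        proof (rule vanishes_top[OF J _ v])
          fix u z assume u: "u \<in> products m s" and z: "z \<in> cocycles ws (Suc c) (adj I x)"
          show "seq_scale u z \<in> coboundaries ws (Suc c) (adj I x)"
          proof (rule killed_adj[OF I _ _ z])
            show "vanishes ws (Suc (Suc c)) (colon I x)" using step.prems(2) x(3) by simp
            fix z assume "z \<in> cocycles ws (Suc c) I"
            then obtain z' where z': "z' \<in> cocycles ws (Suc c) I"
              "seq_scale u z - seq_scale x z' \<in> coboundaries ws (Suc c) I" using F(3)[OF x(2) u] by blast
            have xz: "seq_scale x z' \<in> cocycles ws (Suc c) (adj I x)"
              using seq.subspace_scale[OF subspace_cocycles[OF I] z'(1)] cocycles_mono[OF subset_adj] by blast
            have "seq_scale x z' \<in> coboundaries ws (Suc c) (adj I x)"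
              by (rule coboundaries_cong[OF J xz])
                (use cideal_mult2[OF J mem_adj[OF I]] in \<open>auto simp: seq_scale_def\<close>)
            moreover have "seq_scale u z - seq_scale x z' \<in> coboundaries ws (Suc c) (adj I x)"
              using z'(2) coboundaries_mono[OF subset_adj] by blast
            ultimately show "seq_scale u z \<in> coboundaries ws (Suc c) (adj I x)"
              using seq.subspace_add[OF subspace_coboundaries[OF J]] by fastforce
          qed
        qed auto
        then have "vanishes ws i (adj I x)" if "i > c" for i
          using v that by (cases "i = Suc c") auto
        then obtain xs where xs: "length xs = c" "set xs \<subseteq> m"
          "\<And>Q. prime_ideal Q \<Longrightarrow> adj I x \<subseteq> Q \<Longrightarrow> set xs \<subseteq> Q \<Longrightarrow> m \<subseteq> Q"
          using outer[OF J] step.prems(1) subset_adj[of I x] by (meson order_trans)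
        have "m \<subseteq> Q" if "prime_ideal Q" "I \<subseteq> Q" "set (x # xs) \<subseteq> Q" for Q
          using xs(3)[OF that(1)] adj_least[OF prime_cideal[OF that(1)] that(2), of x] that(3) by auto
        then show ?thesis using xs x(1) by (intro exI[of _ "x # xs"]) auto
      qed
    qed
  qed
qed

text \<open>Otherwise cohomology modulo \<open>P\<close> would vanish above
  \<open>length ws - 1\<close>, and too few elements would be m-primary modulo \<open>P\<close> for
  the height theorem; for an empty list all cohomology would vanish.\<close>

theorem top_not_vanishing:
  assumes "has_chain (length ws) P"
  shows "\<not> vanishes ws (length ws) P"
proof
  assume v: "vanishes ws (length ws) P"
  note P = prime_cideal[OF P_prime]
  show False
  proof (cases "length ws")
    case 0
    have "vanishes ws i P" for i
      using v vanishes_degree[OF P] 0 by (cases "i = 0") auto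
    then show False using vanishes_all[OF P] prime_one[OF P_prime] by blast
  next
    case (Suc c)
    have "vanishes ws i P" if "i > c" for i
      using v vanishes_degree[OF P, of ws i] Suc that by (cases "i = Suc c") auto
    then obtain xs where xs: "length xs = c" "set xs \<subseteq> m"
      "\<And>Q. prime_ideal Q \<Longrightarrow> P \<subseteq> Q \<Longrightarrow> set xs \<subseteq> Q \<Longrightarrow> m \<subseteq> Q"
      using vanishes_parameters[OF P order_refl, of c] by blast
    have "length ws \<le> length xs"
      by (rule krull_height[OF assms xs(2)]) (use xs(3) prime_subset_m in blast)
    then show False using Suc xs(1) by simp
  qed
qed

end

section \<open>Functionals on top local cohomology\<close>

context
  fixes M :: "('a::comm_ring_1, 'm) rmod"
  assumes M: "rmodule M"
begin

lemma rmodule_zero: "mzero M \<in> mcar M"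
  and rmodule_add: "x \<in> mcar M \<Longrightarrow> y \<in> mcar M \<Longrightarrow> madd M x y \<in> mcar M"
  and rmodule_smul: "x \<in> mcar M \<Longrightarrow> msmul M a x \<in> mcar M"
  and rmodule_assoc: "x \<in> mcar M \<Longrightarrow> y \<in> mcar M \<Longrightarrow> z \<in> mcar M \<Longrightarrow>
    madd M (madd M x y) z = madd M x (madd M y z)"
  and rmodule_comm: "x \<in> mcar M \<Longrightarrow> y \<in> mcar M \<Longrightarrow> madd M x y = madd M y x"
  and rmodule_add_zero: "x \<in> mcar M \<Longrightarrow> madd M (mzero M) x = x"
  and rmodule_inverse: "x \<in> mcar M \<Longrightarrow> \<exists>y\<in>mcar M. madd M x y = mzero M"
  and rmodule_smul_add: "x \<in> mcar M \<Longrightarrow> y \<in> mcar M \<Longrightarrow>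
    msmul M a (madd M x y) = madd M (msmul M a x) (msmul M a y)"
  and rmodule_add_smul: "x \<in> mcar M \<Longrightarrow> msmul M (a + b) x = madd M (msmul M a x) (msmul M b x)"
  and rmodule_mult_smul: "x \<in> mcar M \<Longrightarrow> msmul M (a * b) x = msmul M a (msmul M b x)"
  and rmodule_one: "x \<in> mcar M \<Longrightarrow> msmul M 1 x = x"
  by (insert M, unfold rmodule_def, elim conjE, meson)+

lemma rmodule_cancel:
  assumes "x \<in> mcar M" "y \<in> mcar M" "z \<in> mcar M" "madd M x y = madd M x z"
  shows "y = z"
proof -
  obtain x' where x': "x' \<in> mcar M" "madd M x x' = mzero M" using rmodule_inverse[OF assms(1)] by blast
  have "madd M (madd M x' x) y = madd M (madd M x' x) z"
    using assms x' by (simp add: rmodule_assoc)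
  then show ?thesis using assms x' by (simp add: rmodule_comm[of x' x] rmodule_add_zero)
qed

lemma rmodule_idem: "x \<in> mcar M \<Longrightarrow> madd M x x = x \<Longrightarrow> x = mzero M"
  using rmodule_cancel[of x x "mzero M"] rmodule_comm[of x "mzero M"] rmodule_add_zero rmodule_zero by simp

lemma rmodule_zero_smul: "x \<in> mcar M \<Longrightarrow> msmul M 0 x = mzero M"
  using rmodule_idem[of "msmul M 0 x"] rmodule_add_smul[of x 0 0] rmodule_smul by simp

lemma rmodule_smul_zero: "msmul M a (mzero M) = mzero M"
  using rmodule_idem[of "msmul M a (mzero M)"] rmodule_smul_add[of "mzero M" "mzero M" a]
    rmodule_smul rmodule_zero rmodule_add_zero by simp

lemma ann_ideal: "x \<in> mcar M \<Longrightarrow> cideal (ann M x)"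
  unfolding cideal_def ann_def
  by (auto simp: rmodule_zero_smul rmodule_add_smul rmodule_mult_smul rmodule_smul_zero
      rmodule_add_zero rmodule_zero)

lemma rmodule_smul_eq_iff:
  assumes "x \<in> mcar M"
  shows "msmul M a x = msmul M b x \<longleftrightarrow> a - b \<in> ann M x"
proof -
  have "msmul M a x = madd M (msmul M b x) (msmul M (a - b) x)"
    using rmodule_add_smul[OF assms, of b "a - b"] by simp
  moreover have "madd M (msmul M b x) (mzero M) = msmul M b x"
    using assms by (metis rmodule_comm rmodule_add_zero rmodule_smul rmodule_zero)
  ultimately show ?thesis
    unfolding ann_def mem_Collect_eq
    by (metis assms rmodule_cancel rmodule_smul rmodule_zero)
qed

lemma ann_smul: "x \<in> mcar M \<Longrightarrow> ann M (msmul M a x) = colon (ann M x) a"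
  by (auto simp: ann_def colon_def rmodule_mult_smul[symmetric] mult.commute)

end

lemma cideal_INT: "(\<And>n. cideal (f n)) \<Longrightarrow> cideal (\<Inter>n. f n)"
  by (auto simp: cideal_def)

lemma prod_list_dvd: "w \<in> set ws \<Longrightarrow> w dvd prod_list (ws :: 'a::comm_monoid_mult list)"
  by (induction ws) auto

lemma kweight_True [simp]: "kweight ws (replicate (length ws) True) = prod_list ws"
  by (induction ws) auto

lemma cochain_top:
  assumes "cochain ws i c" "i \<ge> length ws" "l \<noteq> replicate (length ws) True"
  shows "c l = 0"
proof (rule ccontr)
  assume "c l \<noteq> 0"
  then have l: "length l = length ws" "count_list l True = i" using assms(1) unfolding cochain_def by auto
  have all: "l = replicate (length l) True" if "length l \<le> count_list l True" for l :: "bool list"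
    using that
  proof (induction l)
    case (Cons b l)
    then show ?case using count_le_length[of l True] by (cases b) auto
  qed simp
  have "length l \<le> count_list l True" using l assms(2) by linarith
  from all[OF this] have "l = replicate (length ws) True" unfolding l(1) .
  then show False using assms(3) by contradiction
qed

section \<open>Annihilators of the top fractions\<close>

context koszul_local
begin

abbreviation (input) power_ideal :: "nat \<Rightarrow> 'a set" where
  "power_ideal n \<equiv> gen_ideal (P \<union> (\<lambda>w. w ^ n) ` set ws)"

text \<open>The annihilator of the class of \<open>1 / (prod_list ws)^n\<close> in top local cohomology.\<close>

definition limit_ideal :: "nat \<Rightarrow> 'a set" where
  "limit_ideal n = {a. \<exists>t. prod_list ws ^ t * a \<in> power_ideal (n + t)}"

lemma power_ideal_step: "a \<in> power_ideal n \<Longrightarrow> prod_list ws * a \<in> power_ideal (Suc n)"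
proof -
  have "power_ideal n \<subseteq> colon (power_ideal (Suc n)) (prod_list ws)"
  proof (rule gen_ideal_least[OF colon_ideal[OF gen_ideal_ideal]], rule subsetI)
    fix b assume b: "b \<in> P \<union> (\<lambda>w. w ^ n) ` set ws"
    have sup: "c \<in> power_ideal (Suc n)" if "c \<in> P \<union> (\<lambda>w. w ^ Suc n) ` set ws" for c
      by (rule subsetD[OF gen_ideal_superset that])
    show "b \<in> colon (power_ideal (Suc n)) (prod_list ws)"
    proof (cases "b \<in> P")
      case True
      then show ?thesis using cideal_mult[OF gen_ideal_ideal sup] by (simp add: colon_def)
    next
      case False
      then obtain w where w: "w \<in> set ws" "b = w ^ n" using b by blast
      obtain v where "prod_list ws = w * v" using prod_list_dvd[OF w(1)] by (auto elim: dvdE)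
      then have "prod_list ws * b = v * w ^ Suc n" unfolding w(2) by (simp add: ac_simps)
      then show ?thesis using cideal_mult[OF gen_ideal_ideal sup] w(1) by (auto simp: colon_def)
    qed
  qed
  then show "a \<in> power_ideal n \<Longrightarrow> prod_list ws * a \<in> power_ideal (Suc n)" by (auto simp: colon_def)
qed

lemma power_ideal_steps: "a \<in> power_ideal n \<Longrightarrow> prod_list ws ^ t * a \<in> power_ideal (n + t)"
proof (induction t)
  case (Suc t)
  then show ?case using power_ideal_step[of "prod_list ws ^ t * a" "n + t"] by (simp add: mult.assoc)
qed simp

lemma limit_ideal_ideal: "cideal (limit_ideal n)"
  unfolding cideal_def
proof (intro conjI ballI allI)
  show "0 \<in> limit_ideal n" unfolding limit_ideal_def using cideal_zero[OF gen_ideal_ideal] by auto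
  fix a assume "a \<in> limit_ideal n"
  then obtain s where s: "prod_list ws ^ s * a \<in> power_ideal (n + s)" unfolding limit_ideal_def by blast
  { fix b assume "b \<in> limit_ideal n"
    then obtain t where t: "prod_list ws ^ t * b \<in> power_ideal (n + t)" unfolding limit_ideal_def by blast
    have "prod_list ws ^ (s + t) * (a + b)
      = prod_list ws ^ t * (prod_list ws ^ s * a) + prod_list ws ^ s * (prod_list ws ^ t * b)"
      by (simp add: algebra_simps power_add)
    moreover have "\<dots> \<in> power_ideal (n + (s + t))"
    proof (rule cideal_add[OF gen_ideal_ideal])
      show "prod_list ws ^ t * (prod_list ws ^ s * a) \<in> power_ideal (n + (s + t))"
        using power_ideal_steps[OF s, of t] by (simp only: add.assoc)
      show "prod_list ws ^ s * (prod_list ws ^ t * b) \<in> power_ideal (n + (s + t))"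
        using power_ideal_steps[OF t, of s] by (simp only: add.assoc add.commute[of t])
    qed
    ultimately have "prod_list ws ^ (s + t) * (a + b) \<in> power_ideal (n + (s + t))" by (simp only:)
    then show "a + b \<in> limit_ideal n" unfolding limit_ideal_def by blast }
  fix r
  have "prod_list ws ^ s * (r * a) \<in> power_ideal (n + s)"
    using cideal_mult[OF gen_ideal_ideal s, of r] by (simp add: ac_simps)
  then show "r * a \<in> limit_ideal n" unfolding limit_ideal_def by blast
qed

lemma power_ideal_subset: "power_ideal n \<subseteq> limit_ideal n"
proof
  fix a assume "a \<in> power_ideal n"
  then have "prod_list ws ^ 0 * a \<in> power_ideal (n + 0)" by simp
  then show "a \<in> limit_ideal n" unfolding limit_ideal_def by blast
qed

text \<open>What the transition maps kill is already part of the limit ideals, so multiplication by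
  the product is injective from R modulo one limit ideal to R modulo the next. This is what allows
  functionals to be extended.\<close>

lemma limit_ideal_colon: "colon (limit_ideal (Suc n)) (prod_list ws) = limit_ideal n"
proof (intro equalityI subsetI)
  fix a assume "a \<in> colon (limit_ideal (Suc n)) (prod_list ws)"
  then obtain t where "prod_list ws ^ t * (prod_list ws * a) \<in> power_ideal (Suc n + t)"
    unfolding limit_ideal_def colon_def by blast
  then have "prod_list ws ^ Suc t * a \<in> power_ideal (n + Suc t)" by (simp add: ac_simps)
  then show "a \<in> limit_ideal n" unfolding limit_ideal_def by blast
next
  fix a assume "a \<in> limit_ideal n"
  then obtain t where "prod_list ws ^ t * a \<in> power_ideal (n + t)" unfolding limit_ideal_def by blast
  from power_ideal_step[OF this]
  have "prod_list ws ^ t * (prod_list ws * a) \<in> power_ideal (Suc n + t)" by (simp add: ac_simps)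
  then show "a \<in> colon (limit_ideal (Suc n)) (prod_list ws)" unfolding limit_ideal_def colon_def by blast
qed

text \<open>The classes of 1 / W^n with W = \<open>prod_list ws\<close> generate the limit; if all
  were zero, each top cocycle would become a coboundary at a later stage.\<close>

lemma limit_ideal_proper:
  assumes "\<not> vanishes ws (length ws) P"
  shows "\<exists>n. 1 \<notin> limit_ideal n"
proof (rule ccontr)
  assume "\<not> ?thesis"
  then have all: "\<exists>t. prod_list ws ^ t \<in> power_ideal (n + t)" for n
    unfolding limit_ideal_def by simp
  note P = prime_cideal[OF P_prime]
  let ?T = "replicate (length ws) True"
  have "vanishes ws (length ws) P"
    unfolding vanishes_def
  proof
    fix c assume c: "c \<in> cocycles ws (length ws) P"
    obtain k where k: "\<And>n. cochain ws (length ws) (c n)"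
      "\<And>n l. n \<ge> k \<Longrightarrow> c (Suc n) l - kweight ws l * c n l \<in> P" using cocyclesE[OF c] by metis
    show "c \<in> coboundaries ws (length ws) P"
    proof (rule coboundariesI[OF P c])
      fix k'
      define n where "n = max k k'"
      obtain t where t: "prod_list ws ^ t \<in> power_ideal (n + t)" using all by blast
      have "c n ?T * prod_list ws ^ t \<in> power_ideal (n + t)"
        by (rule cideal_mult[OF gen_ideal_ideal t])
      from kd_top_onto[OF P this] obtain b where b: "precochain ws (length ws) b"
        "c n ?T * prod_list ws ^ t - kd (n + t) ws b ?T \<in> P" by blast
      have "c (n + t) l - kd (n + t) ws b l \<in> P" for l
      proof (cases "l = ?T")
        case True
        have "c (n + t) ?T - prod_list ws ^ t * c n ?T \<in> P"
          using cocycle_shift[where c = c and n = n and t = t and l = ?T, OF P k(2)] unfolding n_def by simp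
        from cideal_add[OF P this b(2)] show ?thesis unfolding True by (simp add: mult.commute)
      next
        case False
        then show ?thesis
          using cochain_top[OF k(1) order_refl False] cochain_top[OF cochain_kd[OF b(1)] order_refl False]
            cideal_zero[OF P] by simp
      qed
      then have "coboundary_at ws (length ws) P (n + t) (c (n + t))"
        using b(1) unfolding coboundary_at_def by blast
      then show "\<exists>n\<ge>k'. coboundary_at ws (length ws) P n (c n)"
        unfolding n_def by (metis max.cobounded2 trans_le_add1)
    qed
  qed
  then show False using assms by blast
qed

end

section \<open>Compatible sequences in the injective hull\<close>

locale matlis = koszul_local m ws P for m :: "'a::comm_ring_1 set" and ws P +
  fixes E :: "('a, 'e) rmod"
  assumes E: "inj_hull_residue E m" and dim: "quot_dim P = enat (length ws)"
begin

lemma E_module: "rmodule E"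
  using E unfolding inj_hull_residue_def injective_mod_def by blast

lemma E_baer:
  assumes "cideal I" "\<And>a. a \<in> I \<Longrightarrow> g a \<in> mcar E"
    and "\<And>a b. a \<in> I \<Longrightarrow> b \<in> I \<Longrightarrow> g (a + b) = madd E (g a) (g b)"
    and "\<And>r a. a \<in> I \<Longrightarrow> g (r * a) = msmul E r (g a)"
  shows "\<exists>e\<in>mcar E. \<forall>a\<in>I. g a = msmul E a e"
  using E assms unfolding inj_hull_residue_def injective_mod_def by blast

text \<open>On \<open>U + WR\<close>, with \<open>U\<close> the next limit ideal and
  \<open>W\<close> the product, the rule sending \<open>i + r * W\<close> to \<open>r e\<close> is
  well defined by \<open>limit_ideal_colon\<close>. Injectivity of \<open>E\<close> extends it to R,
  and \<open>e'\<close> is the value at 1.\<close>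

lemma extend:
  assumes e: "e \<in> mcar E" "limit_ideal n \<subseteq> ann E e"
  shows "\<exists>e'\<in>mcar E. limit_ideal (Suc n) \<subseteq> ann E e' \<and> msmul E (prod_list ws) e' = e"
proof -
  let ?U = "limit_ideal (Suc n)" and ?W = "prod_list ws"
  note U = limit_ideal_ideal[of "Suc n"]
  define g where "g a = msmul E (SOME r. a - r * ?W \<in> ?U) e" for a
  have g: "g a = msmul E r e" if "a - r * ?W \<in> ?U" for a r
  proof -
    define s where "s = (SOME r. a - r * ?W \<in> ?U)"
    have "a - s * ?W \<in> ?U" unfolding s_def by (rule someI[of "\<lambda>r. a - r * ?W \<in> ?U", OF that])
    from cideal_diff[OF U that this] have "?W * (s - r) \<in> ?U" by (simp add: algebra_simps)
    then have "s - r \<in> limit_ideal n" using limit_ideal_colon[of n] unfolding colon_def by blast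
    then show ?thesis using rmodule_smul_eq_iff[OF E_module e(1)] e(2) unfolding g_def s_def by blast
  qed
  have rep: "\<exists>r. a - r * ?W \<in> ?U" if a: "a \<in> adj ?U ?W" for a
  proof -
    obtain i r where "i \<in> ?U" "a = i + r * ?W" using a unfolding adj_def by blast
    then show ?thesis by (intro exI[of _ r]) simp
  qed
  have "\<exists>e'\<in>mcar E. \<forall>a\<in>adj ?U ?W. g a = msmul E a e'"
  proof (rule E_baer[OF adj_ideal[OF U]])
    show "g a \<in> mcar E" if "a \<in> adj ?U ?W" for a
      unfolding g_def by (rule rmodule_smul[OF E_module e(1)])
    fix a assume a: "a \<in> adj ?U ?W"
    then obtain r where r: "a - r * ?W \<in> ?U" using rep by blast
    { fix b assume "b \<in> adj ?U ?W"
      then obtain s where s: "b - s * ?W \<in> ?U" using rep by blast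
      have "(a + b) - (r + s) * ?W \<in> ?U" using cideal_add[OF U r s] by (simp add: algebra_simps)
      then show "g (a + b) = madd E (g a) (g b)"
        using g[OF r] g[OF s] g rmodule_add_smul[OF E_module e(1)] by metis }
    fix t
    have "t * a - (t * r) * ?W \<in> ?U" using cideal_mult[OF U r, of t] by (simp add: algebra_simps)
    then show "g (t * a) = msmul E t (g a)"
      using g[OF r] g rmodule_mult_smul[OF E_module e(1)] by metis
  qed
  then obtain e' where e': "e' \<in> mcar E" "\<And>a. a \<in> adj ?U ?W \<Longrightarrow> g a = msmul E a e'" by blast
  have "msmul E a e' = mzero E" if "a \<in> ?U" for a
    using e'(2)[of a] g[of a 0] that subset_adj[of ?U ?W] rmodule_zero_smul[OF E_module e(1)] by auto
  moreover have "msmul E ?W e' = e"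
    using e'(2)[OF mem_adj[OF U]] g[of ?W 1] cideal_zero[OF U] rmodule_one[OF E_module e(1)] by simp
  ultimately show ?thesis using e'(1) by (auto simp: ann_def)
qed

text \<open>A sequence in \<open>E\<close> of this kind is a homomorphism from the top local cohomology of \<open>R/P\<close>
  to \<open>E\<close>: its \<open>n\<close>-th term is the image of \<open>1 / (prod_list ws)^n\<close>.\<close>

definition dual_seq :: "(nat \<Rightarrow> 'e) \<Rightarrow> bool" where
  "dual_seq e \<longleftrightarrow> (\<forall>n. e n \<in> mcar E) \<and> (\<forall>n. msmul E (prod_list ws) (e (Suc n)) = e n) \<and>
    (\<forall>n. power_ideal n \<subseteq> ann E (e n))"

text \<open>At a stage \<open>N\<close> with proper limit ideal, the element \<open>e0\<close> with
  annihilator \<open>m\<close> is admissible. Later terms come from \<open>extend\<close> by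
  dependent choice, earlier ones from multiplication by the product.\<close>

lemma dual_seq_exists: "\<exists>e. dual_seq e \<and> (\<exists>n. e n \<noteq> mzero E)"
proof -
  have "\<not> vanishes ws (length ws) P"
    by (rule top_not_vanishing[OF quot_dim_has_chain(1)[OF P_prime dim]])
  then obtain N where N: "1 \<notin> limit_ideal N" using limit_ideal_proper by blast
  obtain e0 where e0: "e0 \<in> mcar E" "ann E e0 = m" using E unfolding inj_hull_residue_def by blast
  have "\<exists>f. \<forall>k. (f k \<in> mcar E \<and> limit_ideal (N + k) \<subseteq> ann E (f k)) \<and>
      (k = 0 \<longrightarrow> f k = e0) \<and> msmul E (prod_list ws) (f (Suc k)) = f k"
  proof -
    let ?A = "\<lambda>k x. x \<in> mcar E \<and> limit_ideal (N + k) \<subseteq> ann E x \<and> (k = 0 \<longrightarrow> x = e0)"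
    have "?A 0 e0"
      using e0 proper_subset_m[OF limit_ideal_ideal N] by simp
    moreover have "\<exists>y. ?A (Suc k) y \<and> msmul E (prod_list ws) y = x" if "?A k x" for k x
      using extend[of x "N + k"] that by auto
    ultimately obtain f where "\<And>k. ?A k (f k)" "\<And>k. msmul E (prod_list ws) (f (Suc k)) = f k"
      using dependent_nat_choice[of ?A "\<lambda>_ x y. msmul E (prod_list ws) y = x"] by metis
    then show ?thesis by blast
  qed
  then obtain f where f: "\<And>k. f k \<in> mcar E" "\<And>k. limit_ideal (N + k) \<subseteq> ann E (f k)" "f 0 = e0"
    "\<And>k. msmul E (prod_list ws) (f (Suc k)) = f k" by blast
  define e where "e n = (if n \<ge> N then f (n - N) else msmul E (prod_list ws ^ (N - n)) e0)" for n
  have car: "e n \<in> mcar E" for n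
    unfolding e_def using f(1) rmodule_smul[OF E_module e0(1)] by simp
  have comp: "msmul E (prod_list ws) (e (Suc n)) = e n" for n
  proof (cases "n \<ge> N")
    case True
    then show ?thesis using f(4)[of "n - N"] by (simp add: e_def Suc_diff_le)
  next
    case False
    then have "N - n = Suc (N - Suc n)" by simp
    then have "msmul E (prod_list ws) (msmul E (prod_list ws ^ (N - Suc n)) e0) = e n"
      using False rmodule_mult_smul[OF E_module e0(1), of "prod_list ws" "prod_list ws ^ (N - Suc n)"]
      by (simp add: e_def)
    moreover have "e (Suc n) = msmul E (prod_list ws ^ (N - Suc n)) e0"
      using False f(3) rmodule_one[OF E_module e0(1)] by (cases "Suc n = N") (auto simp: e_def)
    ultimately show ?thesis by simp
  qed
  have "power_ideal n \<subseteq> ann E (e n)" for n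
  proof (cases "n \<ge> N")
    case True
    then show ?thesis using f(2)[of "n - N"] power_ideal_subset[of n] by (auto simp: e_def)
  next
    case False
    have "power_ideal n \<subseteq> colon (ann E e0) (prod_list ws ^ (N - n))"
      using power_ideal_steps[of _ n "N - n"] power_ideal_subset[of N] f(2)[of 0] f(3) False
      by (auto simp: colon_def)
    then show ?thesis using False by (simp add: e_def ann_smul[OF E_module e0(1)])
  qed
  then have "dual_seq e" unfolding dual_seq_def using car comp by blast
  moreover have "e N \<noteq> mzero E"
    using e0 prime_one[OF m_prime] rmodule_one[OF E_module e0(1)] f(3) by (auto simp: e_def ann_def)
  ultimately show ?thesis by blast
qed

lemma dual_seq_carrier: "dual_seq e \<Longrightarrow> e n \<in> mcar E"
  by (simp add: dual_seq_def)

lemma dual_seq_shift: "dual_seq e \<Longrightarrow> msmul E (prod_list ws ^ t) (e (n + t)) = e n"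
proof (induction t)
  case 0
  then show ?case using rmodule_one[OF E_module dual_seq_carrier] by simp
next
  case (Suc t)
  have "msmul E (prod_list ws ^ Suc t) (e (n + Suc t))
      = msmul E (prod_list ws ^ t) (msmul E (prod_list ws) (e (Suc (n + t))))"
    using rmodule_mult_smul[OF E_module dual_seq_carrier[OF Suc.prems], of "prod_list ws ^ t"]
    by (simp add: mult.commute[of "prod_list ws"])
  then show ?case using Suc unfolding dual_seq_def by simp
qed

lemma dual_seq_ann: "dual_seq e \<Longrightarrow> ann E (e n) = colon (ann E (e (n + t))) (prod_list ws ^ t)"
  using ann_smul[OF E_module dual_seq_carrier] dual_seq_shift by metis

lemma dual_seq_scale:
  assumes e: "dual_seq e"
  shows "dual_seq (\<lambda>n. msmul E r (e n))"
  unfolding dual_seq_def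
proof (intro conjI allI)
  note car = dual_seq_carrier[OF e]
  show "msmul E r (e n) \<in> mcar E" for n by (rule rmodule_smul[OF E_module car])
  show "msmul E (prod_list ws) (msmul E r (e (Suc n))) = msmul E r (e n)" for n
    using e rmodule_mult_smul[OF E_module car] unfolding dual_seq_def by (metis mult.commute)
  show "power_ideal n \<subseteq> ann E (msmul E r (e n))" for n
    using e subset_colon[OF ann_ideal[OF E_module car]] ann_smul[OF E_module car]
    unfolding dual_seq_def by blast
qed

text \<open>Were the class of 1 / W^n zero modulo \<open>Q\<close> at stage \<open>N\<close>, a
  power W^t with \<open>N = n + t\<close> would lie in the sum of \<open>Q\<close> and the power
  ideal of stage \<open>N\<close>, both of which kill \<open>e N\<close>; but W^t carries
  \<open>e N\<close> to \<open>e n\<close>.\<close>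

lemma dual_seq_nonvanishing:
  assumes e: "dual_seq e" "e n \<noteq> mzero E" and Q: "cideal Q" "\<And>n. Q \<subseteq> ann E (e n)"
  shows "\<not> vanishes ws (length ws) Q"
proof
  assume v: "vanishes ws (length ws) Q"
  let ?T = "replicate (length ws) True"
  define c where "c l = (if l = ?T then 1 else (0 :: 'a))" for l
  have cnt: "count_list ?T True = length ws" by (induction ws) auto
  have cc: "cochain ws (length ws) c" unfolding cochain_def c_def using cnt by auto
  then have "cochain ws (Suc (length ws)) (kd n ws c)"
    by (intro cochain_kd) (simp add: precochain_Suc)
  then have "kd n ws c l = 0" for l
    using cnt cochain_top[of ws "Suc (length ws)" "kd n ws c" l] unfolding cochain_def by fastforce
  then have "germ ws n c \<in> cocycles ws (length ws) Q"
    using cideal_zero[OF Q(1)] by (intro germ_cocycle[OF Q(1) cc]) simp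
  then have "germ ws n c \<in> coboundaries ws (length ws) Q" using v unfolding vanishes_def by blast
  from coboundaryD[OF this, of n] obtain N b
    where N: "N \<ge> n" "germ ws n c N ?T - kd N ws b ?T \<in> Q" by blast
  obtain t where t: "N = n + t" using le_Suc_ex[OF N(1)] by blast
  note A = ann_ideal[OF E_module dual_seq_carrier[OF e(1)]]
  have "kd N ws b ?T \<in> power_ideal N"
    using kd_top_mem[of N ws b] gen_ideal_mono[of "(\<lambda>w. w ^ N) ` set ws"] by blast
  then have "kd N ws b ?T \<in> ann E (e N)" using e(1) unfolding dual_seq_def by blast
  then have "germ ws n c N ?T \<in> ann E (e N)" using N(2) Q(2) cideal_eqD[OF A] by blast
  then have "prod_list ws ^ t \<in> ann E (e (n + t))" unfolding t germ_later by (simp add: c_def)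
  then have "e n = mzero E" using dual_seq_shift[OF e(1), of t n] by (simp add: ann_def)
  then show False using e(2) by blast
qed

lemma dual_seq_annihilator: "\<exists>e. dual_seq e \<and> (\<Inter>n. ann E (e n)) = P"
proof -
  let ?A = "\<lambda>e. \<Inter>n. ann E (e n)"
  have A: "cideal (?A e)" if "dual_seq e" for e
    by (rule cideal_INT) (rule ann_ideal[OF E_module dual_seq_carrier[OF that]])
  define S where "S = {?A e | e. dual_seq e \<and> (\<exists>n. e n \<noteq> mzero E)}"
  obtain e1 where "dual_seq e1 \<and> (\<exists>n. e1 n \<noteq> mzero E)" using dual_seq_exists by blast
  then have ne: "?A e1 \<in> S" unfolding S_def by blast
  have "\<exists>Q\<in>S. \<forall>J. (J, Q) \<in> {(J, I). cideal I \<and> cideal J \<and> I \<subset> J} \<longrightarrow> J \<notin> S"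
    by (rule ideal_wf[unfolded wf_eq_minimal, rule_format, OF ne])
  then obtain Q where Q: "Q \<in> S" "\<And>J. cideal Q \<Longrightarrow> cideal J \<Longrightarrow> Q \<subset> J \<Longrightarrow> J \<notin> S"
    by auto
  then obtain e where e: "Q = ?A e" "dual_seq e" "\<exists>n. e n \<noteq> mzero E" unfolding S_def by blast
  note car = dual_seq_carrier[OF e(2)]
  have QI: "cideal Q" unfolding e(1) by (rule A[OF e(2)])
  have "1 \<notin> Q" using e rmodule_one[OF E_module car] by (auto simp: ann_def)
  moreover have "b \<in> Q" if ab: "a * b \<in> Q" "a \<notin> Q" for a b
  proof -
    \<comment> \<open>Multiplying by \<open>a\<close> outside \<open>Q\<close> keeps the sequence
      nonzero and can only enlarge the common annihilator. By maximality it is unchanged, and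
      \<open>b\<close> belongs to it.\<close>
    define e' where "e' n = msmul E a (e n)" for n
    have e': "dual_seq e'" unfolding e'_def by (rule dual_seq_scale[OF e(2)])
    have ann': "ann E (e' n) = colon (ann E (e n)) a" for n
      unfolding e'_def by (rule ann_smul[OF E_module car])
    have "\<exists>n. e' n \<noteq> mzero E" using ab(2) unfolding e(1) e'_def ann_def by blast
    then have S: "?A e' \<in> S" using e' unfolding S_def by blast
    have "Q \<subseteq> ?A e'"
      unfolding e(1) ann' using subset_colon[OF ann_ideal[OF E_module car]] by blast
    then have "Q = ?A e'" using Q(2)[of "?A e'"] S QI A[OF e'] by blast
    moreover have "b \<in> ?A e'" using ab(1) unfolding ann' e(1) colon_def by blast
    ultimately show ?thesis by simp
  qed
  ultimately have prime: "prime_ideal Q" using QI unfolding prime_ideal_def by blast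
  have PQ: "P \<subseteq> Q"
    unfolding e(1) using e(2) gen_ideal_superset unfolding dual_seq_def by blast
  obtain n where "e n \<noteq> mzero E" using e(3) by blast
  then have "\<not> vanishes ws (length ws) Q"
    using dual_seq_nonvanishing[OF e(2) _ QI] unfolding e(1) by blast
  then have "has_chain (length ws) Q" by (rule not_vanishes_has_chain[OF prime])
  \<comment> \<open>A strict inclusion would prolong the chain above \<open>Q\<close> beyond dim
    R/P.\<close>
  then have "\<not> P \<subset> Q" using quot_dim_has_chain(2)[OF P_prime dim] P_prime by auto
  then show ?thesis using PQ e(1,2) by blast
qed

end

section \<open>The lacunary series for part of the parameters\<close>

context matlis
begin

text \<open>For a proper initial part \<open>ys\<close> of the system of parameters \<open>ws = ys @ zs\<close>, restricting
  \<open>e\<close> to the fractions with a fixed power of \<open>zs\<close> in the denominator gives elements of the dual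
  for \<open>ys\<close> that are killed by powers of \<open>zs\<close>. Their sum with coefficients \<open>y1^(j^2)\<close>
  (where \<open>y1 = hd ys\<close>), using the denominators \<open>(prod_list zs)^(j^2)\<close>, converges and, since the
  gaps between squares are unbounded, has the same annihilator as \<open>e\<close>.\<close>

lemma dual_seq_part:
  assumes ws: "ws = ys @ zs" and ys: "ys \<noteq> []"
  shows "\<exists>g. (\<forall>n. g n \<in> mcar E) \<and> (\<forall>n. msmul E (prod_list ys) (g (Suc n)) = g n) \<and>
    (\<forall>n. \<forall>y\<in>set ys. y ^ n \<in> ann E (g n)) \<and> (\<Inter>n. ann E (g n)) = P"
proof -
  obtain e where e: "dual_seq e" "(\<Inter>n. ann E (e n)) = P" using dual_seq_annihilator by blast
  note car = dual_seq_carrier[OF e(1)]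
  note A = ann_ideal[OF E_module car]
  have pow: "w ^ n \<in> ann E (e n)" if "w \<in> set ws" for w n
    using e(1) that gen_ideal_superset[of "P \<union> (\<lambda>w. w ^ n) ` set ws"] unfolding dual_seq_def by blast
  have powd: "a \<in> ann E (e n)" if "w \<in> set ws" "w ^ n dvd a" for w n a
    using pow[OF that(1)] that(2) cideal_mult2[OF A] by (auto elim!: dvdE)
  show ?thesis
  proof (cases "zs = []")
    case True
    have "msmul E (prod_list ws) (e (Suc n)) = e n" for n using e(1) unfolding dual_seq_def by blast
    then show ?thesis
      using True e(2) pow car unfolding ws by (intro exI[of _ e] conjI allI ballI) auto
  next
    case False
    define Y Z y z where "Y = prod_list ys" and "Z = prod_list zs" and "y = hd ys" and "z = hd zs"
    have W: "prod_list ws = Y * Z" unfolding ws Y_def Z_def by simp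
    have yz: "y \<in> set ws" "z \<in> set ws" unfolding ws y_def z_def using ys False by auto
    have yY: "y dvd Y" and zZ: "z dvd Z"
      unfolding Y_def Z_def y_def z_def using ys False by (auto intro: prod_list_dvd)
    \<comment> \<open>\<open>C n N\<close> times \<open>e N\<close> is the value of \<open>e\<close>
      at the sum of y^(j^2) / (Y^n Z^(j^2)) over \<open>j < n\<close>, written with denominator (Y
      Z)^N. Further terms of the series are zero, since y^(j^2) is a multiple of y^n for
      \<open>j \<ge> n\<close>.\<close>
    define C where "C n N = (\<Sum>j<n. y ^ j\<^sup>2 * Y ^ (N - n) * Z ^ (N - j\<^sup>2))" for n N
    \<comment> \<open>Large enough for the subtractions in \<open>C n N\<close> to be exact whenever
      \<open>N \<ge> K n\<close>.\<close>
    define K where "K n = n\<^sup>2 + n" for n :: nat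
    define g where "g n = msmul E (C n (K n)) (e (K n))" for n
    have shift: "g n = msmul E (C n N) (e N)" if N: "K n \<le> N" for n N
    proof -
      obtain t where t: "N = K n + t" using le_Suc_ex[OF N] by blast
      have "C n N = C n (K n) * prod_list ws ^ t"
        unfolding C_def sum_distrib_right
      proof (rule sum.cong[OF refl])
        fix j assume "j \<in> {..<n}"
        then have "j\<^sup>2 \<le> n\<^sup>2" by (simp add: power_mono)
        then have "N - n = (K n - n) + t" "N - j\<^sup>2 = (K n - j\<^sup>2) + t" unfolding t K_def by linarith+
        then show "y ^ j\<^sup>2 * Y ^ (N - n) * Z ^ (N - j\<^sup>2)
          = y ^ j\<^sup>2 * Y ^ (K n - n) * Z ^ (K n - j\<^sup>2) * prod_list ws ^ t"
          unfolding W by (simp add: power_add power_mult_distrib ac_simps)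
      qed
      then show ?thesis
        using rmodule_mult_smul[OF E_module car] dual_seq_shift[OF e(1), of t "K n"]
        unfolding g_def t by simp
    qed
    have gann: "ann E (g n) = colon (ann E (e N)) (C n N)" if "K n \<le> N" for n N
      unfolding shift[OF that] by (rule ann_smul[OF E_module car])
    have "g n \<in> mcar E" for n unfolding g_def by (rule rmodule_smul[OF E_module car])
    moreover have "msmul E (prod_list ys) (g (Suc n)) = g n" for n
    proof -
      define N where "N = K (Suc n)"
      have nN: "Suc n \<le> N" "n\<^sup>2 \<le> N" "K n \<le> N" unfolding N_def K_def by (auto simp: power2_eq_square)
      have "Y * C (Suc n) N = (\<Sum>j<Suc n. y ^ j\<^sup>2 * Y ^ (N - n) * Z ^ (N - j\<^sup>2))"
        unfolding C_def sum_distrib_left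
      proof (rule sum.cong[OF refl])
        fix j
        have "N - n = Suc (N - Suc n)" using nN by simp
        then show "Y * (y ^ j\<^sup>2 * Y ^ (N - Suc n) * Z ^ (N - j\<^sup>2)) = y ^ j\<^sup>2 * Y ^ (N - n) * Z ^ (N - j\<^sup>2)"
          by (simp add: ac_simps)
      qed
      then have "Y * C (Suc n) N - C n N = y ^ n\<^sup>2 * Y ^ (N - n) * Z ^ (N - n\<^sup>2)"
        unfolding C_def by simp
      moreover have "\<dots> \<in> ann E (e N)"
      proof (rule powd[OF yz(1)])
        have "n \<le> n\<^sup>2" by (simp add: power2_eq_square)
        then have "N \<le> n\<^sup>2 + (N - n)" by linarith
        then have "y ^ N dvd y ^ n\<^sup>2 * y ^ (N - n)" unfolding power_add[symmetric] by (rule le_imp_power_dvd)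
        also have "\<dots> dvd y ^ n\<^sup>2 * Y ^ (N - n)" by (intro mult_dvd_mono dvd_power_same yY dvd_refl)
        finally show "y ^ N dvd y ^ n\<^sup>2 * Y ^ (N - n) * Z ^ (N - n\<^sup>2)" by (rule dvd_mult2)
      qed
      ultimately have "msmul E (Y * C (Suc n) N) (e N) = msmul E (C n N) (e N)"
        using rmodule_smul_eq_iff[OF E_module car] by simp
      then show ?thesis
        using shift[of "Suc n" N] shift[OF nN(3)] rmodule_mult_smul[OF E_module car]
        unfolding N_def Y_def by simp
    qed
    moreover have "x ^ n \<in> ann E (g n)" if x: "x \<in> set ys" for x n
    proof -
      have "C n (K n) * x ^ n \<in> ann E (e (K n))"
        unfolding C_def sum_distrib_right
      proof (rule cideal_sum[OF A], rule powd)
        show "x \<in> set ws" using x unfolding ws by simp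
        fix j
        have "K n = (K n - n) + n" unfolding K_def by simp
        then have "x ^ K n = x ^ (K n - n) * x ^ n" by (metis power_add)
        also have "\<dots> dvd Y ^ (K n - n) * x ^ n"
          unfolding Y_def by (intro mult_dvd_mono dvd_power_same prod_list_dvd x dvd_refl)
        also have "\<dots> dvd y ^ j\<^sup>2 * Z ^ (K n - j\<^sup>2) * (Y ^ (K n - n) * x ^ n)" by (rule dvd_triv_right)
        also have "\<dots> = y ^ j\<^sup>2 * Y ^ (K n - n) * Z ^ (K n - j\<^sup>2) * x ^ n" by (simp only: ac_simps)
        finally show "x ^ K n dvd y ^ j\<^sup>2 * Y ^ (K n - n) * Z ^ (K n - j\<^sup>2) * x ^ n" .
      qed
      then show ?thesis unfolding gann[OF order_refl] colon_def by simp
    qed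
    moreover have "(\<Inter>n. ann E (g n)) = P"
    proof
      have "P \<subseteq> ann E (g n)" for n
        unfolding gann[OF order_refl] using e(2) subset_colon[OF A] by blast
      then show "P \<subseteq> (\<Inter>n. ann E (g n))" by blast
      show "(\<Inter>n. ann E (g n)) \<subseteq> P"
      proof
        fix r assume r: "r \<in> (\<Inter>n. ann E (g n))"
        have key: "r \<in> ann E (e (2 * k + 1))" for k
        proof -
          \<comment> \<open>Multiplication by z^(k^2) isolates the term \<open>j = k + 1\<close>:
            terms with \<open>i < j\<close> acquire z^N since i^2 \<le> k^2, and terms with
            \<open>i > j\<close> contain y^N since i^2 \<ge> (j + 1)^2 = n. As j^2 - k^2 = 2 k + 1
            and n - (2 k + 1) = j^2 + 2, a multiple of the remaining term is r (Y Z)^(N - (2 k +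
            1)), whose action on \<open>e N\<close> is that of \<open>r\<close> on
            \<open>e (2 * k + 1)\<close>.\<close>
          define j n N where "j = Suc k" and "n = (j + 1)\<^sup>2" and "N = K n + (2 * k + 1)"
          have jn: "j < n" unfolding n_def by (simp add: power2_eq_square)
          have jN: "j\<^sup>2 \<le> N" "n \<le> N" "K n \<le> N" "2 * k + 1 \<le> N"
            unfolding N_def K_def n_def by (auto simp: power2_eq_square)
          define T where "T i = r * z ^ k\<^sup>2 * (y ^ i\<^sup>2 * Y ^ (N - n) * Z ^ (N - i\<^sup>2))" for i
          have "C n N * r \<in> ann E (e N)" using r gann[OF jN(3)] unfolding colon_def by blast
          from cideal_mult[OF A this, of "z ^ k\<^sup>2"]
          have "r * z ^ k\<^sup>2 * C n N \<in> ann E (e N)" by (simp only: ac_simps)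
          then have "(\<Sum>i<n. T i) \<in> ann E (e N)" unfolding C_def T_def sum_distrib_left .
          moreover have "(\<Sum>i<n. T i) = T j + (\<Sum>i\<in>{..<n} - {j}. T i)"
            by (rule sum.remove) (use jn in auto)
          moreover have "T i \<in> ann E (e N)" if i: "i \<in> {..<n} - {j}" for i
          proof (cases "i < j")
            case True
            then have "i\<^sup>2 \<le> k\<^sup>2" unfolding j_def by (intro power_mono) auto
            then have "N \<le> k\<^sup>2 + (N - i\<^sup>2)" by linarith
            then have "z ^ N dvd z ^ k\<^sup>2 * z ^ (N - i\<^sup>2)" unfolding power_add[symmetric] by (rule le_imp_power_dvd)
            also have "\<dots> dvd z ^ k\<^sup>2 * Z ^ (N - i\<^sup>2)" by (intro mult_dvd_mono dvd_power_same zZ dvd_refl)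
            also have "\<dots> dvd r * (y ^ i\<^sup>2 * Y ^ (N - n)) * (z ^ k\<^sup>2 * Z ^ (N - i\<^sup>2))" by (rule dvd_triv_right)
            also have "\<dots> = T i" unfolding T_def by (simp only: ac_simps)
            finally show ?thesis by (rule powd[OF yz(2)])
          next
            case False
            then have "j + 1 \<le> i" using i by simp
            then have "n \<le> i\<^sup>2" unfolding n_def by (intro power_mono) auto
            then have "N \<le> i\<^sup>2 + (N - n)" by linarith
            then have "y ^ N dvd y ^ i\<^sup>2 * y ^ (N - n)" unfolding power_add[symmetric] by (rule le_imp_power_dvd)
            also have "\<dots> dvd y ^ i\<^sup>2 * Y ^ (N - n)" by (intro mult_dvd_mono dvd_power_same yY dvd_refl)
            also have "\<dots> dvd r * z ^ k\<^sup>2 * Z ^ (N - i\<^sup>2) * (y ^ i\<^sup>2 * Y ^ (N - n))" by (rule dvd_triv_right)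
            also have "\<dots> = T i" unfolding T_def by (simp only: ac_simps)
            finally show ?thesis by (rule powd[OF yz(1)])
          qed
          ultimately have Tj: "T j \<in> ann E (e N)"
            using cideal_sum[OF A, of "{..<n} - {j}" T] cideal_diff[OF A] by (metis add_diff_cancel_right')
          have "y ^ j\<^sup>2 dvd Y ^ (n - (2 * k + 1))"
          proof -
            have "j\<^sup>2 \<le> n - (2 * k + 1)" unfolding n_def j_def by (auto simp: power2_eq_square)
            then have "y ^ j\<^sup>2 dvd y ^ (n - (2 * k + 1))" by (rule le_imp_power_dvd)
            then show ?thesis using dvd_power_same[OF yY] by (rule dvd_trans)
          qed
          then obtain v where v: "Y ^ (n - (2 * k + 1)) = y ^ j\<^sup>2 * v" by (auto elim: dvdE)
          obtain u where u: "Z ^ k\<^sup>2 = z ^ k\<^sup>2 * u" using dvd_power_same[OF zZ, of "k\<^sup>2"] by (auto elim: dvdE)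
          have eqs: "N - (2 * k + 1) = (n - (2 * k + 1)) + (N - n)" "N - (2 * k + 1) = k\<^sup>2 + (N - j\<^sup>2)"
            using jN unfolding n_def j_def by (auto simp: power2_eq_square)
          have "Y ^ (N - (2 * k + 1)) = y ^ j\<^sup>2 * v * Y ^ (N - n)"
            unfolding eqs(1) power_add v ..
          moreover have "Z ^ (N - (2 * k + 1)) = z ^ k\<^sup>2 * u * Z ^ (N - j\<^sup>2)"
            unfolding eqs(2) power_add u ..
          ultimately have "prod_list ws ^ (N - (2 * k + 1)) * r = v * u * T j"
            unfolding W power_mult_distrib T_def by (simp only: ac_simps)
          then have "r \<in> colon (ann E (e N)) (prod_list ws ^ (N - (2 * k + 1)))"
            using cideal_mult[OF A Tj, of "v * u"] unfolding colon_def by simp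
          then show ?thesis
            using dual_seq_ann[OF e(1), of "2 * k + 1" "N - (2 * k + 1)"] jN(4) by simp
        qed
        \<comment> \<open>The annihilators decrease with the stage, and 2 k + 1 \<ge> k.\<close>
        have "r \<in> ann E (e k)" for k
        proof -
          have "ann E (e (2 * k + 1)) \<subseteq> ann E (e k)"
            using dual_seq_ann[OF e(1), of k "k + 1"] subset_colon[OF A]
            by (simp add: mult_2 add.assoc)
          then show ?thesis using key by blast
        qed
        then show "r \<in> P" using e(2) by blast
      qed
    qed
    ultimately show ?thesis by blast
  qed
qed

end

section \<open>Translation to Cech cohomology\<close>

lemma loc_rel_iff: "((r, k), (s, l)) \<in> loc_rel f \<longleftrightarrow> (\<exists>n. f ^ n * (r * f ^ l - s * f ^ k) = 0)"
  by (simp add: loc_rel_def)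

lemma loc_rel_equiv: "equiv UNIV (loc_rel f)"
proof (rule equivI)
  show "refl (loc_rel f)" by (auto simp: refl_on_def loc_rel_iff)
  show "sym (loc_rel f)"
  proof (rule symI, clarify)
    fix r k s l assume "((r, k), (s, l)) \<in> loc_rel f"
    then obtain n where "f ^ n * (r * f ^ l - s * f ^ k) = 0" by (auto simp: loc_rel_iff)
    then have "f ^ n * (s * f ^ k - r * f ^ l) = 0" by (simp add: algebra_simps)
    then show "((s, l), (r, k)) \<in> loc_rel f" by (auto simp: loc_rel_iff)
  qed
  show "trans (loc_rel f)"
  proof (rule transI, clarify)
    fix r k s l t j assume "((r, k), (s, l)) \<in> loc_rel f" "((s, l), (t, j)) \<in> loc_rel f"
    then obtain n n' where n: "f ^ n * (r * f ^ l - s * f ^ k) = 0" "f ^ n' * (s * f ^ j - t * f ^ l) = 0"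
      by (auto simp: loc_rel_iff)
    have "f ^ (n + n' + l) * (r * f ^ j - t * f ^ k)
      = f ^ n' * f ^ j * (f ^ n * (r * f ^ l - s * f ^ k)) + f ^ n * f ^ k * (f ^ n' * (s * f ^ j - t * f ^ l))"
      by (simp add: algebra_simps power_add)
    then have "f ^ (n + n' + l) * (r * f ^ j - t * f ^ k) = 0" using n by simp
    then show "((r, k), (t, j)) \<in> loc_rel f" unfolding loc_rel_iff by blast
  qed
qed (auto simp: loc_rel_def)

lemma lcls_eq_iff: "lcls f q = lcls f q' \<longleftrightarrow> (q, q') \<in> loc_rel f"
  unfolding lcls_def by (rule eq_equiv_class_iff[OF loc_rel_equiv]) auto

lemma lcls_mem_iff: "q' \<in> lcls f q \<longleftrightarrow> (q, q') \<in> loc_rel f"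
  by (auto simp: lcls_def)

lemma lcls_self: "q \<in> lcls f q"
  unfolding lcls_mem_iff lcls_eq_iff[symmetric] ..

lemma lcls_eqI: "f ^ n * (r * f ^ l - s * f ^ k) = 0 \<Longrightarrow> lcls f (r, k) = lcls f (s, l)"
  unfolding lcls_eq_iff loc_rel_iff by blast

lemma Union_lcls_eq:
  assumes "X \<noteq> {}" "\<And>A. A \<in> X \<Longrightarrow> A = B"
  shows "\<Union>X = B"
  using assms by auto

lemma loc_add: "madd (loc_mod f) (lcls f (r, k)) (lcls f (s, l)) = lcls f (r * f ^ l + s * f ^ k, k + l)"
  unfolding loc_mod_def rmod.simps
proof (rule Union_lcls_eq)
  show "{lcls f (r' * f ^ l' + s' * f ^ k', k' + l') | r' k' s' l'.
      (r', k') \<in> lcls f (r, k) \<and> (s', l') \<in> lcls f (s, l)} \<noteq> {}"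
    using lcls_self by blast
  fix A assume "A \<in> {lcls f (r' * f ^ l' + s' * f ^ k', k' + l') | r' k' s' l'.
      (r', k') \<in> lcls f (r, k) \<and> (s', l') \<in> lcls f (s, l)}"
  then obtain r' k' s' l' where A: "A = lcls f (r' * f ^ l' + s' * f ^ k', k' + l')"
    "((r, k), (r', k')) \<in> loc_rel f" "((s, l), (s', l')) \<in> loc_rel f" by (auto simp: lcls_mem_iff)
  then obtain n n' where n: "f ^ n * (r * f ^ k' - r' * f ^ k) = 0" "f ^ n' * (s * f ^ l' - s' * f ^ l) = 0"
    by (auto simp: loc_rel_iff)
  have "f ^ (n + n') * ((r' * f ^ l' + s' * f ^ k') * f ^ (k + l) - (r * f ^ l + s * f ^ k) * f ^ (k' + l'))
    = - (f ^ n' * f ^ l * f ^ l' * (f ^ n * (r * f ^ k' - r' * f ^ k)))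
      - (f ^ n * f ^ k * f ^ k' * (f ^ n' * (s * f ^ l' - s' * f ^ l)))"
    by (simp add: algebra_simps power_add)
  then show "A = lcls f (r * f ^ l + s * f ^ k, k + l)" unfolding A(1) using n by (intro lcls_eqI) simp
qed

lemma loc_smul: "msmul (loc_mod f) a (lcls f (r, k)) = lcls f (a * r, k)"
  unfolding loc_mod_def rmod.simps
proof (rule Union_lcls_eq)
  show "{lcls f (a * r', k') | r' k'. (r', k') \<in> lcls f (r, k)} \<noteq> {}" using lcls_self by blast
  fix A assume "A \<in> {lcls f (a * r', k') | r' k'. (r', k') \<in> lcls f (r, k)}"
  then obtain r' k' n where A: "A = lcls f (a * r', k')" "f ^ n * (r * f ^ k' - r' * f ^ k) = 0"
    by (auto simp: lcls_mem_iff loc_rel_iff)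
  have "f ^ n * (a * r' * f ^ k - a * r * f ^ k') = - (a * (f ^ n * (r * f ^ k' - r' * f ^ k)))"
    by (simp add: algebra_simps)
  then show "A = lcls f (a * r, k)" unfolding A(1) using A(2) by (intro lcls_eqI) simp
qed

lemma loc_carE:
  assumes "A \<in> mcar (loc_mod f)"
  obtains r k where "A = lcls f (r, k)"
  using assms unfolding loc_mod_def by auto

lemma loc_carI: "lcls f q \<in> mcar (loc_mod f)"
  by (simp add: loc_mod_def)

lemma loc_zero: "mzero (loc_mod f) = lcls f (0, 0)"
  by (simp add: loc_mod_def)

lemma loc_module: "rmodule (loc_mod f)"
  unfolding rmodule_def
proof (intro conjI ballI allI)
  let ?L = "loc_mod f"
  show "mzero ?L \<in> mcar ?L" by (simp add: loc_zero loc_carI)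
  fix x assume "x \<in> mcar ?L"
  then obtain r k where x: "x = lcls f (r, k)" by (rule loc_carE)
  show "madd ?L (mzero ?L) x = x" unfolding x loc_zero loc_add by simp
  have "madd ?L x (lcls f (- r, k)) = mzero ?L"
    unfolding x loc_zero loc_add by (rule lcls_eqI[where n = 0]) simp
  then show "\<exists>y\<in>mcar ?L. madd ?L x y = mzero ?L" using loc_carI by blast
  show "msmul ?L 1 x = x" unfolding x loc_smul by simp
  fix a
  show "msmul ?L a x \<in> mcar ?L" unfolding x loc_smul by (rule loc_carI)
  fix b
  show "msmul ?L (a + b) x = madd ?L (msmul ?L a x) (msmul ?L b x)"
    unfolding x loc_smul loc_add by (rule lcls_eqI[where n = 0]) (simp add: algebra_simps power_add)
  show "msmul ?L (a * b) x = msmul ?L a (msmul ?L b x)"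
    unfolding x loc_smul by (simp add: mult.assoc)
next
  let ?L = "loc_mod f"
  fix x y assume "x \<in> mcar ?L" "y \<in> mcar ?L"
  then obtain r k s l where xy: "x = lcls f (r, k)" "y = lcls f (s, l)" by (metis loc_carE)
  show "madd ?L x y \<in> mcar ?L" unfolding xy loc_add by (rule loc_carI)
  show "madd ?L x y = madd ?L y x" unfolding xy loc_add by (simp add: add.commute)
  show "msmul ?L a (madd ?L x y) = madd ?L (msmul ?L a x) (msmul ?L a y)" for a
    unfolding xy loc_add loc_smul by (simp add: algebra_simps)
  fix z assume "z \<in> mcar ?L"
  then obtain t j where z: "z = lcls f (t, j)" by (rule loc_carE)
  show "madd ?L (madd ?L x y) z = madd ?L x (madd ?L y z)"
    unfolding xy z loc_add by (simp add: algebra_simps power_add)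
qed

lemma cech_carD: "c \<in> mcar (cech_mod xs k) \<Longrightarrow> S \<in> cidx xs k \<Longrightarrow> c S \<in> mcar (loc_mod (xprod xs S))"
  by (simp add: cech_mod_def)

lemma cech_module: "rmodule (cech_mod xs k)"
  unfolding rmodule_def
proof (intro conjI ballI allI)
  let ?C = "cech_mod xs k"
  note L = loc_module
  show "mzero ?C \<in> mcar ?C" by (simp add: cech_mod_def rmodule_zero[OF L])
  fix x assume x: "x \<in> mcar ?C"
  show "madd ?C (mzero ?C) x = x"
    using x by (auto simp: cech_mod_def fun_eq_iff rmodule_add_zero[OF L])
  show "msmul ?C 1 x = x"
    using x by (auto simp: cech_mod_def fun_eq_iff rmodule_one[OF L])
  have "\<forall>S. \<exists>B. S \<in> cidx xs k \<longrightarrow> B \<in> mcar (loc_mod (xprod xs S)) \<and>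
      madd (loc_mod (xprod xs S)) (x S) B = mzero (loc_mod (xprod xs S))"
    using rmodule_inverse[OF L cech_carD[OF x]] by blast
  then obtain y where y: "\<And>S. S \<in> cidx xs k \<Longrightarrow> y S \<in> mcar (loc_mod (xprod xs S)) \<and>
      madd (loc_mod (xprod xs S)) (x S) (y S) = mzero (loc_mod (xprod xs S))" by metis
  define y' where "y' S = (if S \<in> cidx xs k then y S else {})" for S
  have "y' \<in> mcar ?C" "madd ?C x y' = mzero ?C"
    using y by (auto simp: cech_mod_def y'_def fun_eq_iff)
  then show "\<exists>y\<in>mcar ?C. madd ?C x y = mzero ?C" by blast
  fix a
  show "msmul ?C a x \<in> mcar ?C" using x by (simp add: cech_mod_def rmodule_smul[OF L])
  fix b
  show "msmul ?C (a + b) x = madd ?C (msmul ?C a x) (msmul ?C b x)"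
    "msmul ?C (a * b) x = msmul ?C a (msmul ?C b x)"
    using x by (auto simp: cech_mod_def fun_eq_iff rmodule_add_smul[OF L] rmodule_mult_smul[OF L])
next
  let ?C = "cech_mod xs k"
  note L = loc_module
  fix x y assume xy: "x \<in> mcar ?C" "y \<in> mcar ?C"
  show "madd ?C x y \<in> mcar ?C" using xy by (simp add: cech_mod_def rmodule_add[OF L])
  show "madd ?C x y = madd ?C y x"
    using xy by (auto simp: cech_mod_def fun_eq_iff rmodule_comm[OF L])
  show "msmul ?C a (madd ?C x y) = madd ?C (msmul ?C a x) (msmul ?C a y)" for a
    using xy by (auto simp: cech_mod_def fun_eq_iff rmodule_smul_add[OF L])
  fix z assume z: "z \<in> mcar ?C"
  show "madd ?C (madd ?C x y) z = madd ?C x (madd ?C y z)"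
    using xy z by (auto simp: cech_mod_def fun_eq_iff rmodule_assoc[OF L])
qed

lemma xprod_split:
  assumes "finite T" "S \<subseteq> T"
  shows "xprod xs T = xprod xs S * xprod xs (T - S)"
  unfolding xprod_def using prod.subset_diff[OF assms(2,1)] by (metis mult.commute)

lemma lmap_lcls:
  assumes "finite T" "S \<subseteq> T"
  shows "lmap xs S T (lcls (xprod xs S) (r, k)) = lcls (xprod xs T) (r * xprod xs (T - S) ^ k, k)"
  unfolding lmap_def
proof (rule Union_lcls_eq)
  let ?f = "xprod xs S" and ?g = "xprod xs (T - S)" and ?h = "xprod xs T"
  show "{lcls ?h (r' * ?g ^ k', k') | r' k'. (r', k') \<in> lcls ?f (r, k)} \<noteq> {}" using lcls_self by blast
  fix A assume "A \<in> {lcls ?h (r' * ?g ^ k', k') | r' k'. (r', k') \<in> lcls ?f (r, k)}"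
  then obtain r' k' n where A: "A = lcls ?h (r' * ?g ^ k', k')" "?f ^ n * (r * ?f ^ k' - r' * ?f ^ k) = 0"
    by (auto simp: lcls_mem_iff loc_rel_iff)
  have "?h ^ n * (r' * ?g ^ k' * ?h ^ k - r * ?g ^ k * ?h ^ k')
      = - (?g ^ n * ?g ^ k * ?g ^ k' * (?f ^ n * (r * ?f ^ k' - r' * ?f ^ k)))"
    unfolding xprod_split[OF assms] power_mult_distrib by (simp add: algebra_simps)
  then show "A = lcls ?h (r * ?g ^ k, k)" unfolding A(1) using A(2) by (intro lcls_eqI) simp
qed

lemma lmap_linear:
  assumes T: "finite T" "S \<subseteq> T"
    and A: "A \<in> mcar (loc_mod (xprod xs S))" and B: "B \<in> mcar (loc_mod (xprod xs S))"
  shows "lmap xs S T A \<in> mcar (loc_mod (xprod xs T))"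
    and "lmap xs S T (madd (loc_mod (xprod xs S)) A B)
      = madd (loc_mod (xprod xs T)) (lmap xs S T A) (lmap xs S T B)"
    and "lmap xs S T (msmul (loc_mod (xprod xs S)) a A) = msmul (loc_mod (xprod xs T)) a (lmap xs S T A)"
proof -
  obtain r k s l where AB: "A = lcls (xprod xs S) (r, k)" "B = lcls (xprod xs S) (s, l)"
    using A B by (metis loc_carE)
  show "lmap xs S T A \<in> mcar (loc_mod (xprod xs T))"
    unfolding AB lmap_lcls[OF T] by (rule loc_carI)
  show "lmap xs S T (msmul (loc_mod (xprod xs S)) a A) = msmul (loc_mod (xprod xs T)) a (lmap xs S T A)"
    unfolding AB loc_smul lmap_lcls[OF T] by (simp add: mult.assoc)
  show "lmap xs S T (madd (loc_mod (xprod xs S)) A B)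
      = madd (loc_mod (xprod xs T)) (lmap xs S T A) (lmap xs S T B)"
    unfolding AB loc_add lmap_lcls[OF T]
    by (simp add: xprod_split[OF T] algebra_simps power_add power_mult_distrib)
qed

section \<open>Linearity of the Cech differential\<close>

lemma msum_Cons: "msum M f (j # L) = madd M (f j) (msum M f L)"
  and msum_Nil: "msum M f [] = mzero M"
  by (simp_all add: msum_def)

context
  fixes M :: "('a::comm_ring_1, 'm) rmod"
  assumes M: "rmodule M"
begin

lemma rmodule_interchange:
  assumes "a \<in> mcar M" "b \<in> mcar M" "c \<in> mcar M" "d \<in> mcar M"
  shows "madd M (madd M a b) (madd M c d) = madd M (madd M a c) (madd M b d)"
  using assms by (metis M rmodule_add rmodule_assoc rmodule_comm)

lemma msum_closed: "(\<And>j. j \<in> set L \<Longrightarrow> f j \<in> mcar M) \<Longrightarrow> msum M f L \<in> mcar M"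
  unfolding msum_def by (induction L) (auto simp: rmodule_zero[OF M] intro: rmodule_add[OF M])

lemma msum_add:
  "(\<And>j. j \<in> set L \<Longrightarrow> f j \<in> mcar M) \<Longrightarrow> (\<And>j. j \<in> set L \<Longrightarrow> g j \<in> mcar M) \<Longrightarrow>
    msum M (\<lambda>j. madd M (f j) (g j)) L = madd M (msum M f L) (msum M g L)"
proof (induction L)
  case Nil
  then show ?case by (simp add: msum_Nil rmodule_add_zero[OF M] rmodule_zero[OF M])
next
  case (Cons j L)
  then show ?case by (simp add: msum_Cons rmodule_interchange msum_closed)
qed

lemma msum_smul:
  "(\<And>j. j \<in> set L \<Longrightarrow> f j \<in> mcar M) \<Longrightarrow> msum M (\<lambda>j. msmul M a (f j)) L = msmul M a (msum M f L)"
proof (induction L)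
  case Nil
  then show ?case by (simp add: msum_Nil rmodule_smul_zero[OF M])
next
  case (Cons j L)
  then show ?case by (simp add: msum_Cons rmodule_smul_add[OF M] msum_closed)
qed

end

lemma msum_cong: "(\<And>j. j \<in> set L \<Longrightarrow> f j = g j) \<Longrightarrow> msum M f L = msum M g L"
  unfolding msum_def by (induction L) auto

lemma cidxD: "T \<in> cidx xs (k + 1) \<Longrightarrow> finite T"
  "T \<in> cidx xs (k + 1) \<Longrightarrow> j \<in> T \<Longrightarrow> T - {j} \<in> cidx xs k"
  unfolding cidx_def by (auto intro: finite_subset simp: finite_subset[of T "{..<length xs}"])

definition cech_term :: "'a::comm_ring_1 list \<Rightarrow> (nat set \<Rightarrow> ('a \<times> nat) set) \<Rightarrow> nat set \<Rightarrow> nat \<Rightarrow> ('a \<times> nat) set" where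
  "cech_term xs c T j = msmul (loc_mod (xprod xs T)) ((-1) ^ card {t \<in> T. t < j}) (lmap xs (T - {j}) T (c (T - {j})))"

lemma cech_d_eq:
  "cech_d xs k c T = (if T \<in> cidx xs (k + 1)
    then msum (loc_mod (xprod xs T)) (cech_term xs c T) (sorted_list_of_set T) else {})"
proof -
  have "cech_term xs c T = (\<lambda>j. msmul (loc_mod (xprod xs T)) ((-1) ^ card {t \<in> T. t < j})
      (lmap xs (T - {j}) T (c (T - {j}))))"
    by (rule ext) (simp add: cech_term_def)
  then show ?thesis by (simp add: cech_d_def)
qed

lemma cech_term_linear:
  assumes T: "T \<in> cidx xs (k + 1)" "j \<in> T" and c: "c \<in> mcar (cech_mod xs k)" and d: "d \<in> mcar (cech_mod xs k)"
  shows "cech_term xs c T j \<in> mcar (loc_mod (xprod xs T))"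
    and "cech_term xs (madd (cech_mod xs k) c d) T j
      = madd (loc_mod (xprod xs T)) (cech_term xs c T j) (cech_term xs d T j)"
    and "cech_term xs (msmul (cech_mod xs k) a c) T j = msmul (loc_mod (xprod xs T)) a (cech_term xs c T j)"
proof -
  let ?S = "T - {j}"
  note S = cidxD(2)[OF T]
  note L = loc_module[of "xprod xs T"]
  note lin = lmap_linear[OF cidxD(1)[OF T(1)], of ?S, OF Diff_subset cech_carD[OF c S]]
  note lin2 = lin[OF cech_carD[OF c S]] lin[OF cech_carD[OF d S]]
  have d1: "lmap xs ?S T (d ?S) \<in> mcar (loc_mod (xprod xs T))"
    by (rule lmap_linear(1)[OF cidxD(1)[OF T(1)] Diff_subset cech_carD[OF d S] cech_carD[OF d S]])
  show "cech_term xs c T j \<in> mcar (loc_mod (xprod xs T))"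
    unfolding cech_term_def by (rule rmodule_smul[OF L lin2(1)])
  show "cech_term xs (madd (cech_mod xs k) c d) T j
      = madd (loc_mod (xprod xs T)) (cech_term xs c T j) (cech_term xs d T j)"
    unfolding cech_term_def using S lin2 d1
    by (simp add: cech_mod_def rmodule_smul_add[OF L])
  show "cech_term xs (msmul (cech_mod xs k) a c) T j = msmul (loc_mod (xprod xs T)) a (cech_term xs c T j)"
    unfolding cech_term_def using S lin2
    by (simp add: cech_mod_def rmodule_mult_smul[OF L, symmetric] mult.commute)
qed

lemma cech_d_linear:
  assumes c: "c \<in> mcar (cech_mod xs k)" and d: "d \<in> mcar (cech_mod xs k)"
  shows "cech_d xs k c \<in> mcar (cech_mod xs (k + 1))"
    and "cech_d xs k (madd (cech_mod xs k) c d)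
      = madd (cech_mod xs (k + 1)) (cech_d xs k c) (cech_d xs k d)"
    and "cech_d xs k (msmul (cech_mod xs k) a c) = msmul (cech_mod xs (k + 1)) a (cech_d xs k c)"
proof -
  have set: "set (sorted_list_of_set T) = T" if "T \<in> cidx xs (k + 1)" for T
    using cidxD(1)[OF that] by simp
  show "cech_d xs k c \<in> mcar (cech_mod xs (k + 1))"
    using cech_term_linear(1)[OF _ _ c d] set
    by (auto simp: cech_mod_def cech_d_eq intro!: msum_closed[OF loc_module])
  show "cech_d xs k (madd (cech_mod xs k) c d)
      = madd (cech_mod xs (k + 1)) (cech_d xs k c) (cech_d xs k d)"
  proof
    fix T
    show "cech_d xs k (madd (cech_mod xs k) c d) T = madd (cech_mod xs (k + 1)) (cech_d xs k c) (cech_d xs k d) T"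
    proof (cases "T \<in> cidx xs (k + 1)")
      case True
      let ?L = "loc_mod (xprod xs T)" and ?s = "sorted_list_of_set T"
      have "msum ?L (cech_term xs (madd (cech_mod xs k) c d) T) ?s
        = msum ?L (\<lambda>j. madd ?L (cech_term xs c T j) (cech_term xs d T j)) ?s"
        by (rule msum_cong) (use cech_term_linear(2)[OF True _ c d] set[OF True] in blast)
      also have "\<dots> = madd ?L (msum ?L (cech_term xs c T) ?s) (msum ?L (cech_term xs d T) ?s)"
        by (rule msum_add[OF loc_module])
          (use cech_term_linear(1)[OF True _ c c] cech_term_linear(1)[OF True _ d d] set[OF True] in blast)+
      finally show ?thesis using True by (simp add: cech_d_eq cech_mod_def)
    qed (simp add: cech_d_eq cech_mod_def)
  qed
  show "cech_d xs k (msmul (cech_mod xs k) a c) = msmul (cech_mod xs (k + 1)) a (cech_d xs k c)"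
  proof
    fix T
    show "cech_d xs k (msmul (cech_mod xs k) a c) T = msmul (cech_mod xs (k + 1)) a (cech_d xs k c) T"
    proof (cases "T \<in> cidx xs (k + 1)")
      case True
      let ?L = "loc_mod (xprod xs T)" and ?s = "sorted_list_of_set T"
      have "msum ?L (cech_term xs (msmul (cech_mod xs k) a c) T) ?s
        = msum ?L (\<lambda>j. msmul ?L a (cech_term xs c T j)) ?s"
        by (rule msum_cong) (use cech_term_linear(3)[OF True _ c d] set[OF True] in blast)
      also have "\<dots> = msmul ?L a (msum ?L (cech_term xs c T) ?s)"
        by (rule msum_smul[OF loc_module]) (use cech_term_linear(1)[OF True _ c c] set[OF True] in blast)
      finally show ?thesis using True by (simp add: cech_d_eq cech_mod_def)
    qed (simp add: cech_d_eq cech_mod_def)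
  qed
qed

section \<open>Quotient modules and maps out of them\<close>

definition submodule :: "('a::comm_ring_1, 'm) rmod \<Rightarrow> 'm set \<Rightarrow> bool" where
  "submodule M N \<longleftrightarrow> N \<subseteq> mcar M \<and> mzero M \<in> N \<and> (\<forall>x\<in>N. \<forall>y\<in>N. madd M x y \<in> N) \<and>
    (\<forall>a. \<forall>x\<in>N. msmul M a x \<in> N)"

lemma cech_img_submodule: "submodule (cech_mod xs (k + 1)) (cech_img xs (k + 1))"
proof -
  let ?C = "cech_mod xs k" and ?D = "cech_mod xs (k + 1)"
  have img: "cech_img xs (k + 1) = cech_d xs k ` mcar ?C" by (simp add: cech_img_def)
  note z = rmodule_zero[OF cech_module[of xs k]]
  have "cech_d xs k (msmul ?C 0 (mzero ?C)) = msmul ?D 0 (cech_d xs k (mzero ?C))"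
    by (rule cech_d_linear(3)[OF z z])
  also have "\<dots> = mzero ?D" by (rule rmodule_zero_smul[OF cech_module cech_d_linear(1)[OF z z]])
  finally have "mzero ?D \<in> cech_d xs k ` mcar ?C"
    using rmodule_smul[OF cech_module z] by (metis imageI)
  moreover have "madd ?D x y \<in> cech_d xs k ` mcar ?C"
    if xy: "x \<in> cech_d xs k ` mcar ?C" "y \<in> cech_d xs k ` mcar ?C" for x y
  proof -
    obtain c d where cd: "c \<in> mcar ?C" "d \<in> mcar ?C" "x = cech_d xs k c" "y = cech_d xs k d" using xy by blast
    then have "madd ?D x y = cech_d xs k (madd ?C c d)" using cech_d_linear(2)[OF cd(1,2)] by simp
    then show ?thesis using rmodule_add[OF cech_module cd(1,2)] by blast
  qed
  moreover have "msmul ?D a x \<in> cech_d xs k ` mcar ?C" if x: "x \<in> cech_d xs k ` mcar ?C" for a x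
  proof -
    obtain c where c: "c \<in> mcar ?C" "x = cech_d xs k c" using x by blast
    then have "msmul ?D a x = cech_d xs k (msmul ?C a c)" using cech_d_linear(3)[OF c(1) c(1)] by simp
    then show ?thesis using rmodule_smul[OF cech_module c(1)] by blast
  qed
  moreover have "cech_d xs k ` mcar ?C \<subseteq> mcar ?D" using cech_d_linear(1) by blast
  ultimately show ?thesis unfolding img submodule_def by blast
qed

context
  fixes M :: "('a::comm_ring_1, 'm) rmod" and N
  assumes M: "rmodule M" and N: "submodule M N"
begin

lemma submodule_car: "n \<in> N \<Longrightarrow> n \<in> mcar M"
  and submodule_zero: "mzero M \<in> N"
  and submodule_add: "n \<in> N \<Longrightarrow> n' \<in> N \<Longrightarrow> madd M n n' \<in> N"
  and submodule_smul: "n \<in> N \<Longrightarrow> msmul M a n \<in> N"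
  using N unfolding submodule_def by blast+

lemma rmodule_neg: "x \<in> mcar M \<Longrightarrow> madd M x (msmul M (-1) x) = mzero M"
  using rmodule_add_smul[OF M, of x 1 "-1"] rmodule_one[OF M] rmodule_zero_smul[OF M] by simp

lemma mcoset_self: "x \<in> mcar M \<Longrightarrow> x \<in> mcoset M N x"
  unfolding mcoset_def using submodule_zero rmodule_comm[OF M] rmodule_add_zero[OF M] rmodule_zero[OF M]
  by force

lemma mcoset_shift:
  assumes x: "x \<in> mcar M" and n: "n \<in> N"
  shows "mcoset M N (madd M x n) = mcoset M N x"
proof
  note nc = submodule_car[OF n]
  show "mcoset M N (madd M x n) \<subseteq> mcoset M N x"
    unfolding mcoset_def using rmodule_assoc[OF M x nc submodule_car] submodule_add[OF n] by auto
  show "mcoset M N x \<subseteq> mcoset M N (madd M x n)"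
  proof
    fix y assume "y \<in> mcoset M N x"
    then obtain n' where y: "y \<in> mcar M" "n' \<in> N" "y = madd M x n'" unfolding mcoset_def by blast
    define n'' where "n'' = madd M (msmul M (-1) n) n'"
    have n'': "n'' \<in> N" unfolding n''_def by (intro submodule_add submodule_smul n y(2))
    note n1 = submodule_car[OF submodule_smul[OF n, of "-1"]]
    have "madd M (madd M x n) n'' = madd M x (madd M n n'')"
      using rmodule_assoc[OF M x nc submodule_car[OF n'']] .
    also have "madd M n n'' = madd M (madd M n (msmul M (-1) n)) n'"
      unfolding n''_def using rmodule_assoc[OF M nc n1 submodule_car[OF y(2)]] by simp
    also have "\<dots> = n'" using rmodule_neg[OF nc] rmodule_add_zero[OF M submodule_car[OF y(2)]] by simp
    finally have "y = madd M (madd M x n) n''" using y(3) by simp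
    then show "y \<in> mcoset M N (madd M x n)" unfolding mcoset_def using y(1) n'' by blast
  qed
qed

lemma quot_add:
  assumes x: "x \<in> mcar M" and y: "y \<in> mcar M"
  shows "madd (quot_mod M N) (mcoset M N x) (mcoset M N y) = mcoset M N (madd M x y)"
  unfolding quot_mod_def rmod.simps
proof (rule Union_lcls_eq)
  show "{mcoset M N (madd M u v) | u v. u \<in> mcoset M N x \<and> v \<in> mcoset M N y} \<noteq> {}"
    using mcoset_self[OF x] mcoset_self[OF y] by blast
  fix A assume "A \<in> {mcoset M N (madd M u v) | u v. u \<in> mcoset M N x \<and> v \<in> mcoset M N y}"
  then obtain n n' where A: "A = mcoset M N (madd M (madd M x n) (madd M y n'))" "n \<in> N" "n' \<in> N"
    unfolding mcoset_def by blast
  have "madd M (madd M x n) (madd M y n') = madd M (madd M x y) (madd M n n')"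
    by (rule rmodule_interchange[OF M x submodule_car[OF A(2)] y submodule_car[OF A(3)]])
  then show "A = mcoset M N (madd M x y)"
    unfolding A(1) using mcoset_shift[OF rmodule_add[OF M x y] submodule_add[OF A(2,3)]] by simp
qed

lemma quot_smul:
  assumes x: "x \<in> mcar M"
  shows "msmul (quot_mod M N) a (mcoset M N x) = mcoset M N (msmul M a x)"
  unfolding quot_mod_def rmod.simps
proof (rule Union_lcls_eq)
  show "{mcoset M N (msmul M a u) | u. u \<in> mcoset M N x} \<noteq> {}" using mcoset_self[OF x] by blast
  fix A assume "A \<in> {mcoset M N (msmul M a u) | u. u \<in> mcoset M N x}"
  then obtain n where A: "A = mcoset M N (msmul M a (madd M x n))" "n \<in> N" unfolding mcoset_def by blast
  then show "A = mcoset M N (msmul M a x)"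
    using rmodule_smul_add[OF M x submodule_car[OF A(2)]] mcoset_shift[OF rmodule_smul[OF M x] submodule_smul[OF A(2)]]
    by simp
qed

text \<open>A homomorphism that is zero on \<open>N\<close> is constant on cosets, so the
  representative picked by \<open>SOME\<close> does not matter. Outside the carrier the value is
  \<open>mzero E\<close>, as \<open>lin_map\<close> demands.\<close>

lemma hom_from_quotient:
  assumes E: "rmodule E" and car: "\<And>x. x \<in> mcar M \<Longrightarrow> \<psi> x \<in> mcar E"
    and add: "\<And>x y. x \<in> mcar M \<Longrightarrow> y \<in> mcar M \<Longrightarrow> \<psi> (madd M x y) = madd E (\<psi> x) (\<psi> y)"
    and smul: "\<And>a x. x \<in> mcar M \<Longrightarrow> \<psi> (msmul M a x) = msmul E a (\<psi> x)"
    and ker: "\<And>n. n \<in> N \<Longrightarrow> \<psi> n = mzero E"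
  shows "\<exists>\<phi>. lin_map (quot_mod M N) E \<phi> \<and> (\<forall>x\<in>mcar M. \<phi> (mcoset M N x) = \<psi> x)"
proof -
  define \<phi> where "\<phi> U = (if U \<in> mcar (quot_mod M N) then \<psi> (SOME u. u \<in> U) else mzero E)" for U
  have qcar: "U \<in> mcar (quot_mod M N) \<longleftrightarrow> (\<exists>x\<in>mcar M. U = mcoset M N x)" for U
    unfolding quot_mod_def by auto
  have \<phi>: "\<phi> (mcoset M N x) = \<psi> x" if x: "x \<in> mcar M" for x
  proof -
    have "(SOME u. u \<in> mcoset M N x) \<in> mcoset M N x" using mcoset_self[OF x] by (rule someI)
    then obtain n where n: "n \<in> N" "(SOME u. u \<in> mcoset M N x) = madd M x n" unfolding mcoset_def by blast
    have "\<psi> (madd M x n) = \<psi> x"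
      using add[OF x submodule_car[OF n(1)]] ker[OF n(1)] car[OF x]
        rmodule_comm[OF E car[OF x] rmodule_zero[OF E]] rmodule_add_zero[OF E car[OF x]] by simp
    then show ?thesis unfolding \<phi>_def using n(2) qcar x by auto
  qed
  have "lin_map (quot_mod M N) E \<phi>"
    unfolding lin_map_def
  proof (intro conjI ballI allI impI)
    fix U assume "U \<in> mcar (quot_mod M N)"
    then obtain x where x: "x \<in> mcar M" "U = mcoset M N x" using qcar by blast
    show "\<phi> U \<in> mcar E" unfolding x(2) \<phi>[OF x(1)] by (rule car[OF x(1)])
    show "\<phi> (msmul (quot_mod M N) a U) = msmul E a (\<phi> U)" for a
      unfolding x(2) quot_smul[OF x(1)] \<phi>[OF x(1)] \<phi>[OF rmodule_smul[OF M x(1)]] by (rule smul[OF x(1)])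
    fix V assume "V \<in> mcar (quot_mod M N)"
    then obtain y where y: "y \<in> mcar M" "V = mcoset M N y" using qcar by blast
    show "\<phi> (madd (quot_mod M N) U V) = madd E (\<phi> U) (\<phi> V)"
      unfolding x(2) y(2) quot_add[OF x(1) y(1)] \<phi>[OF x(1)] \<phi>[OF y(1)] \<phi>[OF rmodule_add[OF M x(1) y(1)]]
      by (rule add[OF x(1) y(1)])
  qed (simp add: \<phi>_def)
  then show ?thesis using \<phi> by blast
qed

end

section \<open>Functionals on the top Cech group from compatible sequences\<close>

context
  fixes E :: "('a::comm_ring_1, 'e) rmod" and ys :: "'a list" and g :: "nat \<Rightarrow> 'e"
  assumes E: "rmodule E" and car: "\<And>n. g n \<in> mcar E"
    and step: "\<And>n. msmul E (prod_list ys) (g (Suc n)) = g n"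
    and kill: "\<And>n y. y \<in> set ys \<Longrightarrow> y ^ n \<in> ann E (g n)"
begin

lemma compatible_shift: "msmul E (prod_list ys ^ t) (g (n + t)) = g n"
proof (induction t)
  case 0
  then show ?case using rmodule_one[OF E car] by simp
next
  case (Suc t)
  have "msmul E (prod_list ys ^ Suc t) (g (n + Suc t))
      = msmul E (prod_list ys ^ t) (msmul E (prod_list ys) (g (Suc (n + t))))"
    using rmodule_mult_smul[OF E car, of "prod_list ys ^ t"] by (simp add: mult.commute[of "prod_list ys"])
  then show ?case using Suc step by simp
qed

lemma smul_shift: "msmul E r (g n) = msmul E (r * prod_list ys ^ t) (g (n + t))"
  using rmodule_mult_smul[OF E car] compatible_shift by simp

definition eval_fraction :: "('a \<times> nat) set \<Rightarrow> 'e" where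
  "eval_fraction A = (let q = (SOME q. q \<in> A) in msmul E (fst q) (g (snd q)))"

text \<open>Equal fractions agree after cross-multiplication with powers of the product, and
  \<open>smul_shift\<close> absorbs these powers into the index of \<open>g\<close>.\<close>

lemma eval_fraction_lcls: "eval_fraction (lcls (prod_list ys) (r, k)) = msmul E r (g k)"
proof -
  let ?F = "prod_list ys"
  define q where "q = (SOME q. q \<in> lcls ?F (r, k))"
  have "q \<in> lcls ?F (r, k)" unfolding q_def by (rule someI[of "\<lambda>q. q \<in> lcls ?F (r, k)", OF lcls_self])
  then obtain s l n where q: "q = (s, l)" and n: "?F ^ n * (r * ?F ^ l - s * ?F ^ k) = 0"
    by (cases q) (auto simp: lcls_mem_iff loc_rel_iff)
  have "r * ?F ^ (l + n) = s * ?F ^ (k + n)" using n by (simp add: algebra_simps power_add)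
  then have "msmul E r (g k) = msmul E s (g l)"
    using smul_shift[of r k "l + n"] smul_shift[of s l "k + n"] by (simp add: ac_simps)
  then show ?thesis unfolding eval_fraction_def Let_def q_def[symmetric] q by simp
qed

lemma xprod_all: "xprod ys {..<length ys} = prod_list ys"
  unfolding xprod_def by (simp add: prod.list_conv_set_nth atLeast0LessThan)

lemma cidx_top: "cidx ys (length ys) = {{..<length ys}}"
  unfolding cidx_def using card_subset_eq[of "{..<length ys}"] by auto

lemma eval_fraction_linear:
  assumes "A \<in> mcar (loc_mod (prod_list ys))" "B \<in> mcar (loc_mod (prod_list ys))"
  shows "eval_fraction A \<in> mcar E"
    and "eval_fraction (madd (loc_mod (prod_list ys)) A B) = madd E (eval_fraction A) (eval_fraction B)"
    and "eval_fraction (msmul (loc_mod (prod_list ys)) a A) = msmul E a (eval_fraction A)"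
proof -
  let ?F = "prod_list ys"
  obtain r k s l where AB: "A = lcls ?F (r, k)" "B = lcls ?F (s, l)" using assms by (metis loc_carE)
  show "eval_fraction A \<in> mcar E" unfolding AB eval_fraction_lcls by (rule rmodule_smul[OF E car])
  show "eval_fraction (msmul (loc_mod ?F) a A) = msmul E a (eval_fraction A)"
    unfolding AB loc_smul eval_fraction_lcls by (rule rmodule_mult_smul[OF E car])
  show "eval_fraction (madd (loc_mod ?F) A B) = madd E (eval_fraction A) (eval_fraction B)"
    unfolding AB loc_add eval_fraction_lcls rmodule_add_smul[OF E car]
    using smul_shift[of r k l] smul_shift[of s l k] by (simp add: add.commute)
qed

text \<open>A boundary is a sum of fractions r / f^n in which one \<open>ys ! j\<close> is missing
  from f. Over the full product the numerator gains \<open>(ys ! j) ^ n\<close>, which kills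
  \<open>g n\<close>.\<close>

lemma eval_fraction_image:
  assumes ys: "ys \<noteq> []" and c: "c \<in> cech_img ys (length ys)"
  shows "eval_fraction (c {..<length ys}) = mzero E"
proof -
  let ?T = "{..<length ys}" and ?F = "prod_list ys" and ?k = "length ys - 1"
  have k: "?k + 1 = length ys" using ys by (cases ys) auto
  have T: "?T \<in> cidx ys (?k + 1)" unfolding k cidx_top by simp
  obtain b where b: "b \<in> mcar (cech_mod ys ?k)" "c = cech_d ys ?k b"
    using c ys unfolding cech_img_def by auto
  have term_zero: "eval_fraction (cech_term ys b ?T j) = mzero E" if j: "j \<in> ?T" for j
  proof -
    obtain r n where rn: "b (?T - {j}) = lcls (xprod ys (?T - {j})) (r, n)"
      using cech_carD[OF b(1) cidxD(2)[OF T j]] by (rule loc_carE)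
    have "?T - (?T - {j}) = {j}" using j by auto
    then have x: "xprod ys (?T - (?T - {j})) = ys ! j" by (simp add: xprod_def)
    let ?s = "(- 1) ^ card {t \<in> ?T. t < j}"
    have "cech_term ys b ?T j = lcls ?F (?s * (r * (ys ! j) ^ n), n)"
      unfolding cech_term_def rn lmap_lcls[OF finite_lessThan Diff_subset] x loc_smul xprod_all ..
    moreover have "?s * (r * (ys ! j) ^ n) \<in> ann E (g n)"
      using j by (intro cideal_mult[OF ann_ideal[OF E car]] kill) simp
    ultimately show ?thesis by (simp add: eval_fraction_lcls ann_def)
  qed
  have "eval_fraction (msum (loc_mod ?F) (cech_term ys b ?T) L) = mzero E" if "set L \<subseteq> ?T" for L
    using that
  proof (induction L)
    case Nil
    then show ?case
      by (simp add: msum_Nil loc_zero eval_fraction_lcls rmodule_zero_smul[OF E car])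
  next
    case (Cons j L)
    have L: "cech_term ys b ?T i \<in> mcar (loc_mod ?F)" if "i \<in> ?T" for i
      using cech_term_linear(1)[OF T that b(1) b(1)] unfolding xprod_all .
    have "msum (loc_mod ?F) (cech_term ys b ?T) L \<in> mcar (loc_mod ?F)"
      by (rule msum_closed[OF loc_module]) (use L Cons.prems in auto)
    then show ?case
      using Cons term_zero[of j] L[of j] rmodule_add_zero[OF E rmodule_zero[OF E]]
      by (simp add: msum_Cons eval_fraction_linear(2))
  qed
  from this[of "sorted_list_of_set ?T"] show ?thesis
    unfolding b(2) cech_d_eq using T by (simp add: xprod_all)
qed

text \<open>The top Cech module has a single index set, and it is generated by the fractions 1 / Y^n
  with Y = \<open>prod_list ys\<close>. The functional sends them to the \<open>g n\<close>, so its
  annihilator is the common one.\<close>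

lemma dual_element:
  assumes ys: "ys \<noteq> []"
  shows "\<exists>\<phi>\<in>mcar (matlis_dual (local_coh ys (length ys)) E).
    ann (matlis_dual (local_coh ys (length ys)) E) \<phi> = (\<Inter>n. ann E (g n))"
proof -
  let ?T = "{..<length ys}" and ?F = "prod_list ys" and ?C = "cech_mod ys (length ys)"
    and ?N = "cech_img ys (length ys)" and ?H = "local_coh ys (length ys)"
  have k: "length ys - 1 + 1 = length ys" using ys by (cases ys) auto
  \<comment> \<open>No index set exceeds the whole, so every top cochain is a cocycle.\<close>
  have "cidx ys (length ys + 1) = {}"
  proof (rule equals0I)
    fix S assume "S \<in> cidx ys (length ys + 1)"
    then have "S \<subseteq> {..<length ys}" "card S = length ys + 1" unfolding cidx_def by auto
    then show False using card_mono[OF finite_lessThan, of S "length ys"] by simp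
  qed
  then have "cech_d ys (length ys) c = mzero (cech_mod ys (length ys + 1))" for c
    unfolding cech_d_def cech_mod_def by simp
  then have "cech_ker ys (length ys) = mcar ?C" unfolding cech_ker_def by simp
  then have H: "?H = quot_mod ?C ?N" unfolding local_coh_def by simp
  have N: "submodule ?C ?N" using cech_img_submodule[of ys "length ys - 1"] unfolding k .
  have T: "?T \<in> cidx ys (length ys)" unfolding cidx_top by simp
  have carT: "c ?T \<in> mcar (loc_mod ?F)" if "c \<in> mcar ?C" for c
    using cech_carD[OF that T] unfolding xprod_all .
  define \<psi> where "\<psi> c = eval_fraction (c ?T)" for c
  have "\<exists>\<phi>. lin_map (quot_mod ?C ?N) E \<phi> \<and> (\<forall>x\<in>mcar ?C. \<phi> (mcoset ?C ?N x) = \<psi> x)"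
  proof (rule hom_from_quotient[OF cech_module N E])
    show "\<psi> x \<in> mcar E" if "x \<in> mcar ?C" for x
      unfolding \<psi>_def by (rule eval_fraction_linear(1)[OF carT[OF that] carT[OF that]])
    show "\<psi> (madd ?C x y) = madd E (\<psi> x) (\<psi> y)" if "x \<in> mcar ?C" "y \<in> mcar ?C" for x y
      unfolding \<psi>_def using eval_fraction_linear(2)[OF carT[OF that(1)] carT[OF that(2)]] T
      by (simp add: cech_mod_def xprod_all)
    show "\<psi> (msmul ?C a x) = msmul E a (\<psi> x)" if "x \<in> mcar ?C" for a x
      unfolding \<psi>_def using eval_fraction_linear(3)[OF carT[OF that] carT[OF that]] T
      by (simp add: cech_mod_def xprod_all)
    show "\<psi> n = mzero E" if "n \<in> ?N" for n
      unfolding \<psi>_def by (rule eval_fraction_image[OF ys that])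
  qed
  then obtain \<phi> where \<phi>: "lin_map ?H E \<phi>" "\<And>x. x \<in> mcar ?C \<Longrightarrow> \<phi> (mcoset ?C ?N x) = \<psi> x"
    unfolding H by blast
  have qcar: "U \<in> mcar ?H \<longleftrightarrow> (\<exists>x\<in>mcar ?C. U = mcoset ?C ?N x)" for U
    unfolding H quot_mod_def by auto
  have "ann (matlis_dual ?H E) \<phi> = {a. \<forall>U\<in>mcar ?H. msmul E a (\<phi> U) = mzero E}"
    unfolding ann_def matlis_dual_def hom_mod_def by (auto simp: fun_eq_iff)
  also have "\<dots> = {a. \<forall>x\<in>mcar ?C. msmul E a (\<psi> x) = mzero E}"
  proof (intro Collect_cong iffI ballI)
    fix a x assume "\<forall>U\<in>mcar ?H. msmul E a (\<phi> U) = mzero E" "x \<in> mcar ?C"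
    moreover from this(2) have "mcoset ?C ?N x \<in> mcar ?H" using qcar by blast
    ultimately show "msmul E a (\<psi> x) = mzero E" using \<phi>(2)[of x] by metis
  next
    fix a U assume a: "\<forall>x\<in>mcar ?C. msmul E a (\<psi> x) = mzero E" and "U \<in> mcar ?H"
    then obtain x where "x \<in> mcar ?C" "U = mcoset ?C ?N x" using qcar by blast
    then show "msmul E a (\<phi> U) = mzero E" using \<phi>(2) a by simp
  qed
  also have "\<dots> = (\<Inter>n. ann E (g n))"
  proof (intro equalityI subsetI)
    fix a assume a: "a \<in> {a. \<forall>x\<in>mcar ?C. msmul E a (\<psi> x) = mzero E}"
    have "msmul E a (g n) = mzero E" for n
    proof -
      define c where "c S = (if S = ?T then lcls ?F (1, n) else {})" for S
      have "c \<in> mcar ?C" by (simp add: cech_mod_def cidx_top c_def xprod_all loc_carI)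
      moreover have "\<psi> c = g n" unfolding \<psi>_def c_def by (simp add: eval_fraction_lcls rmodule_one[OF E car])
      ultimately show ?thesis using a by auto
    qed
    then show "a \<in> (\<Inter>n. ann E (g n))" by (simp add: ann_def)
  next
    fix a assume a: "a \<in> (\<Inter>n. ann E (g n))"
    have "msmul E a (\<psi> x) = mzero E" if x: "x \<in> mcar ?C" for x
    proof -
      obtain r n where "x ?T = lcls ?F (r, n)" using carT[OF x] by (rule loc_carE)
      then have "msmul E a (\<psi> x) = msmul E (r * a) (g n)"
        unfolding \<psi>_def using rmodule_mult_smul[OF E car, of a r n] by (simp add: eval_fraction_lcls mult.commute)
      moreover have "r * a \<in> ann E (g n)" using a by (intro cideal_mult[OF ann_ideal[OF E car]]) blast
      ultimately show ?thesis by (simp add: ann_def)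
    qed
    then show "a \<in> {a. \<forall>x\<in>mcar ?C. msmul E a (\<psi> x) = mzero E}" by blast
  qed
  finally have "ann (matlis_dual ?H E) \<phi> = (\<Inter>n. ann E (g n))" .
  moreover have "\<phi> \<in> mcar (matlis_dual ?H E)" using \<phi>(1) by (simp add: matlis_dual_def hom_mod_def)
  ultimately show ?thesis by blast
qed

end

text \<open>Both inclusions are instances, with \<open>ys\<close> any nonempty initial part of a
  system of parameters of R/P.\<close>

theorem part_of_sop_in_ass:
  fixes m :: "'a::comm_ring_1 set" and E :: "('a, 'e) rmod"
  assumes R: "noetherian_ring TYPE('a)" "local_ring m" and E: "inj_hull_residue E m"
    and P: "prime_ideal P" and ys: "ys \<noteq> []"
    and sop: "set (ys @ zs) \<subseteq> m" "enat (length (ys @ zs)) = quot_dim P"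
      "\<And>Q. prime_ideal Q \<Longrightarrow> gen_ideal (P \<union> set (ys @ zs)) \<subseteq> Q \<Longrightarrow> Q = m"
  shows "P \<in> ass (matlis_dual (local_coh ys (length ys)) E)"
proof -
  interpret matlis m "ys @ zs" P E
  proof unfold_locales
    fix Q assume "prime_ideal Q" "P \<subseteq> Q" "set (ys @ zs) \<subseteq> Q"
    then show "Q = m" using sop(3)[of Q] gen_ideal_least[OF prime_cideal] by (metis Un_least)
  qed (use R E P sop in auto)
  obtain g where g: "\<And>n. g n \<in> mcar E" "\<And>n. msmul E (prod_list ys) (g (Suc n)) = g n"
    "\<And>n y. y \<in> set ys \<Longrightarrow> y ^ n \<in> ann E (g n)" "(\<Inter>n. ann E (g n)) = P"
    using dual_seq_part[OF refl ys] by blast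
  from dual_element[OF E_module g(1-3) ys] show ?thesis
    unfolding ass_def g(4) using P by blast
qed

theorem theorem2p5:
  fixes m :: "'a::comm_ring_1 set" and xs :: "'a list" and E :: "('a, 'e) rmod"
  assumes "noetherian_ring TYPE('a)"
    and "local_ring m"
    and "mixed_char m"
    and "inj_hull_residue E m"
  shows "{P. prime_ideal P \<and> part_of_sop m P (of_nat (residue_char m) # xs)}
           \<subseteq> ass (matlis_dual (local_coh (of_nat (residue_char m) # xs) (length xs + 1)) E)
         \<and> (length xs \<ge> 1 \<longrightarrow>
           {P. prime_ideal P \<and> part_of_sop m P (of_nat (residue_char m) # xs)}
           \<subseteq> ass (matlis_dual (local_coh xs (length xs)) E))"
proof (intro conjI impI subsetI)
  let ?p = "of_nat (residue_char m) :: 'a"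
  fix P assume "P \<in> {P. prime_ideal P \<and> part_of_sop m P (?p # xs)}"
  then obtain zs where P: "prime_ideal P" and zs: "set ((?p # xs) @ zs) \<subseteq> m"
    "enat (length ((?p # xs) @ zs)) = quot_dim P"
    "\<And>Q. prime_ideal Q \<Longrightarrow> gen_ideal (P \<union> set ((?p # xs) @ zs)) \<subseteq> Q \<Longrightarrow> Q = m"
    unfolding part_of_sop_def by blast
  show "P \<in> ass (matlis_dual (local_coh (?p # xs) (length xs + 1)) E)"
    using part_of_sop_in_ass[OF assms(1,2,4) P _ zs] by simp
  assume "length xs \<ge> 1"
  then have "xs \<noteq> []" by auto
  \<comment> \<open>For the second inclusion \<open>p\<close> is moved behind \<open>xs\<close> and
    becomes one of the complementary parameters; being a system of parameters does not depend on the
    order.\<close>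
  have perm: "set (xs @ ?p # zs) = set ((?p # xs) @ zs)" "length (xs @ ?p # zs) = length ((?p # xs) @ zs)"
    by auto
  show "P \<in> ass (matlis_dual (local_coh xs (length xs)) E)"
    by (rule part_of_sop_in_ass[OF assms(1,2,4) P \<open>xs \<noteq> []\<close>, of "?p # zs"], unfold perm) (fact zs)+
qed

end
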